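(* Let $n\ge1$ and $\omega\in\mathfrak S_n$. The map sending each $\equiv_\omega$-class $\mathcal L(P)$ to $P$ is an isomorphism from the Hasse diagram of the lattice quotient $[e,\omega]/{\equiv_\omega}$ to the increasing flip graph on $\mathrm{APD}(\omega)$. Consequently, the reflexive and transitive closure of the increasing flip graph on $\mathrm{APD}(\omega)$ is a lattice.
   Context: Permutations of $[n]$ are written in one-line notation. An inversion of $\pi$ is a pair of values $i<j$ with $\pi^{-1}(i)>\pi^{-1}(j)$; the weak order is $\pi\le\sigma$ iff every inversion of $\pi$ is an inversion of $\sigma$, and $[e,\omega]$ is a lattice. Pipe dreams: on the triangular shape of positions $(r,c)$ (row from top, column from left) with $r,c\ge1$, $r+c\le n+1$, each position with $r+c\le n$ is a crossing or a contact and each position with $r+c=n+1$ an elbow, forming $n$ pipes; pipe $j$ enters from the left at row $j$, moves east and north, exits at the top. At a crossing the pipe from the west continues east and the one from the south continues north; at a contact the pipe from the west turns north (northwest pipe) and the pipe from the south turns east (southeast pipe). Two pipes cross at most once. $\mathrm{PD}(\omega)$: pipe dreams with pipe $j$ exiting at column $\omega^{-1}(j)$. Contact graph $P^{\#}$: directed multigraph on $[n]$ with an arc from the northwest to the southeast pipe of each contact; $P$ is acyclic if $P^{\#}$ has no directed cycle; $\mathrm{APD}(\omega)$ is the set of acyclic elements of $\mathrm{PD}(\omega)$. $\mathcal L(P)$ is the set of $\pi\in\mathfrak S_n$ with $\pi^{-1}(i)<\pi^{-1}(j)$ for every arc $i\to j$ of $P^{\#}$. The sets $\mathcal L(P)$,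 $P\in\mathrm{APD}(\omega)$, partition $[e,\omega]$ and define a lattice congruence $\equiv_\omega$ of $[e,\omega]$; the lattice quotient $[e,\omega]/{\equiv_\omega}$ is the lattice on the classes with $X\le Y$ iff there exist $x\in X$, $y\in Y$ with $x\le y$. Flips: a contact $c$ between pipes $i$ and $j$ is flippable if $i$ and $j$ cross at some position $x$; the flip replaces the contact at $c$ by a crossing and the crossing at $x$ by a contact, producing another element of $\mathrm{PD}(\omega)$. The flip is increasing if $c$ is weakly southwest of $x$ (row of $c\ge$ row of $x$, column of $c\le$ column of $x$). The increasing flip graph on $\mathrm{APD}(\omega)$ is the directed graph on $\mathrm{APD}(\omega)$ with an arc $P\to P'$ whenever $P'$ is obtained from $P$ by an increasing flip. *)

theory Defs
  imports
    "HOL-Algebra.Lattice"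
    "HOL-Combinatorics.Permutations"
    "Graph_Theory.Digraph_Isomorphism"
begin

section \<open>Weak order\<close>

text \<open>
  A permutation of \<open>[n]\<close> is a function \<open>\<pi>\<close> with \<open>\<pi> permutes {1..n}\<close>; its one-line notation is
  \<open>\<pi> 1, \<dots>, \<pi> n\<close>, so that \<open>inv \<pi> i\<close> is the place of the value \<open>i\<close>. Inversions are pairs of values.
\<close>

definition inversions :: "nat \<Rightarrow> (nat \<Rightarrow> nat) \<Rightarrow> (nat \<times> nat) set" where
  "inversions n \<pi> = {(i, j). 1 \<le> i \<and> i < j \<and> j \<le> n \<and> inv \<pi> i > inv \<pi> j}"

definition weak_le :: "nat \<Rightarrow> (nat \<Rightarrow> nat) \<Rightarrow> (nat \<Rightarrow> nat) \<Rightarrow> bool" where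
  "weak_le n \<pi> \<sigma> \<longleftrightarrow> inversions n \<pi> \<subseteq> inversions n \<sigma>"

definition weak_interval :: "nat \<Rightarrow> (nat \<Rightarrow> nat) \<Rightarrow> (nat \<Rightarrow> nat) gorder" where
  "weak_interval n \<omega> =
    \<lparr> carrier = {\<pi>. \<pi> permutes {1..n} \<and> weak_le n id \<pi> \<and> weak_le n \<pi> \<omega>},
      eq = (=), le = weak_le n \<rparr>"


section \<open>Pipe dreams\<close>

text \<open>
  Positions are pairs (row, column). A filling of the triangular shape is encoded by its set \<open>P\<close> of
  crossings, a subset of \<open>inner_cells n\<close>; the remaining positions of \<open>inner_cells n\<close> are the contacts.
\<close>

type_synonym position = "nat \<times> nat"

definition inner_cells :: "nat \<Rightarrow> position set" where
  "inner_cells n = {(r, c). 1 \<le> r \<and> 1 \<le> c \<and> r + c \<le> n}"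

definition elbows :: "nat \<Rightarrow> position set" where
  "elbows n = {(r, c). 1 \<le> r \<and> 1 \<le> c \<and> r + c = n + 1}"

definition contacts :: "nat \<Rightarrow> position set \<Rightarrow> position set" where
  "contacts n P = inner_cells n - P"

datatype side = West | South

text \<open>
  \<open>enters n P j x s\<close>: on its way, pipe \<open>j\<close> enters position \<open>x\<close> through side \<open>s\<close>. Row \<open>r\<close> is directly
  north of row \<open>Suc r\<close>.
\<close>

inductive enters :: "nat \<Rightarrow> position set \<Rightarrow> nat \<Rightarrow> position \<Rightarrow> side \<Rightarrow> bool"
  for n :: nat and P :: "position set" and j :: nat where
  start: "1 \<le> j \<Longrightarrow> j \<le> n \<Longrightarrow> enters n P j (j, 1) West"
| cross_east: "enters n P j (r, c) West \<Longrightarrow> (r, c) \<in> P \<Longrightarrow> enters n P j (r, Suc c) West"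
| cross_north: "enters n P j (Suc r, c) South \<Longrightarrow> (Suc r, c) \<in> P \<Longrightarrow> 1 \<le> r
    \<Longrightarrow> enters n P j (r, c) South"
| turn_north: "enters n P j (Suc r, c) West \<Longrightarrow> (Suc r, c) \<in> contacts n P \<union> elbows n \<Longrightarrow> 1 \<le> r
    \<Longrightarrow> enters n P j (r, c) South"
| turn_east: "enters n P j (r, c) South \<Longrightarrow> (r, c) \<in> contacts n P \<Longrightarrow> enters n P j (r, Suc c) West"

definition exits_at :: "nat \<Rightarrow> position set \<Rightarrow> nat \<Rightarrow> nat \<Rightarrow> bool" where
  "exits_at n P j c \<longleftrightarrow>
    enters n P j (1, c) South \<and> (1, c) \<in> P \<or>
    enters n P j (1, c) West \<and> (1, c) \<in> contacts n P \<union> elbows n"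

definition pipes_meet :: "nat \<Rightarrow> position set \<Rightarrow> nat \<Rightarrow> nat \<Rightarrow> position \<Rightarrow> bool" where
  "pipes_meet n P i j x \<longleftrightarrow>
    enters n P i x West \<and> enters n P j x South \<or> enters n P j x West \<and> enters n P i x South"

definition pipes_cross_at :: "nat \<Rightarrow> position set \<Rightarrow> nat \<Rightarrow> nat \<Rightarrow> position \<Rightarrow> bool" where
  "pipes_cross_at n P i j x \<longleftrightarrow> x \<in> P \<and> pipes_meet n P i j x"

definition pipes_touch_at :: "nat \<Rightarrow> position set \<Rightarrow> nat \<Rightarrow> nat \<Rightarrow> position \<Rightarrow> bool" where
  "pipes_touch_at n P i j x \<longleftrightarrow> x \<in> contacts n P \<and> pipes_meet n P i j x"

definition PD :: "nat \<Rightarrow> (nat \<Rightarrow> nat) \<Rightarrow> position set set" where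
  "PD n \<omega> = {P. P \<subseteq> inner_cells n \<and>
    (\<forall>i j x y. pipes_cross_at n P i j x \<and> pipes_cross_at n P i j y \<longrightarrow> x = y) \<and>
    (\<forall>j\<in>{1..n}. exits_at n P j (inv \<omega> j))}"


section \<open>Contact graphs and linear extensions\<close>

text \<open>
  The arc of the contact at \<open>x\<close> is \<open>(x, i, j)\<close>, where \<open>i\<close> is the northwest pipe (the one entering from
  the west) and \<open>j\<close> the southeast pipe; keeping \<open>x\<close> accounts for parallel arcs.
\<close>

definition contact_graph :: "nat \<Rightarrow> position set \<Rightarrow> (nat, position \<times> nat \<times> nat) pre_digraph" where
  "contact_graph n P =
    \<lparr> verts = {1..n},
      arcs = {(x, i, j). x \<in> contacts n P \<and> enters n P i x West \<and> enters n P j x South},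
      tail = (\<lambda>(x, i, j). i), head = (\<lambda>(x, i, j). j) \<rparr>"

definition APD :: "nat \<Rightarrow> (nat \<Rightarrow> nat) \<Rightarrow> position set set" where
  "APD n \<omega> = {P \<in> PD n \<omega>. \<nexists>p. pre_digraph.cycle (contact_graph n P) p}"

definition linear_extensions :: "nat \<Rightarrow> position set \<Rightarrow> (nat \<Rightarrow> nat) set" where
  "linear_extensions n P = {\<pi>. \<pi> permutes {1..n} \<and>
    (\<forall>a \<in> arcs (contact_graph n P).
      inv \<pi> (tail (contact_graph n P) a) < inv \<pi> (head (contact_graph n P) a))}"


section \<open>The lattice quotient and its Hasse diagram\<close>

definition pd_congruence :: "nat \<Rightarrow> (nat \<Rightarrow> nat) \<Rightarrow> ((nat \<Rightarrow> nat) \<times> (nat \<Rightarrow> nat)) set" where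
  "pd_congruence n \<omega> = {(\<pi>, \<sigma>). \<pi> \<in> carrier (weak_interval n \<omega>) \<and> \<sigma> \<in> carrier (weak_interval n \<omega>) \<and>
    (\<exists>P \<in> APD n \<omega>. \<pi> \<in> linear_extensions n P \<and> \<sigma> \<in> linear_extensions n P)}"

definition quotient_order :: "'a gorder \<Rightarrow> ('a \<times> 'a) set \<Rightarrow> 'a set gorder" where
  "quotient_order L R =
    \<lparr> carrier = carrier L // R, eq = (=), le = (\<lambda>X Y. \<exists>x\<in>X. \<exists>y\<in>Y. x \<sqsubseteq>\<^bsub>L\<^esub> y) \<rparr>"

definition pd_quotient :: "nat \<Rightarrow> (nat \<Rightarrow> nat) \<Rightarrow> (nat \<Rightarrow> nat) set gorder" where
  "pd_quotient n \<omega> = quotient_order (weak_interval n \<omega>) (pd_congruence n \<omega>)"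

definition hasse_diagram :: "'a gorder \<Rightarrow> ('a, 'a \<times> 'a) pre_digraph" where
  "hasse_diagram L =
    \<lparr> verts = carrier L,
      arcs = {(x, y). x \<in> carrier L \<and> y \<in> carrier L \<and> x \<sqsubset>\<^bsub>L\<^esub> y \<and>
        \<not> (\<exists>z \<in> carrier L. x \<sqsubset>\<^bsub>L\<^esub> z \<and> z \<sqsubset>\<^bsub>L\<^esub> y)},
      tail = fst, head = snd \<rparr>"


section \<open>Increasing flips\<close>

definition increasing_flip :: "nat \<Rightarrow> position set \<Rightarrow> position set \<Rightarrow> bool" where
  "increasing_flip n P P' \<longleftrightarrow> (\<exists>i j c x. pipes_touch_at n P i j c \<and> pipes_cross_at n P i j x \<and>
    fst c \<ge> fst x \<and> snd c \<le> snd x \<and> P' = insert c (P - {x}))"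

definition increasing_flip_graph ::
    "nat \<Rightarrow> (nat \<Rightarrow> nat) \<Rightarrow> (position set, position set \<times> position set) pre_digraph" where
  "increasing_flip_graph n \<omega> =
    \<lparr> verts = APD n \<omega>,
      arcs = {(P, P'). P \<in> APD n \<omega> \<and> P' \<in> APD n \<omega> \<and> increasing_flip n P P'},
      tail = fst, head = snd \<rparr>"

definition closure_order :: "('a, 'b) pre_digraph \<Rightarrow> 'a gorder" where
  "closure_order G = \<lparr> carrier = verts G, eq = (=), le = reachable G \<rparr>"

text \<open>
  The vertex map sends \<open>linear_extensions n P\<close> to \<open>P\<close>; it is meaningful once \<open>linear_extensions n\<close>
  is injective on \<open>APD n \<omega>\<close>. Arcs are mapped along, with \<open>fst\<close> as tail and \<open>snd\<close> as head.
\<close>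

definition class_to_pd :: "nat \<Rightarrow> (nat \<Rightarrow> nat) \<Rightarrow> (nat \<Rightarrow> nat) set \<Rightarrow> position set" where
  "class_to_pd n \<omega> = the_inv_into (APD n \<omega>) (linear_extensions n)"

definition class_to_pd_iso :: "nat \<Rightarrow> (nat \<Rightarrow> nat) \<Rightarrow>
    ((nat \<Rightarrow> nat) set, (nat \<Rightarrow> nat) set \<times> (nat \<Rightarrow> nat) set,
     position set, position set \<times> position set) digraph_isomorphism" where
  "class_to_pd_iso n \<omega> =
    \<lparr> iso_verts = class_to_pd n \<omega>, iso_arcs = map_prod (class_to_pd n \<omega>) (class_to_pd n \<omega>),
      iso_head = snd, iso_tail = fst \<rparr>"

end

theory Submission
  imports Defs
begin

text \<open>
  Exchanging two adjacent values \<open>i < j\<close> of a linear extension of \<open>P\<close> either stays in the class of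
  \<open>P\<close> or flips the first contact of the pipes \<open>i\<close> and \<open>j\<close>. This step is injective, so uniqueness of
  the pipe dream of a permutation reduces to the top \<open>\<omega>\<close>, and existence to the identity.

  Counting the contacts of a single pipe row by row shows that, for \<open>i < j\<close>, every linear extension has
  \<open>i\<close> before \<open>j\<close> unless the two pipes cross in row \<open>i\<close>; dually it has \<open>j\<close> before \<open>i\<close> if they cross
  left of the exit column of \<open>j\<close>. In an acyclic pipe dream each crossing therefore lies in the starting
  row of its upper pipe or in the exit column of its lower pipe. From this one reads off how a flip
  moves crossings: the pairs crossing in the starting row increase, which makes the largest elements
  of the classes monotone, and only the flipped pair changes from one forced order to the other, which
  makes every flip a cover. Meets and joins of classes come from meets and joins of largest elements.
\<close>

section \<open>Inversion sets\<close>

text \<open>Comparability of classes is defined by the existence of comparable representatives,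
  which is not visibly transitive or antisymmetric, and a flip need not a priori preserve
  acyclicity. Both obstacles are removed by lifting flips to the weak order. Going up from
  \<open>\<pi>\<close> to \<open>\<sigma>\<close> by adjacent exchanges induces a path of increasing
  flips, and every pipe dream on it is acyclic because it carries a linear extension. So comparable
  representatives give a flip path, while a flip path gives nested largest extensions, which are
  comparable representatives: quotient order, flip reachability and the weak order of largest
  extensions are one relation. This already makes every cover a flip; that a flip never factors
  through other flips needs the two families of forced pairs.

  The forced orders come from geometry: the row of a crossing is bounded by the starting rows of its
  pipes and its column by their exit columns. Reflection in the diagonal exchanges the two bounds,
  so one counting argument serves both.\<close>

definition value_pairs :: "nat \<Rightarrow> (nat \<times> nat) set" where
  "value_pairs n = {(i, j). 1 \<le> i \<and> i < j \<and> j \<le> n}"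

lemma finite_value_pairs [simp]: "finite (value_pairs n)"
  by (rule finite_subset[of _ "{1..n} \<times> {1..n}"]) (auto simp: value_pairs_def)

lemma inversions_subset: "inversions n \<pi> \<subseteq> value_pairs n"
  by (auto simp: inversions_def value_pairs_def)

lemma finite_inversions [simp]: "finite (inversions n \<pi>)"
  using finite_subset[OF inversions_subset] by simp

lemma trans_value_pairs: "trans (value_pairs n)"
  by (auto simp: trans_def value_pairs_def)

lemma inv_less_iff:
  assumes "\<pi> permutes {1..n}" "1 \<le> i" "i < j" "j \<le> n"
  shows "inv \<pi> i < inv \<pi> j \<longleftrightarrow> (i, j) \<notin> inversions n \<pi>"
proof -
  have "inv \<pi> i \<noteq> inv \<pi> j"
    using assms permutes_inverses(1)[OF assms(1)] by (metis less_irrefl)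
  then show ?thesis using assms by (auto simp: inversions_def)
qed

lemma inversions_iff:
  "(i, j) \<in> inversions n \<pi> \<longleftrightarrow> 1 \<le> i \<and> i < j \<and> j \<le> n \<and> inv \<pi> j < inv \<pi> i"
  by (auto simp: inversions_def)

lemma trans_inversions: "trans (inversions n \<pi>)"
  by (auto simp: trans_def inversions_def)

lemma trans_noninversions:
  assumes "\<pi> permutes {1..n}"
  shows "trans (value_pairs n - inversions n \<pi>)"
proof (rule transI)
  fix i j k
  assume "(i, j) \<in> value_pairs n - inversions n \<pi>" "(j, k) \<in> value_pairs n - inversions n \<pi>"
  then show "(i, k) \<in> value_pairs n - inversions n \<pi>"
    by (auto simp: value_pairs_def inversions_def)
qed

lemma inv_permutes_in: "\<pi> permutes {1..n::nat} \<Longrightarrow> j \<in> {1..n} \<Longrightarrow> inv \<pi> j \<in> {1..n}"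
  by (metis permutes_in_image permutes_inv)

text \<open>\<open>inv \<pi>\<close> maps the values before \<open>j\<close> bijectively onto the
  places before that of \<open>j\<close>. Hence the relative order of values alone determines a
  permutation.\<close>

lemma inv_eq_card:
  assumes "\<pi> permutes {1..n::nat}" "j \<in> {1..n}"
  shows "inv \<pi> j = Suc (card {u \<in> {1..n}. inv \<pi> u < inv \<pi> j})"
proof -
  have "bij_betw (inv \<pi>) {u \<in> {1..n}. inv \<pi> u < inv \<pi> j} {1..<inv \<pi> j}"
  proof (rule bij_betwI')
    fix y assume "y \<in> {1..<inv \<pi> j}"
    then have "y \<in> {1..n}" using inv_permutes_in[OF assms] by auto
    then have "\<pi> y \<in> {1..n}" using permutes_in_image[OF assms(1)] by blast
    then show "\<exists>x\<in>{u \<in> {1..n}. inv \<pi> u < inv \<pi> j}. y = inv \<pi> x"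
      using \<open>y \<in> {1..<inv \<pi> j}\<close> permutes_inverses(2)[OF assms(1)]
      by (intro bexI[of _ "\<pi> y"]) auto
  next
    fix x assume "x \<in> {u \<in> {1..n}. inv \<pi> u < inv \<pi> j}"
    then show "inv \<pi> x \<in> {1..<inv \<pi> j}"
      using inv_permutes_in[OF assms(1)] by fastforce
  next
    fix x y show "inv \<pi> x = inv \<pi> y \<longleftrightarrow> x = y"
      using permutes_inverses(1)[OF assms(1)] by metis
  qed
  then have "card {u \<in> {1..n}. inv \<pi> u < inv \<pi> j} = inv \<pi> j - 1"
    by (simp add: bij_betw_same_card)
  moreover have "inv \<pi> j \<ge> 1" using inv_permutes_in[OF assms] by simp
  ultimately show ?thesis by simp
qed

lemma inversions_inject:
  assumes \<pi>: "\<pi> permutes {1..n}" and \<sigma>: "\<sigma> permutes {1..n}"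
    and eq: "inversions n \<pi> = inversions n \<sigma>"
  shows "\<pi> = \<sigma>"
proof -
  have less: "inv \<pi> u < inv \<pi> j \<longleftrightarrow> inv \<sigma> u < inv \<sigma> j" if "u \<in> {1..n}" "j \<in> {1..n}" for u j
  proof (cases u j rule: linorder_cases)
    case less
    then show ?thesis using inv_less_iff[OF \<pi>, of u j] inv_less_iff[OF \<sigma>, of u j] eq that by auto
  next
    case greater
    then show ?thesis using inversions_iff[of j u n \<pi>] inversions_iff[of j u n \<sigma>] eq that by auto
  qed simp
  have "inv \<pi> j = inv \<sigma> j" for j
  proof (cases "j \<in> {1..n}")
    case True
    have "{u \<in> {1..n}. inv \<pi> u < inv \<pi> j} = {u \<in> {1..n}. inv \<sigma> u < inv \<sigma> j}"
      using less True by auto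
    then show ?thesis using inv_eq_card[OF \<pi> True] inv_eq_card[OF \<sigma> True] by simp
  next
    case False
    then show ?thesis using permutes_inv[OF \<pi>] permutes_inv[OF \<sigma>] by (metis permutes_not_in)
  qed
  then have "inv \<pi> = inv \<sigma>" by auto
  then show ?thesis by (metis \<pi> \<sigma> permutes_inv_inv)
qed

text \<open>If \<open>f\<close> increases along the places, then \<open>inv f\<close> has no
  inversions, just like the identity.\<close>

lemma strict_mono_on_permutes_id:
  assumes "f permutes {1..n::nat}" "\<And>k. 1 \<le> k \<Longrightarrow> k < n \<Longrightarrow> f k < f (Suc k)"
  shows "f = id"
proof -
  have mono: "f i < f j" if "1 \<le> i" "i < j" "j \<le> n" for i j
    using that(2,3)
  proof (induction j rule: less_induct)
    case (less j)
    show ?case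
    proof (cases "j = Suc i")
      case True then show ?thesis using assms(2) that(1) less.prems by auto
    next
      case False
      then obtain j' where "j = Suc j'" "i < j'" using less.prems by (cases j) auto
      then show ?thesis using less.IH[of j'] assms(2)[of j'] that(1) less.prems by force
    qed
  qed
  have "inversions n (inv f) = inversions n id"
    using mono permutes_inv_inv[OF assms(1)] by (fastforce simp: inversions_def)
  then have "inv f = id" using inversions_inject[OF permutes_inv[OF assms(1)] permutes_id] by blast
  then show ?thesis using permutes_inv_inv[OF assms(1)] by (metis inv_id)
qed

text \<open>
  If every ascent of \<open>\<pi>\<close> were a noninversion of \<open>\<sigma>\<close>, the word of \<open>\<pi>\<close> would be increasing
  with respect to \<open>inv \<sigma>\<close>.
\<close>
lemma exists_ascent:
  assumes \<pi>: "\<pi> permutes {1..n}" and \<sigma>: "\<sigma> permutes {1..n}"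
    and sub: "inversions n \<pi> \<subset> inversions n \<sigma>"
  obtains k where "1 \<le> k" "k < n" "\<pi> k < \<pi> (Suc k)" "(\<pi> k, \<pi> (Suc k)) \<in> inversions n \<sigma>"
proof -
  have "\<exists>k\<ge>1. k < n \<and> \<pi> k < \<pi> (Suc k) \<and> (\<pi> k, \<pi> (Suc k)) \<in> inversions n \<sigma>"
  proof (rule ccontr)
    assume none: "\<not> ?thesis"
    have step: "(inv \<sigma> \<circ> \<pi>) k < (inv \<sigma> \<circ> \<pi>) (Suc k)" if "1 \<le> k" "k < n" for k
    proof -
      have in_n: "\<pi> k \<in> {1..n}" "\<pi> (Suc k) \<in> {1..n}"
        using permutes_in_image[OF \<pi>] that by auto
      have ne: "\<pi> k \<noteq> \<pi> (Suc k)" using permutes_inj[OF \<pi>] by (metis inj_eq n_not_Suc_n)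
      show ?thesis
      proof (cases "\<pi> k < \<pi> (Suc k)")
        case True
        then have "(\<pi> k, \<pi> (Suc k)) \<notin> inversions n \<sigma>" using none that by auto
        then show ?thesis using inv_less_iff[OF \<sigma>, of "\<pi> k" "\<pi> (Suc k)"] True in_n by auto
      next
        case False
        then have "(\<pi> (Suc k), \<pi> k) \<in> inversions n \<pi>"
          using ne in_n permutes_inverses(2)[OF \<pi>] by (auto simp: inversions_def)
        then have "(\<pi> (Suc k), \<pi> k) \<in> inversions n \<sigma>" using sub by auto
        then show ?thesis by (auto simp: inversions_def)
      qed
    qed
    have "inv \<sigma> \<circ> \<pi> = id"
      using permutes_compose[OF \<pi> permutes_inv[OF \<sigma>]] step
      by (rule strict_mono_on_permutes_id)
    then have "\<pi> x = \<sigma> x" for x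
      using permutes_inverses(1)[OF \<sigma>] by (metis comp_apply id_apply)
    then have "\<pi> = \<sigma>" by auto
    then show False using sub by simp
  qed
  then show thesis using that by blast
qed

text \<open>Exchanging two places on the right is exchanging the two values standing there on the
  left; at an ascent this adds a single inversion. Both views are needed: inversions measure
  progress in inductions, the transposition of values matches the exchange of two pipes.\<close>

lemma swap_positions:
  assumes \<pi>: "\<pi> permutes {1..n}" and k: "1 \<le> k" "k < n" and asc: "\<pi> k < \<pi> (Suc k)"
  defines "\<pi>' \<equiv> \<pi> \<circ> transpose k (Suc k)"
  shows "\<pi>' permutes {1..n}" "inversions n \<pi>' = insert (\<pi> k, \<pi> (Suc k)) (inversions n \<pi>)"
    "(\<pi> k, \<pi> (Suc k)) \<notin> inversions n \<pi>" "inv \<pi>' v = inv \<pi> (transpose (\<pi> k) (\<pi> (Suc k)) v)"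
proof -
  have tr: "transpose k (Suc k) permutes {1..n}" by (rule permutes_swap_id) (use k in auto)
  show \<pi>': "\<pi>' permutes {1..n}" unfolding \<pi>'_def by (rule permutes_compose[OF tr \<pi>])
  note i = permutes_inverses[OF \<pi>] permutes_inverses[OF \<pi>']
  have inv': "inv \<pi>' v = transpose k (Suc k) (inv \<pi> v)" for v
  proof -
    have "\<pi>' (transpose k (Suc k) (inv \<pi> v)) = v" unfolding \<pi>'_def by (simp add: i)
    then show ?thesis by (metis i(4))
  qed
  have in_n: "\<pi> k \<in> {1..n}" "\<pi> (Suc k) \<in> {1..n}"
    using permutes_in_image[OF \<pi>] k by auto
  show "(\<pi> k, \<pi> (Suc k)) \<notin> inversions n \<pi>" by (simp add: inversions_def i)
  show "inv \<pi>' v = inv \<pi> (transpose (\<pi> k) (\<pi> (Suc k)) v)"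
    unfolding inv' by (metis i(1) i(2) transpose_apply_first transpose_apply_other transpose_apply_second)
  have "(a, b) \<in> inversions n \<pi>' \<longleftrightarrow> (a, b) = (\<pi> k, \<pi> (Suc k)) \<or> (a, b) \<in> inversions n \<pi>" for a b
  proof -
    define p q where "p = inv \<pi> a" and "q = inv \<pi> b"
    have ab: "a = \<pi> p" "b = \<pi> q" by (simp_all add: p_def q_def i)
    have "transpose k (Suc k) p > transpose k (Suc k) q \<longleftrightarrow> p = k \<and> q = Suc k \<or> p > q \<and> \<not> (p = Suc k \<and> q = k)"
      by (auto simp: transpose_def)
    moreover have "\<pi> p = \<pi> k \<longleftrightarrow> p = k" "\<pi> q = \<pi> (Suc k) \<longleftrightarrow> q = Suc k"
      using permutes_inj[OF \<pi>] by (auto simp: inj_eq)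
    ultimately show ?thesis unfolding inversions_iff inv' p_def[symmetric] q_def[symmetric]
      using in_n asc ab by auto
  qed
  then show "inversions n \<pi>' = insert (\<pi> k, \<pi> (Suc k)) (inversions n \<pi>)" by auto
qed

section \<open>Permutations with prescribed inversions; joins and meets in the weak order\<close>

text \<open>The two transitivities say precisely that "keep the natural order, except on
  \<open>I\<close>" is a strict total order of the values; listing the values in that order gives
  the permutation.\<close>

lemma exists_permutation_of_inversions:
  assumes sub: "I \<subseteq> value_pairs n" and tr: "trans I" and cotr: "trans (value_pairs n - I)"
  obtains \<pi> where "\<pi> permutes {1..n}" "inversions n \<pi> = I"
proof -
  define before where "before u v \<longleftrightarrow> (u < v \<and> (u, v) \<notin> I) \<or> (v < u \<and> (v, u) \<in> I)" for u v
  have irrefl: "\<not> before u u" for u by (simp add: before_def)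
  have total: "before u v \<or> before v u" if "u \<noteq> v" for u v
    using that by (auto simp: before_def)
  have asym: "\<not> before v u" if "before u v" for u v using that by (auto simp: before_def)
  have VP: "(u, v) \<in> value_pairs n" if "u \<in> {1..n}" "v \<in> {1..n}" "u < v" for u v
    using that by (auto simp: value_pairs_def)
  have trn: "before u w" if "before u v" "before v w" "u \<in> {1..n}" "v \<in> {1..n}" "w \<in> {1..n}" for u v w
  proof (rule ccontr)
    assume nb: "\<not> before u w"
    have "u \<noteq> w" using that asym by auto
    then have wu: "before w u" using total nb by auto
    \<comment> \<open>A cycle of \<open>before\<close> on three values can be rotated so that
      \<open>a\<close> is the least. Then \<open>(a, b)\<close> is not inverted and
      \<open>(a, c)\<close> is, and either order of \<open>b\<close> and \<open>c\<close> violates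
      one of the two transitivities.\<close>
    have c: "before a b \<Longrightarrow> before b c \<Longrightarrow> before c a \<Longrightarrow> a < b \<Longrightarrow> a < c \<Longrightarrow>
        a \<in> {1..n} \<Longrightarrow> b \<in> {1..n} \<Longrightarrow> c \<in> {1..n} \<Longrightarrow> False" for a b c
    proof -
      assume h: "before a b" "before b c" "before c a" "a < b" "a < c"
        "a \<in> {1..n}" "b \<in> {1..n}" "c \<in> {1..n}"
      have ab: "(a, b) \<notin> I" and ac: "(a, c) \<in> I" using h by (auto simp: before_def)
      show False
      proof (cases "b < c")
        case True
        then have "(b, c) \<notin> I" using h by (auto simp: before_def)
        then have "(a, c) \<in> value_pairs n - I"
          using ab cotr VP h True by (meson DiffI transD)
        then show False using ac by auto
      next
        case False
        then have "(c, b) \<in> I" using h(2) irrefl by (auto simp: before_def)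
        then show False using tr ab ac by (meson transD)
      qed
    qed
    have "u \<noteq> v" "v \<noteq> w" using that irrefl by auto
    with \<open>u \<noteq> w\<close> consider "u < v \<and> u < w" | "v < u \<and> v < w" | "w < u \<and> w < v" by linarith
    then show False using c[of u v w] c[of v w u] c[of w u v] that wu by cases auto
  qed
  \<comment> \<open>\<open>p\<close> gives the place of a value, so it is the inverse of the
    permutation sought; outside \<open>{1..n}\<close> it must be the identity to count as a
    permutation of that set.\<close>
  define p where "p v = (if v \<in> {1..n} then Suc (card {u \<in> {1..n}. before u v}) else v)" for v
  have p_mono: "p u < p v" if "before u v" "u \<in> {1..n}" "v \<in> {1..n}" for u v
  proof -
    have "{x \<in> {1..n}. before x u} \<subset> {x \<in> {1..n}. before x v}"
    proof (rule psubsetI)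
      show "{x \<in> {1..n}. before x u} \<subseteq> {x \<in> {1..n}. before x v}" using that trn by blast
      have "u \<in> {x \<in> {1..n}. before x v}" "u \<notin> {x \<in> {1..n}. before x u}" using that irrefl by auto
      then show "{x \<in> {1..n}. before x u} \<noteq> {x \<in> {1..n}. before x v}" by blast
    qed
    then have "card {x \<in> {1..n}. before x u} < card {x \<in> {1..n}. before x v}"
      by (intro psubset_card_mono) auto
    then show ?thesis using that by (simp add: p_def)
  qed
  have inj: "inj_on p {1..n}" using p_mono total by (metis inj_onI less_irrefl)
  have "p v \<in> {1..n}" if "v \<in> {1..n}" for v
  proof -
    have "{u \<in> {1..n}. before u v} \<subset> {1..n}" using that irrefl[of v] by blast
    then have "card {u \<in> {1..n}. before u v} < card {1..n}" by (intro psubset_card_mono) auto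
    then show ?thesis using that by (auto simp: p_def)
  qed
  then have "p ` {1..n} \<subseteq> {1..n}" by blast
  then have "bij_betw p {1..n} {1..n}"
    using inj by (simp add: bij_betw_def endo_inj_surj)
  then have pp: "p permutes {1..n}" by (rule bij_imp_permutes) (auto simp: p_def)
  have "p i < p j \<longleftrightarrow> before i j" if "i \<in> {1..n}" "j \<in> {1..n}" for i j
    using p_mono that total by (metis less_asym less_irrefl)
  then have "inversions n (inv p) = I"
    using sub unfolding inversions_def permutes_inv_inv[OF pp]
    by (auto simp: before_def value_pairs_def)
  then show thesis using that permutes_inv[OF pp] by blast
qed

text \<open>A value \<open>j\<close> strictly between the ends of an increasing
  \<open>C\<close>-path is a vertex of the path or lies inside one of its steps, and such a step
  splits at \<open>j\<close> by hypothesis.\<close>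

lemma trans_diff_trancl:
  assumes sub: "C \<subseteq> value_pairs n" and cotr: "trans (value_pairs n - C)"
  shows "C\<^sup>+ \<subseteq> value_pairs n" "trans (value_pairs n - C\<^sup>+)"
proof -
  show sub': "C\<^sup>+ \<subseteq> value_pairs n"
    using trancl_mono_subset[OF sub] trancl_id[OF trans_value_pairs] by auto
  have co: "(i, j) \<in> C \<or> (j, k) \<in> C" if "(i, k) \<in> C" "i < j" "j < k" for i j k
    using transD[OF cotr, of i j k] that sub by (auto simp: value_pairs_def)
  have "(i, j) \<in> C\<^sup>+ \<or> (j, k) \<in> C\<^sup>+" if "(i, k) \<in> C\<^sup>+" "i < j" "j < k" for i j k
    using that
  proof (induction arbitrary: j rule: trancl_induct)
    case (base k)
    then show ?case using co by blast
  next
    case (step m k)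
    consider "j < m" | "j = m" | "m < j" by linarith
    then show ?case
    proof cases
      case 1
      then show ?thesis using step by (meson trancl_into_trancl)
    next
      case 2
      then show ?thesis using step by blast
    next
      case 3
      then show ?thesis using step co by (meson r_into_trancl trancl_into_trancl)
    qed
  qed
  then show "trans (value_pairs n - C\<^sup>+)"
    using trans_value_pairs[of n] by (auto simp: trans_def value_pairs_def)
qed

lemma inversions_trancl:
  assumes "C \<subseteq> value_pairs n" "trans (value_pairs n - C)"
  obtains \<pi> where "\<pi> permutes {1..n}" "inversions n \<pi> = C\<^sup>+"
  using exists_permutation_of_inversions trans_diff_trancl[OF assms] trans_trancl by metis

lemma inversions_diff_trancl:
  assumes "C \<subseteq> value_pairs n" "trans (value_pairs n - C)"
  obtains \<pi> where "\<pi> permutes {1..n}" "inversions n \<pi> = value_pairs n - C\<^sup>+"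
proof -
  have "value_pairs n - (value_pairs n - C\<^sup>+) = C\<^sup>+" using trans_diff_trancl(1)[OF assms] by auto
  then show thesis
    using exists_permutation_of_inversions[of "value_pairs n - C\<^sup>+" n] trans_diff_trancl(2)[OF assms]
      that by auto
qed

text \<open>The complement of a union of inversion sets is an intersection of transitive relations,
  so only transitivity of the union itself has to be repaired, by closing it.\<close>

lemma weak_join:
  assumes "\<pi> permutes {1..n}" "\<sigma> permutes {1..n}"
  obtains \<rho> where "\<rho> permutes {1..n}"
    "\<And>\<tau>. inversions n \<rho> \<subseteq> inversions n \<tau> \<longleftrightarrow>
      inversions n \<pi> \<subseteq> inversions n \<tau> \<and> inversions n \<sigma> \<subseteq> inversions n \<tau>"
proof -
  let ?C = "inversions n \<pi> \<union> inversions n \<sigma>"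
  have "value_pairs n - ?C = (value_pairs n - inversions n \<pi>) \<inter> (value_pairs n - inversions n \<sigma>)"
    by auto
  then have "trans (value_pairs n - ?C)" using trans_Int[OF trans_noninversions trans_noninversions] assms by metis
  then obtain \<rho> where \<rho>: "\<rho> permutes {1..n}" "inversions n \<rho> = ?C\<^sup>+"
    using inversions_trancl[of ?C n] inversions_subset by auto
  have "?C\<^sup>+ \<subseteq> inversions n \<tau> \<longleftrightarrow> ?C \<subseteq> inversions n \<tau>" for \<tau>
    using trancl_mono_subset[of ?C "inversions n \<tau>"] trancl_id[OF trans_inversions[of n \<tau>]] by auto
  then show thesis using that \<rho> by auto
qed

text \<open>Dual to the join: here the union of the noninversions is closed transitively.\<close>

lemma weak_meet:
  assumes "\<pi> permutes {1..n}" "\<sigma> permutes {1..n}"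
  obtains \<rho> where "\<rho> permutes {1..n}"
    "\<And>\<tau>. \<tau> permutes {1..n} \<Longrightarrow> inversions n \<tau> \<subseteq> inversions n \<rho> \<longleftrightarrow>
      inversions n \<tau> \<subseteq> inversions n \<pi> \<and> inversions n \<tau> \<subseteq> inversions n \<sigma>"
proof -
  let ?C = "value_pairs n - inversions n \<pi> \<inter> inversions n \<sigma>"
  have eq: "value_pairs n - ?C = inversions n \<pi> \<inter> inversions n \<sigma>"
    using inversions_subset[of n \<pi>] by auto
  have "trans (value_pairs n - ?C)" unfolding eq by (intro trans_Int trans_inversions)
  then obtain \<rho> where \<rho>: "\<rho> permutes {1..n}" "inversions n \<rho> = value_pairs n - ?C\<^sup>+"
    using inversions_diff_trancl[of ?C n] by auto
  have "inversions n \<tau> \<subseteq> inversions n \<rho> \<longleftrightarrow>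
      inversions n \<tau> \<subseteq> inversions n \<pi> \<and> inversions n \<tau> \<subseteq> inversions n \<sigma>"
    if \<tau>: "\<tau> permutes {1..n}" for \<tau>
  proof
    assume "inversions n \<tau> \<subseteq> inversions n \<rho>"
    then show "inversions n \<tau> \<subseteq> inversions n \<pi> \<and> inversions n \<tau> \<subseteq> inversions n \<sigma>"
      using \<rho>(2) r_into_trancl[of _ ?C] by (auto 0 3)
  next
    assume "inversions n \<tau> \<subseteq> inversions n \<pi> \<and> inversions n \<tau> \<subseteq> inversions n \<sigma>"
    then have "?C \<subseteq> value_pairs n - inversions n \<tau>" by blast
    then have "?C\<^sup>+ \<subseteq> value_pairs n - inversions n \<tau>"
      using trancl_mono_subset trancl_id[OF trans_noninversions[OF \<tau>]] by metis
    then show "inversions n \<tau> \<subseteq> inversions n \<rho>"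
      using \<rho>(2) inversions_subset[of n \<tau>] by blast
  qed
  then show thesis using that \<rho> by auto
qed

section \<open>Pipe dreams as sorting networks\<close>

text \<open>
  Each step of a pipe, east or north, increases column minus row by one; this is the time. The level
  of a pipe entering \<open>(r, c)\<close> is \<open>r + c\<close> from the west and \<open>r + c + 1\<close> from the south. A contact
  preserves the levels of its two pipes and a crossing exchanges them. Levels are extended to all
  times: a pipe rests at its initial level before it starts and at its final level after its exit.
\<close>

definition cell_time :: "nat \<Rightarrow> position \<Rightarrow> nat" where
  "cell_time n x = snd x + n - fst x"

text \<open>The condition \<open>c + n = r + t\<close> is \<open>cell_time n (r, c) = t\<close>
  without truncated subtraction. Cells of one time have levels \<open>r + c\<close> of equal parity,
  so each step is a product of disjoint adjacent transpositions of levels.\<close>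

definition cross_step :: "nat \<Rightarrow> position set \<Rightarrow> nat \<Rightarrow> nat \<Rightarrow> nat" where
  "cross_step n P t l =
    (if \<exists>r c. (r, c) \<in> P \<and> r + c = l \<and> c + n = r + t then Suc l
     else if \<exists>r c. (r, c) \<in> P \<and> Suc (r + c) = l \<and> c + n = r + t then l - 1 else l)"

primrec level :: "nat \<Rightarrow> position set \<Rightarrow> nat \<Rightarrow> nat \<Rightarrow> nat" where
  "level n P 0 j = Suc j"
| "level n P (Suc t) j = cross_step n P t (level n P t j)"

fun side_offset :: "side \<Rightarrow> nat" where
  "side_offset West = 0"
| "side_offset South = 1"

lemma cross_step_west:
  assumes t: "c + n = r + t"
  shows "cross_step n P t (r + c) = (if (r, c) \<in> P then Suc (r + c) else r + c)"
proof -
  have eq: "r' = r" "c' = c" if "r' + c' = r + c" "c' + n = r' + t" for r' c'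
    using that t by linarith+
  have 1: "(\<exists>r' c'. (r', c') \<in> P \<and> r' + c' = r + c \<and> c' + n = r' + t) \<longleftrightarrow> (r, c) \<in> P"
    (is "?L \<longleftrightarrow> _")
  proof
    assume ?L
    then show "(r, c) \<in> P" using eq by force
  qed (use t in auto)
  \<comment> \<open>Parity: the west level of a cell is never the south level of another cell of the
    same time.\<close>
  have "Suc (r' + c') \<noteq> r + c" if "c' + n = r' + t" for r' c'
  proof
    assume "Suc (r' + c') = r + c"
    then have "Suc (2 * c') = 2 * c" using that t by linarith
    then show False by presburger
  qed
  then have 2: "\<not> (\<exists>r' c'. (r', c') \<in> P \<and> Suc (r' + c') = r + c \<and> c' + n = r' + t)"
    by metis
  show ?thesis by (simp only: cross_step_def 1 2 if_False diff_Suc_1)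
qed

lemma cross_step_south:
  assumes t: "c + n = r + t"
  shows "cross_step n P t (Suc (r + c)) = (if (r, c) \<in> P then r + c else Suc (r + c))"
proof -
  have eq: "r' = r" "c' = c" if "Suc (r' + c') = Suc (r + c)" "c' + n = r' + t" for r' c'
    using that t by linarith+
  have 1: "(\<exists>r' c'. (r', c') \<in> P \<and> Suc (r' + c') = Suc (r + c) \<and> c' + n = r' + t) \<longleftrightarrow> (r, c) \<in> P"
    (is "?L \<longleftrightarrow> _")
  proof
    assume ?L
    then show "(r, c) \<in> P" using eq by force
  qed (use t in auto)
  have "r' + c' \<noteq> Suc (r + c)" if "c' + n = r' + t" for r' c'
  proof
    assume "r' + c' = Suc (r + c)"
    then have "2 * c' = Suc (2 * c)" using that t by linarith
    then show False by presburger
  qed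
  then have 2: "\<not> (\<exists>r' c'. (r', c') \<in> P \<and> r' + c' = Suc (r + c) \<and> c' + n = r' + t)"
    by metis
  show ?thesis by (simp only: cross_step_def 1 2 if_False diff_Suc_1)
qed

lemma cross_step_other:
  assumes "\<And>r c. (r, c) \<in> P \<Longrightarrow> c + n = r + t \<Longrightarrow> l \<noteq> r + c \<and> l \<noteq> Suc (r + c)"
  shows "cross_step n P t l = l"
  using assms unfolding cross_step_def by metis

lemma cross_step_cases [consumes 0, case_names west south other]:
  obtains (west) r c where "(r, c) \<in> P" "c + n = r + t" "l = r + c" "cross_step n P t l = Suc (r + c)"
  | (south) r c where "(r, c) \<in> P" "c + n = r + t" "l = Suc (r + c)" "cross_step n P t l = r + c"
  | (other) "\<And>r c. (r, c) \<in> P \<Longrightarrow> c + n = r + t \<Longrightarrow> l \<noteq> r + c \<and> l \<noteq> Suc (r + c)"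
      "cross_step n P t l = l"
proof -
  consider (a) r c where "(r, c) \<in> P" "c + n = r + t" "l = r + c"
    | (b) r c where "(r, c) \<in> P" "c + n = r + t" "l = Suc (r + c)"
    | (c) "\<And>r c. (r, c) \<in> P \<Longrightarrow> c + n = r + t \<Longrightarrow> l \<noteq> r + c \<and> l \<noteq> Suc (r + c)"
    by blast
  then show thesis
  proof cases
    case a
    then show ?thesis using west cross_step_west[OF a(2), of P] by simp
  next
    case b
    then show ?thesis using south cross_step_south[OF b(2), of P] by simp
  next
    case c
    then show ?thesis using other cross_step_other[OF c] by simp
  qed
qed

lemma cross_step_involution: "cross_step n P t (cross_step n P t l) = l"
  by (rule cross_step_cases[where n = n and P = P and t = t and l = l]) (simp_all add: cross_step_west cross_step_south)

lemma cross_step_inject: "cross_step n P t l = cross_step n P t l' \<longleftrightarrow> l = l'"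
  by (metis cross_step_involution)

lemma cross_step_le: "cross_step n P t l \<le> Suc l" "l \<le> Suc (cross_step n P t l)"
  by (rule cross_step_cases[where n = n and P = P and t = t and l = l]; simp)+

lemma level_inject: "level n P t i = level n P t j \<longleftrightarrow> i = j"
  by (induction t) (simp_all add: cross_step_inject)

lemma level_back: "level n P t j = cross_step n P t (level n P (Suc t) j)"
  by (simp add: cross_step_involution)

lemma level_mono:
  assumes "t \<le> t'"
  shows "level n P t j + t \<le> level n P t' j + t'" "level n P t' j + t \<le> level n P t j + t'"
  using assms
proof (induction t' rule: dec_induct)
  case (step m)
  { case 1 show ?case using step.IH(1) cross_step_le(2)[of "level n P m j" n P m] by simp }
  { case 2 show ?case using step.IH(2) cross_step_le(1)[of n P m "level n P m j"] by simp }
qed simp_all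

lemma level_in:
  assumes P: "P \<subseteq> inner_cells n" and "j \<in> {1..n}"
  shows "level n P t j \<in> {2..Suc n}"
proof (induction t)
  case (Suc t)
  then show ?case using P
    by - (rule cross_step_cases[where n = n and P = P and t = t and l = "level n P t j"],
        auto simp: inner_cells_def)
qed (use assms in simp)

lemma level_surj:
  assumes P: "P \<subseteq> inner_cells n" and "l \<in> {2..Suc n}"
  obtains j where "j \<in> {1..n}" "level n P t j = l"
proof -
  have "level n P t ` {1..n} \<subseteq> {2..Suc n}" using level_in[OF P] by blast
  moreover have "card (level n P t ` {1..n}) = card {2..Suc n}"
    by (subst card_image) (auto simp: inj_on_def level_inject)
  ultimately have "level n P t ` {1..n} = {2..Suc n}" by (intro card_subset_eq) auto
  then show thesis using assms(2) that by (metis imageE)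
qed

text \<open>Pipe \<open>j\<close> enters at time \<open>Suc n - j\<close>. Cells of earlier times
  satisfy \<open>r \<ge> c + j\<close>, so their levels exceed \<open>Suc j\<close>.\<close>

lemma level_before_start:
  assumes P: "P \<subseteq> inner_cells n"
  shows "t + j \<le> Suc n \<Longrightarrow> level n P t j = Suc j"
proof (induction t)
  case (Suc t)
  then have l: "level n P t j = Suc j" by simp
  have "cross_step n P t (Suc j) = Suc j"
  proof (rule cross_step_other)
    fix r c assume "(r, c) \<in> P" "c + n = r + t"
    then show "Suc j \<noteq> r + c \<and> Suc j \<noteq> Suc (r + c)" using P Suc.prems by (auto simp: inner_cells_def)
  qed
  then show ?case using l by simp
qed simp

text \<open>A cell of time at least \<open>e + n\<close> has \<open>c \<ge> r + e\<close>, so its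
  levels exceed \<open>Suc e\<close>.\<close>

lemma level_after_exit:
  assumes P: "P \<subseteq> inner_cells n" and l: "level n P t j = Suc e" and t: "e + n \<le> t" "t \<le> t'"
  shows "level n P t' j = Suc e"
  using t(2)
proof (induction t' rule: dec_induct)
  case (step m)
  have "cross_step n P m (Suc e) = Suc e"
  proof (rule cross_step_other)
    fix r c assume "(r, c) \<in> P" "c + n = r + m"
    then show "Suc e \<noteq> r + c \<and> Suc e \<noteq> Suc (r + c)" using P t step.hyps by (auto simp: inner_cells_def)
  qed
  then show ?case using step.IH by simp
qed (rule l)

section \<open>Translation between paths of pipes and levels\<close>

text \<open>The bounds travel in the same induction because they keep \<open>cell_time\<close> free
  of truncation. The bound on the row is the geometric input of the later counting: no pipe ever
  goes below its starting row.\<close>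

lemma enters_imp_level:
  assumes P: "P \<subseteq> inner_cells n" and "enters n P j x s"
  shows "1 \<le> j \<and> j \<le> n \<and> 1 \<le> fst x \<and> 1 \<le> snd x \<and> fst x + snd x + side_offset s \<le> Suc n \<and>
    fst x + side_offset s \<le> j \<and> level n P (cell_time n x) j = fst x + snd x + side_offset s"
  using assms(2)
proof induction
  case start
  then show ?case using level_before_start[OF P, of "Suc n - j" j] by (simp add: cell_time_def)
next
  case (cross_east r c)
  have "r + c \<le> n" using P cross_east by (auto simp: inner_cells_def)
  moreover have "cell_time n (r, Suc c) = Suc (cell_time n (r, c))" using calculation by (simp add: cell_time_def)
  ultimately show ?case using cross_east cross_step_west[of c n r "cell_time n (r, c)" P]
    by (simp add: cell_time_def)
next
  case (cross_north r c)
  have "Suc r + c \<le> n" using P cross_north by (auto simp: inner_cells_def)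
  moreover have "cell_time n (r, c) = Suc (cell_time n (Suc r, c))" using calculation by (simp add: cell_time_def)
  ultimately show ?case using cross_north cross_step_south[of c n "Suc r" "cell_time n (Suc r, c)" P]
    by (simp add: cell_time_def)
next
  case (turn_north r c)
  have "(Suc r, c) \<notin> P" using P turn_north by (auto simp: inner_cells_def contacts_def elbows_def)
  moreover have "cell_time n (r, c) = Suc (cell_time n (Suc r, c))" using turn_north.IH by (simp add: cell_time_def Suc_diff_Suc)
  ultimately show ?case using turn_north cross_step_west[of c n "Suc r" "cell_time n (Suc r, c)" P]
    by (simp add: cell_time_def)
next
  case (turn_east r c)
  have "r + c \<le> n" "(r, c) \<notin> P" using turn_east by (auto simp: inner_cells_def contacts_def)
  moreover have "cell_time n (r, Suc c) = Suc (cell_time n (r, c))" using calculation by (simp add: cell_time_def)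
  ultimately show ?case using turn_east cross_step_south[of c n r "cell_time n (r, c)" P]
    by (simp add: cell_time_def)
qed

lemma level_imp_enters:
  assumes P: "P \<subseteq> inner_cells n" and j: "1 \<le> j" "j \<le> n"
  shows "c + n = r + t \<Longrightarrow> 1 \<le> r \<Longrightarrow> 1 \<le> c \<Longrightarrow> r + c + side_offset s \<le> Suc n \<Longrightarrow>
    level n P t j = r + c + side_offset s \<Longrightarrow> enters n P j (r, c) s"
proof (induction t arbitrary: r c s)
  case (Suc t)
  show ?case
  proof (cases s)
    case West
    show ?thesis
    proof (cases "c = 1")
      \<comment> \<open>In the first column there is no western neighbour to come from; distinctness
        of levels identifies the pipe as the one that starts here.\<close>
      case True
      then have "Suc t + r \<le> Suc n" using Suc.prems by simp
      then have "level n P (Suc t) r = Suc r" by (rule level_before_start[OF P])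
      then have "j = r" using Suc.prems(5) True West level_inject[of n P "Suc t" j r] by simp
      then show ?thesis using enters.start[of r n P] True West j by simp
    next
      case False
      then obtain d where d: "c = Suc d" "1 \<le> d" using Suc.prems by (cases c) auto
      have t: "d + n = r + t" using Suc.prems d by simp
      have prev: "level n P t j = cross_step n P t (Suc (r + d))"
        using level_back[of n P t j] Suc.prems(5) West d by simp
      show ?thesis
      proof (cases "(r, d) \<in> P")
        case True
        then have "level n P t j = r + d + side_offset West" using prev cross_step_south[OF t] by simp
        then have "enters n P j (r, d) West" using Suc.IH[of d r West] Suc.prems d t by simp
        then show ?thesis using True West d by (simp add: enters.cross_east)
      next
        case False
        then have "level n P t j = r + d + side_offset South" using prev cross_step_south[OF t] by simp
        then have "enters n P j (r, d) South"
          using Suc.IH[of d r South] Suc.prems d t West by simp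
        moreover have "(r, d) \<in> contacts n P"
          using False Suc.prems d West by (auto simp: contacts_def inner_cells_def)
        ultimately show ?thesis using West d by (simp add: enters.turn_east)
      qed
    qed
  next
    case South
    have t: "c + n = Suc r + t" using Suc.prems by simp
    have prev: "level n P t j = cross_step n P t (Suc r + c)"
      using level_back[of n P t j] Suc.prems(5) South by simp
    show ?thesis
    proof (cases "(Suc r, c) \<in> P")
      case True
      then have "level n P t j = Suc r + c + side_offset South" using prev cross_step_west[OF t] by simp
      moreover have "Suc r + c \<le> n" using True P by (auto simp: inner_cells_def)
      ultimately have "enters n P j (Suc r, c) South"
        using Suc.IH[of c "Suc r" South] Suc.prems t by simp
      then show ?thesis using True South Suc.prems by (simp add: enters.cross_north)
    next
      case False
      then have "level n P t j = Suc r + c + side_offset West" using prev cross_step_west[OF t] by simp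
      then have "enters n P j (Suc r, c) West"
        using Suc.IH[of c "Suc r" West] Suc.prems t South by simp
      moreover have "(Suc r, c) \<in> contacts n P \<union> elbows n"
        using False Suc.prems South by (auto simp: contacts_def inner_cells_def elbows_def)
      ultimately show ?thesis using South Suc.prems by (auto intro: enters.turn_north)
    qed
  qed
qed (use j in auto)

lemma enters_iff:
  assumes "P \<subseteq> inner_cells n"
  shows "enters n P j x s \<longleftrightarrow> 1 \<le> j \<and> j \<le> n \<and> 1 \<le> fst x \<and> 1 \<le> snd x \<and>
    fst x + snd x + side_offset s \<le> Suc n \<and> level n P (cell_time n x) j = fst x + snd x + side_offset s"
  using enters_imp_level[OF assms, of j x s]
    level_imp_enters[OF assms, of j "snd x" "fst x" "cell_time n x" s]
  by (cases x) (auto simp: cell_time_def)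

lemma exits_at_iff:
  assumes P: "P \<subseteq> inner_cells n" and c: "1 \<le> c" "c \<le> n"
  shows "exits_at n P j c \<longleftrightarrow> 1 \<le> j \<and> j \<le> n \<and> level n P (2 * n) j = Suc c"
proof -
  define t where "t = c + n - 1"
  have t: "c + n = 1 + t" "cell_time n (1, c) = t" "Suc t = c + n" using c by (auto simp: t_def cell_time_def)
  have "(1, c) \<in> contacts n P \<union> elbows n \<longleftrightarrow> (1, c) \<notin> P"
    using c P by (auto simp: contacts_def elbows_def inner_cells_def)
  moreover have "Suc c \<le> n" if "(1, c) \<in> P" using that P by (auto simp: inner_cells_def)
  ultimately have "exits_at n P j c \<longleftrightarrow> 1 \<le> j \<and> j \<le> n \<and>
      ((1, c) \<in> P \<and> level n P t j = Suc (1 + c) \<or> (1, c) \<notin> P \<and> level n P t j = 1 + c)"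
    using c t by (auto simp: exits_at_def enters_iff[OF P])
  also have "\<dots> \<longleftrightarrow> 1 \<le> j \<and> j \<le> n \<and> level n P t j = cross_step n P t (1 + c)"
    using cross_step_west[OF t(1), of P] by auto
  also have "\<dots> \<longleftrightarrow> 1 \<le> j \<and> j \<le> n \<and> level n P (c + n) j = Suc c"
    unfolding t(3)[symmetric] level.simps(2) using cross_step_involution by (metis plus_1_eq_Suc)
  \<comment> \<open>A pipe at its exit level rests there until \<open>2 * n\<close>. Conversely,
    some pipe holds this level at time \<open>c + n\<close> and keeps it, and at time
    \<open>2 * n\<close> levels are still distinct.\<close>
  also have "\<dots> \<longleftrightarrow> 1 \<le> j \<and> j \<le> n \<and> level n P (2 * n) j = Suc c"
  proof -
    have "level n P (2 * n) j = Suc c" if "level n P (c + n) j = Suc c" for j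
      by (rule level_after_exit[OF P that]) (use c in auto)
    moreover obtain k where "level n P (c + n) k = Suc c" using level_surj[OF P, of "Suc c"] c by auto
    ultimately show ?thesis by (metis level_inject)
  qed
  finally show ?thesis .
qed

lemma enters_row_le:
  assumes "P \<subseteq> inner_cells n" "enters n P j x s"
  shows "fst x + side_offset s \<le> j"
  using enters_imp_level[OF assms] by simp

lemma enters_unique:
  assumes P: "P \<subseteq> inner_cells n" and "enters n P i x s" "enters n P j x s"
  shows "i = j"
  using assms(2,3) enters_iff[OF P] level_inject by metis

text \<open>Time fixes the difference of the coordinates and the level their sum up to the offset,
  so parity separates the two sides.\<close>

lemma enters_same_time:
  assumes P: "P \<subseteq> inner_cells n" and e: "enters n P j x s" "enters n P j y s'"
    and t: "cell_time n x = cell_time n y"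
  shows "x = y" "s = s'"
proof -
  have "fst x + snd x + side_offset s = fst y + snd y + side_offset s'"
    "snd x + fst y = snd y + fst x"
    using e t by (auto simp: enters_iff[OF P] cell_time_def)
  then have "2 * fst x + side_offset s = 2 * fst y + side_offset s'" "snd x + fst y = snd y + fst x"
    by linarith+
  moreover have "2 * a \<noteq> Suc (2 * b)" for a b :: nat by presburger
  ultimately have "x = y \<and> s = s'" by (cases s; cases s') (auto simp: prod_eq_iff, metis)
  then show "x = y" "s = s'" by auto
qed

lemma enters_monotone:
  assumes P: "P \<subseteq> inner_cells n" and e: "enters n P j x s" "enters n P j y s'"
    and t: "cell_time n x \<le> cell_time n y"
  shows "fst y \<le> fst x" "snd x \<le> snd y"
proof -
  have *: "fst x + snd x + side_offset s = level n P (cell_time n x) j"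
    "fst y + snd y + side_offset s' = level n P (cell_time n y) j"
    "cell_time n x + fst x = snd x + n" "cell_time n y + fst y = snd y + n"
    using e by (auto simp: enters_iff[OF P] cell_time_def)
  have "side_offset s \<le> 1" "side_offset s' \<le> 1" by (cases s; cases s'; simp)+
  then show "fst y \<le> fst x" "snd x \<le> snd y" using level_mono[OF t, of n P j] * by linarith+
qed

lemma exists_entering:
  assumes P: "P \<subseteq> inner_cells n" and x: "x \<in> inner_cells n"
  obtains i j where "enters n P i x West" "enters n P j x South"
proof -
  obtain i where "i \<in> {1..n}" "level n P (cell_time n x) i = fst x + snd x"
    by (rule level_surj[OF P, of "fst x + snd x" "cell_time n x"]) (use x in \<open>auto simp: inner_cells_def\<close>)
  moreover obtain j where "j \<in> {1..n}" "level n P (cell_time n x) j = Suc (fst x + snd x)"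
    by (rule level_surj[OF P, of "Suc (fst x + snd x)" "cell_time n x"]) (use x in \<open>auto simp: inner_cells_def\<close>)
  ultimately show thesis using that x by (auto simp: enters_iff[OF P] inner_cells_def)
qed

section \<open>Crossings and flips\<close>

text \<open>Oriented form of \<open>pipes_cross_at\<close>: in a pipe dream the pipe from the west
  is the smaller one, so crossings \<open>i j\<close> correspond to inversions \<open>(i, j)\<close>
  without case distinctions.\<close>

definition crosses :: "nat \<Rightarrow> position set \<Rightarrow> nat \<Rightarrow> nat \<Rightarrow> position \<Rightarrow> bool" where
  "crosses n P i j x \<longleftrightarrow> x \<in> P \<and> enters n P i x West \<and> enters n P j x South"

definition touches :: "nat \<Rightarrow> position set \<Rightarrow> nat \<Rightarrow> nat \<Rightarrow> position \<Rightarrow> bool" where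
  "touches n P i j x \<longleftrightarrow> x \<in> contacts n P \<and> enters n P i x West \<and> enters n P j x South"

lemma pipes_cross_at_iff: "pipes_cross_at n P i j x \<longleftrightarrow> crosses n P i j x \<or> crosses n P j i x"
  by (auto simp: pipes_cross_at_def pipes_meet_def crosses_def)

lemma pipes_touch_at_iff: "pipes_touch_at n P i j x \<longleftrightarrow> touches n P i j x \<or> touches n P j i x"
  by (auto simp: pipes_touch_at_def pipes_meet_def touches_def)

lemma cell_time_add: "x \<in> inner_cells n \<Longrightarrow> cell_time n x + fst x = snd x + n"
  by (auto simp: cell_time_def inner_cells_def)

lemma cell_time_less: "x \<in> inner_cells n \<Longrightarrow> cell_time n x < 2 * n"
  by (auto simp: cell_time_def inner_cells_def)

lemma crosses_levels:
  assumes P: "P \<subseteq> inner_cells n" and x: "crosses n P i j x"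
  shows "level n P (cell_time n x) i < level n P (cell_time n x) j"
    "level n P (Suc (cell_time n x)) j < level n P (Suc (cell_time n x)) i"
proof -
  have xP: "x \<in> P" and l: "level n P (cell_time n x) i = fst x + snd x"
    "level n P (cell_time n x) j = Suc (fst x + snd x)"
    using x by (auto simp: crosses_def enters_iff[OF P])
  have t: "snd x + n = fst x + cell_time n x" using cell_time_add xP P by (metis add.commute subsetD)
  show "level n P (cell_time n x) i < level n P (cell_time n x) j" using l by simp
  show "level n P (Suc (cell_time n x)) j < level n P (Suc (cell_time n x)) i"
    using xP by (simp add: l cross_step_west[OF t] cross_step_south[OF t])
qed

text \<open>Levels change by at most one per step and stay distinct, so two pipes can change their
  order only by exchanging adjacent levels.\<close>

lemma level_order_step:
  assumes P: "P \<subseteq> inner_cells n" and ij: "i \<in> {1..n}" "j \<in> {1..n}"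
    and less: "level n P t i < level n P t j" and not_less: "\<not> level n P (Suc t) i < level n P (Suc t) j"
  obtains x where "crosses n P i j x" "cell_time n x = t"
proof -
  have ne: "level n P (Suc t) i \<noteq> level n P (Suc t) j" using less level_inject by (metis less_irrefl)
  have up: "level n P (Suc t) i = Suc (level n P t i)" and down: "level n P (Suc t) j = level n P t i"
    and next_to: "level n P t j = Suc (level n P t i)"
    using cross_step_le(1)[of n P t "level n P t i"] cross_step_le(2)[of "level n P t j" n P t]
      less not_less ne by auto
  obtain r c where rc: "(r, c) \<in> P" "c + n = r + t" "level n P t i = r + c"
    by (rule cross_step_cases[where n = n and P = P and t = t and l = "level n P t i"]) (use up in auto)
  have inner: "1 \<le> r" "1 \<le> c" "r + c \<le> n" using P rc(1) by (auto simp: inner_cells_def)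
  have time: "cell_time n (r, c) = t" using rc inner by (simp add: cell_time_def)
  then have "crosses n P i j (r, c)"
    using rc inner next_to ij by (auto simp: crosses_def enters_iff[OF P])
  then show thesis using that time by blast
qed

lemma crossing_between:
  assumes P: "P \<subseteq> inner_cells n" and ij: "i \<in> {1..n}" "j \<in> {1..n}" and t: "t \<le> t'"
    and less: "level n P t i < level n P t j" "\<not> level n P t' i < level n P t' j"
  obtains x where "crosses n P i j x" "t \<le> cell_time n x" "cell_time n x < t'"
proof -
  have "level n P t' i < level n P t' j \<or> (\<exists>x. crosses n P i j x \<and> t \<le> cell_time n x \<and> cell_time n x < t')"
    using t
  proof (induction t' rule: dec_induct)
    case (step m)
    then show ?case using level_order_step[OF P ij, of m] by (metis less_Suc_eq)
  qed (use less in simp)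
  then show thesis using that less by blast
qed

definition crosses_once :: "nat \<Rightarrow> position set \<Rightarrow> bool" where
  "crosses_once n P \<longleftrightarrow>
    (\<forall>i j x y. pipes_cross_at n P i j x \<and> pipes_cross_at n P i j y \<longrightarrow> x = y)"

lemma enters_pipe: "P \<subseteq> inner_cells n \<Longrightarrow> enters n P j x s \<Longrightarrow> j \<in> {1..n}"
  by (simp add: enters_iff)

text \<open>The wrong order at some time would force another crossing of the two pipes between that
  time and the crossing at \<open>x\<close>.\<close>

lemma crosses_once_order:
  assumes P: "P \<subseteq> inner_cells n" and once: "crosses_once n P" and x: "crosses n P i j x"
  shows "t \<le> cell_time n x \<Longrightarrow> level n P t i < level n P t j"
    "cell_time n x < t \<Longrightarrow> level n P t j < level n P t i"
proof -
  have ij: "i \<in> {1..n}" "j \<in> {1..n}" using x P by (auto simp: crosses_def enters_iff)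
  have same: "y = x" if "crosses n P i j y \<or> crosses n P j i y" for y
    using once x that unfolding crosses_once_def pipes_cross_at_iff by blast
  have "i \<noteq> j" using crosses_levels(1)[OF P x] by auto
  then have dich: "level n P t j < level n P t i \<longleftrightarrow> \<not> level n P t i < level n P t j" for t
    using level_inject[of n P t i j] by auto
  show "level n P t i < level n P t j" if t: "t \<le> cell_time n x"
  proof (rule ccontr)
    assume "\<not> ?thesis"
    then have "level n P t j < level n P t i" using dich by simp
    then obtain y where "crosses n P j i y" "cell_time n y < cell_time n x"
      using crossing_between[OF P ij(2,1) t] crosses_levels(1)[OF P x] by (metis less_asym)
    then show False using same by blast
  qed
  show "level n P t j < level n P t i" if t: "cell_time n x < t"
  proof (rule ccontr)
    assume "\<not> ?thesis"
    then obtain y where "crosses n P j i y" "Suc (cell_time n x) \<le> cell_time n y"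
      using crossing_between[OF P ij(2,1), of "Suc (cell_time n x)" t] t crosses_levels(2)[OF P x]
      by (metis Suc_leI)
    then show False using same by (metis not_less_eq_eq order_refl)
  qed
qed

lemma PD_D:
  assumes "P \<in> PD n \<omega>" and \<omega>: "\<omega> permutes {1..n}"
  shows "P \<subseteq> inner_cells n" "crosses_once n P"
    "j \<in> {1..n} \<Longrightarrow> level n P (2 * n) j = Suc (inv \<omega> j)"
proof -
  show P: "P \<subseteq> inner_cells n" and "crosses_once n P" using assms by (auto simp: PD_def crosses_once_def)
  assume j: "j \<in> {1..n}"
  then have "exits_at n P j (inv \<omega> j)" using assms by (auto simp: PD_def)
  then show "level n P (2 * n) j = Suc (inv \<omega> j)"
    using inv_permutes_in[OF \<omega> j] exits_at_iff[OF P] by auto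
qed

lemma PD_I:
  assumes P: "P \<subseteq> inner_cells n" and "crosses_once n P" and \<omega>: "\<omega> permutes {1..n}"
    and exit: "\<And>j. j \<in> {1..n} \<Longrightarrow> level n P (2 * n) j = Suc (inv \<omega> j)"
  shows "P \<in> PD n \<omega>"
proof -
  have "exits_at n P j (inv \<omega> j)" if "j \<in> {1..n}" for j
    using exits_at_iff[OF P, of "inv \<omega> j" j] inv_permutes_in[OF \<omega> that] exit[OF that] that by auto
  then show ?thesis using assms(1,2) by (auto simp: PD_def crosses_once_def)
qed

text \<open>At time 0 levels are ordered by pipe numbers, at time \<open>2 * n\<close> by exit
  columns; the crossing lies between the two.\<close>

lemma crosses_inversion:
  assumes \<omega>: "\<omega> permutes {1..n}" and PD: "P \<in> PD n \<omega>" and x: "crosses n P i j x"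
  shows "(i, j) \<in> inversions n \<omega>"
proof -
  note P = PD_D[OF PD \<omega>]
  have ij: "i \<in> {1..n}" "j \<in> {1..n}" using x P(1) by (auto simp: crosses_def enters_iff)
  have "x \<in> inner_cells n" using x P(1) by (auto simp: crosses_def)
  then have "level n P (2 * n) j < level n P (2 * n) i"
    using crosses_once_order(2)[OF P(1,2) x] cell_time_less by blast
  moreover have "i < j" using crosses_once_order(1)[OF P(1,2) x, of 0] by simp
  ultimately show ?thesis using ij P(3) by (auto simp: inversions_def)
qed

lemma exit_crossing:
  assumes P: "P \<subseteq> inner_cells n" and ij: "(i, j) \<in> inversions n \<omega>"
    and exit: "\<And>j. j \<in> {1..n} \<Longrightarrow> level n P (2 * n) j = Suc (inv \<omega> j)"
  obtains x where "crosses n P i j x"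
proof -
  have r: "i \<in> {1..n}" "j \<in> {1..n}" "i < j" "inv \<omega> j < inv \<omega> i" using ij by (auto simp: inversions_def)
  then have "level n P 0 i < level n P 0 j" "\<not> level n P (2 * n) i < level n P (2 * n) j"
    using exit by auto
  then show thesis using crossing_between[OF P r(1,2) zero_le] that by metis
qed

lemma inversion_crosses:
  assumes \<omega>: "\<omega> permutes {1..n}" and PD: "P \<in> PD n \<omega>" and ij: "(i, j) \<in> inversions n \<omega>"
  obtains x where "crosses n P i j x"
  using exit_crossing[OF PD_D(1)[OF PD \<omega>] ij PD_D(3)[OF PD \<omega>]] by blast

lemma crosses_unique:
  assumes \<omega>: "\<omega> permutes {1..n}" and PD: "P \<in> PD n \<omega>" and "crosses n P i j x" "crosses n P i j y"
  shows "x = y"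
  using PD_D(2)[OF PD \<omega>] assms(3,4) unfolding crosses_once_def pipes_cross_at_iff by blast

lemma crosses_asym:
  assumes \<omega>: "\<omega> permutes {1..n}" and PD: "P \<in> PD n \<omega>" and "crosses n P i j x" "crosses n P j i y"
  shows False
  using crosses_inversion[OF \<omega> PD assms(3)] crosses_inversion[OF \<omega> PD assms(4)]
  by (auto simp: inversions_def)

lemma touches_levels:
  assumes P: "P \<subseteq> inner_cells n" and x: "touches n P i j x"
  shows "level n P (cell_time n x) i = fst x + snd x" "level n P (cell_time n x) j = Suc (fst x + snd x)"
    "level n P (Suc (cell_time n x)) i = fst x + snd x"
    "level n P (Suc (cell_time n x)) j = Suc (fst x + snd x)"
proof -
  have xP: "x \<notin> P" and l: "level n P (cell_time n x) i = fst x + snd x"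
    "level n P (cell_time n x) j = Suc (fst x + snd x)" and xi: "x \<in> inner_cells n"
    using x by (auto simp: touches_def enters_iff[OF P] contacts_def)
  have t: "snd x + n = fst x + cell_time n x" using cell_time_add[OF xi] by simp
  show "level n P (cell_time n x) i = fst x + snd x" "level n P (cell_time n x) j = Suc (fst x + snd x)"
    by (rule l)+
  show "level n P (Suc (cell_time n x)) i = fst x + snd x"
    "level n P (Suc (cell_time n x)) j = Suc (fst x + snd x)"
    using xP by (simp_all add: l cross_step_west[OF t] cross_step_south[OF t])
qed

lemma touches_before_crossing:
  assumes \<omega>: "\<omega> permutes {1..n}" and PD: "P \<in> PD n \<omega>" and y: "touches n P i j y" and x: "crosses n P i j x"
  shows "cell_time n y < cell_time n x"
proof -
  note P = PD_D[OF PD \<omega>]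
  have "level n P (Suc (cell_time n y)) i < level n P (Suc (cell_time n y)) j"
    using touches_levels[OF P(1) y] by simp
  then show ?thesis using crosses_once_order(2)[OF P(1,2) x, of "Suc (cell_time n y)"]
    by (metis less_SucI not_less_eq order_less_asym)
qed

lemma touches_after_crossing:
  assumes \<omega>: "\<omega> permutes {1..n}" and PD: "P \<in> PD n \<omega>" and y: "touches n P j i y" and "i < j"
  obtains x where "crosses n P i j x" "cell_time n x < cell_time n y"
proof -
  note P = PD_D[OF PD \<omega>]
  have "i \<in> {1..n}" "j \<in> {1..n}" using y P(1) by (auto simp: touches_def enters_iff)
  then show thesis using crossing_between[OF P(1), of i j 0 "cell_time n y"] touches_levels(1,2)[OF P(1) y]
      \<open>i < j\<close> that by auto
qed

text \<open>Correct exits force every inversion to be crossed, so the number of crossings is minimal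
  exactly when no pair crosses twice. This trades a condition on all pairs of pipes for a count,
  which is easy to follow when cells are changed.\<close>

lemma crosses_once_iff_card:
  assumes P: "P \<subseteq> inner_cells n" and \<omega>: "\<omega> permutes {1..n}"
    and exit: "\<And>j. j \<in> {1..n} \<Longrightarrow> level n P (2 * n) j = Suc (inv \<omega> j)"
  shows "crosses_once n P \<longleftrightarrow> card P = card (inversions n \<omega>)"
proof -
  \<comment> \<open>Pairs are sorted by \<open>min\<close> and \<open>max\<close> because, before
    single crossings are known, a pair might also cross in the reverse direction.\<close>
  define f where "f x = (let i = (THE i. enters n P i x West); j = (THE j. enters n P j x South)
    in (min i j, max i j))" for x
  have f: "f x = (min i j, max i j)" if "crosses n P i j x" for i j x
    using that enters_unique[OF P] unfolding f_def crosses_def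
    by (metis (mono_tags, lifting) the_equality)
  have "finite (inner_cells n)"
    by (rule finite_subset[of _ "{1..n} \<times> {1..n}"]) (auto simp: inner_cells_def)
  then have fin: "finite P" using P finite_subset by blast
  have sub: "inversions n \<omega> \<subseteq> f ` P"
  proof (rule subrelI)
    fix i j assume ij: "(i, j) \<in> inversions n \<omega>"
    obtain x where x: "crosses n P i j x" using exit_crossing[OF P ij exit] by blast
    then have "f x = (i, j)" using f[OF x] ij by (auto simp: inversions_def)
    then show "(i, j) \<in> f ` P" using x by (auto simp: crosses_def intro!: rev_image_eqI)
  qed
  show ?thesis
  proof
    assume once: "crosses_once n P"
    have PD: "P \<in> PD n \<omega>" by (rule PD_I[OF P once \<omega> exit])
    have ex: "\<exists>i j. crosses n P i j x \<and> f x = (i, j)" if "x \<in> P" for x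
    proof -
      have "x \<in> inner_cells n" using that P by blast
      then obtain i j where "enters n P i x West" "enters n P j x South"
        by (rule exists_entering[OF P])
      then have "crosses n P i j x" using that by (simp add: crosses_def)
      moreover from this have "i < j" using crosses_inversion[OF \<omega> PD] by (auto simp: inversions_def)
      ultimately show ?thesis using f by fastforce
    qed
    then have "f ` P \<subseteq> inversions n \<omega>" using crosses_inversion[OF \<omega> PD] by fastforce
    moreover have "inj_on f P"
      using ex crosses_unique[OF \<omega> PD] by (intro inj_onI) (metis Pair_inject)
    ultimately show "card P = card (inversions n \<omega>)" using sub by (metis card_image subset_antisym)
  next
    assume card: "card P = card (inversions n \<omega>)"
    have "card (inversions n \<omega>) \<le> card (f ` P)" using sub fin by (intro card_mono) auto
    then have "inj_on f P" using card card_image_le[OF fin, of f] fin by (intro eq_card_imp_inj_on) auto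
    moreover have "f x = (min i j, max i j)" if "pipes_cross_at n P i j x" for i j x
      using that f unfolding pipes_cross_at_iff by (metis max.commute min.commute)
    moreover have "x \<in> P" if "pipes_cross_at n P i j x" for i j x
      using that by (auto simp: pipes_cross_at_def)
    ultimately show "crosses_once n P" unfolding crosses_once_def by (metis inj_onD)
  qed
qed

section \<open>Changing one or two cells\<close>

definition toggle :: "position set \<Rightarrow> position \<Rightarrow> position set" where
  "toggle P x = (if x \<in> P then P - {x} else insert x P)"

lemma mem_toggle: "y \<in> toggle P x \<longleftrightarrow> (if y = x then y \<notin> P else y \<in> P)"
  by (auto simp: toggle_def)

lemma cross_step_cong:
  assumes "\<And>r c. c + n = r + t \<Longrightarrow> l = r + c \<or> l = Suc (r + c) \<Longrightarrow> (r, c) \<in> P \<longleftrightarrow> (r, c) \<in> Q"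
  shows "cross_step n P t l = cross_step n Q t l"
proof -
  have "(\<exists>r c. (r, c) \<in> P \<and> r + c = l \<and> c + n = r + t) \<longleftrightarrow> (\<exists>r c. (r, c) \<in> Q \<and> r + c = l \<and> c + n = r + t)"
    using assms by metis
  moreover have "(\<exists>r c. (r, c) \<in> P \<and> Suc (r + c) = l \<and> c + n = r + t) \<longleftrightarrow>
      (\<exists>r c. (r, c) \<in> Q \<and> Suc (r + c) = l \<and> c + n = r + t)"
    using assms by metis
  ultimately show ?thesis by (simp only: cross_step_def)
qed

text \<open>Changing a cell affects only the two levels it handles: the pipes meeting there exchange
  their continuations.\<close>

lemma level_toggle:
  assumes P: "P \<subseteq> inner_cells n" and x: "x \<in> inner_cells n"
    and i: "enters n P i x West" and j: "enters n P j x South"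
  shows "level n (toggle P x) t k = level n P t (if t \<le> cell_time n x then k else transpose i j k)"
proof (induction t)
  case (Suc t)
  obtain r c where rc: "x = (r, c)" by (cases x)
  have time: "cell_time n x + r = c + n" using cell_time_add[OF x] rc by simp
  show ?case
  proof (cases "t = cell_time n x")
    case False
    have "cross_step n (toggle P x) t l = cross_step n P t l" for l
      by (rule cross_step_cong) (use False time rc in \<open>auto simp: mem_toggle\<close>)
    then show ?thesis using Suc False by auto
  next
    case True
    then have ct: "c + n = r + t" using time by simp
    have li: "level n P t i = r + c" and lj: "level n P t j = Suc (r + c)"
      using i j rc True by (auto simp: enters_iff[OF P])
    have IH: "level n (toggle P x) t k = level n P t k" using Suc True by simp
    have "cross_step n (toggle P x) t (level n P t k) = cross_step n P t (level n P t (transpose i j k))"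
    proof -
      consider "k = i" | "k = j" | "k \<noteq> i" "k \<noteq> j" by blast
      then show ?thesis
      proof cases
        case 1
        then show ?thesis
          using rc by (simp add: li lj cross_step_west[OF ct] cross_step_south[OF ct] mem_toggle)
      next
        case 2
        then show ?thesis
          using rc by (simp add: li lj cross_step_west[OF ct] cross_step_south[OF ct] mem_toggle)
      next
        case 3
        then have "level n P t k \<noteq> r + c" "level n P t k \<noteq> Suc (r + c)"
          using li lj level_inject by metis+
        then have "cross_step n (toggle P x) t (level n P t k) = cross_step n P t (level n P t k)"
          by (intro cross_step_cong) (use rc in \<open>auto simp: mem_toggle\<close>)
        then show ?thesis using 3 by simp
      qed
    qed
    then show ?thesis using IH True by simp
  qed
qed simp

text \<open>The second change undoes the exchange of continuations, which leaves a relabelling in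
  the time window between the two cells. It is half open because levels at \<open>cell_time\<close>
  are those before the cell acts.\<close>

lemma level_toggle2:
  assumes P: "P \<subseteq> inner_cells n" and y: "y \<in> inner_cells n" and z: "z \<in> inner_cells n"
    and my: "pipes_meet n P i j y" and mz: "pipes_meet n P i j z" and t: "cell_time n y < cell_time n z"
  defines "Q \<equiv> toggle (toggle P y) z"
  shows "Q \<subseteq> inner_cells n"
    "level n Q t k = level n P t (if cell_time n y < t \<and> t \<le> cell_time n z then transpose i j k else k)"
    "enters n Q k u s \<longleftrightarrow>
      enters n P (if cell_time n y < cell_time n u \<and> cell_time n u \<le> cell_time n z then transpose i j k else k) u s"
proof -
  have P1: "toggle P y \<subseteq> inner_cells n" using P y by (auto simp: toggle_def)
  show Q: "Q \<subseteq> inner_cells n" unfolding Q_def using P1 z by (auto simp: toggle_def)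
  have ij: "i \<in> {1..n}" "j \<in> {1..n}" using my P by (auto simp: pipes_meet_def enters_iff)
  have range: "1 \<le> transpose i j k \<and> transpose i j k \<le> n \<longleftrightarrow> 1 \<le> k \<and> k \<le> n" for k
    using ij by (auto simp: transpose_def)
  have l1: "level n (toggle P y) t k = level n P t (if t \<le> cell_time n y then k else transpose i j k)" for t k
    using my level_toggle[OF P y] unfolding pipes_meet_def by (metis transpose_commute)
  have e1: "enters n (toggle P y) k z s \<longleftrightarrow> enters n P (transpose i j k) z s" for k s
    using t range by (auto simp: enters_iff[OF P] enters_iff[OF P1] l1)
  \<comment> \<open>\<open>pipes_meet\<close> is symmetric in the pipes, so the exchange caused by
    the change at \<open>y\<close> does not destroy the meeting at \<open>z\<close>.\<close>
  have m1: "pipes_meet n (toggle P y) i j z"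
    using mz unfolding pipes_meet_def e1 by auto
  have l: "level n Q t k = level n P t (if cell_time n y < t \<and> t \<le> cell_time n z then transpose i j k else k)" for t k
  proof -
    have "level n Q t k = level n (toggle P y) t (if t \<le> cell_time n z then k else transpose i j k)"
      using m1 level_toggle[OF P1 z] unfolding pipes_meet_def Q_def by (metis transpose_commute)
    then show ?thesis using l1 t by auto
  qed
  then show "level n Q t k = level n P t (if cell_time n y < t \<and> t \<le> cell_time n z then transpose i j k else k)" .
  show "enters n Q k u s \<longleftrightarrow>
      enters n P (if cell_time n y < cell_time n u \<and> cell_time n u \<le> cell_time n z then transpose i j k else k) u s"
    using range by (auto simp: enters_iff[OF P] enters_iff[OF Q] l)
qed

text \<open>Exits and the number of crossings are both preserved, which suffices by the counting
  criterion.\<close>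

lemma toggle2_PD:
  assumes \<omega>: "\<omega> permutes {1..n}" and PD: "P \<in> PD n \<omega>"
    and y: "y \<in> inner_cells n" and z: "z \<in> inner_cells n" and yz: "y \<in> P \<longleftrightarrow> z \<notin> P"
    and my: "pipes_meet n P i j y" and mz: "pipes_meet n P i j z" and t: "cell_time n y < cell_time n z"
  shows "toggle (toggle P y) z \<in> PD n \<omega>"
proof -
  note P = PD_D[OF PD \<omega>]
  let ?Q = "toggle (toggle P y) z"
  note tog = level_toggle2[OF P(1) y z my mz t]
  have exit: "level n ?Q (2 * n) j = Suc (inv \<omega> j)" if "j \<in> {1..n}" for j
    using tog(2)[of "2 * n" j] P(3)[OF that] cell_time_less[OF z] by simp
  have "finite P" using P(1) finite_subset[of P "{1..n} \<times> {1..n}"] by (force simp: inner_cells_def)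
  then have "card ?Q = card P"
    using yz t card_Suc_Diff1[of P y] card_Suc_Diff1[of P z] by (cases "y \<in> P") (auto simp: toggle_def)
  also have "\<dots> = card (inversions n \<omega>)" using crosses_once_iff_card[OF P(1) \<omega> P(3)] P(2) by blast
  finally have "crosses_once n ?Q" using crosses_once_iff_card[OF tog(1) \<omega> exit] by blast
  then show ?thesis using PD_I tog(1) exit \<omega> by blast
qed

section \<open>Linear extensions and the weak order\<close>

lemma crosses_pipes: "P \<subseteq> inner_cells n \<Longrightarrow> crosses n P i j x \<Longrightarrow> i \<in> {1..n} \<and> j \<in> {1..n}"
  by (simp add: crosses_def enters_iff)

lemma touches_pipes: "P \<subseteq> inner_cells n \<Longrightarrow> touches n P i j x \<Longrightarrow> i \<in> {1..n} \<and> j \<in> {1..n}"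
  by (simp add: touches_def enters_iff)

lemma linear_extensions_iff:
  "\<pi> \<in> linear_extensions n P \<longleftrightarrow>
    \<pi> permutes {1..n} \<and> (\<forall>x i j. touches n P i j x \<longrightarrow> inv \<pi> i < inv \<pi> j)"
  by (auto simp: linear_extensions_def contact_graph_def touches_def)

lemma linear_extensions_permutes: "\<pi> \<in> linear_extensions n P \<Longrightarrow> \<pi> permutes {1..n}"
  by (simp add: linear_extensions_iff)

lemma linear_extensions_touches:
  "\<pi> \<in> linear_extensions n P \<Longrightarrow> touches n P i j x \<Longrightarrow> inv \<pi> i < inv \<pi> j"
  unfolding linear_extensions_iff by blast

text \<open>Along row \<open>r\<close> from west to east, a crossing passes the pipe on, and a
  contact replaces it by its southeast pipe, which the arc puts later.\<close>

lemma row_entries_increase: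
  assumes P: "P \<subseteq> inner_cells n" and \<pi>: "\<pi> \<in> linear_extensions n P"
  shows "enters n P i (r, Suc c) West \<Longrightarrow> inv \<pi> r \<le> inv \<pi> i"
proof (induction c arbitrary: i)
  case 0
  have "1 \<le> r \<and> r \<le> n" using 0 by (auto simp: enters_iff[OF P])
  then have "enters n P r (r, Suc 0) West" using enters.start[of r n P] by simp
  then show ?case using enters_unique[OF P 0] by simp
next
  case (Suc c)
  from Suc.prems show ?case
  proof (cases rule: enters.cases)
    case cross_east
    then show ?thesis using Suc.IH by simp
  next
    case turn_east
    then have x: "(r, Suc c) \<in> contacts n P" "enters n P i (r, Suc c) South" by auto
    then obtain a where a: "enters n P a (r, Suc c) West"
      using exists_entering[OF P, of "(r, Suc c)"] by (auto simp: contacts_def)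
    then have "inv \<pi> a < inv \<pi> i" using x by (intro linear_extensions_touches[OF \<pi>]) (simp add: touches_def)
    then show ?thesis using Suc.IH[OF a] by simp
  qed auto
qed

text \<open>The pipe runs east until something sends it north; the elbow at the end of the row does
  so at the latest.\<close>

lemma enters_row_above:
  assumes P: "P \<subseteq> inner_cells n"
  shows "enters n P k (Suc r, c) s \<Longrightarrow> 1 \<le> r \<Longrightarrow> \<exists>c'. enters n P k (r, c') South"
proof (induction "Suc n - (r + c)" arbitrary: c s)
  case 0
  then show ?case using enters_imp_level[OF P 0(2)] by simp
next
  case (Suc d)
  have le: "Suc r + c + side_offset s \<le> Suc n" "1 \<le> c" using enters_imp_level[OF P Suc.prems(1)] by simp_all
  have east: ?case if "enters n P k (Suc r, Suc c) West"
    using Suc.hyps(1)[of "Suc c"] that Suc.hyps(2) Suc.prems(2) by simp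
  show ?case
  proof (cases "(Suc r, c) \<in> P")
    case True
    then show ?thesis using Suc.prems east enters.cross_north[of n P k r c] enters.cross_east[of n P k "Suc r" c]
      by (cases s) auto
  next
    case False
    then have "(Suc r, c) \<in> contacts n P \<union> elbows n" "s = South \<Longrightarrow> (Suc r, c) \<in> contacts n P"
      using le by (auto simp: contacts_def inner_cells_def elbows_def)
    then show ?thesis using Suc.prems east enters.turn_north[of n P k r c] enters.turn_east[of n P k "Suc r" c]
      by (cases s) auto
  qed
qed

lemma south_entry_exists:
  assumes P: "P \<subseteq> inner_cells n" and k: "k \<le> n" and "1 \<le> r" "r < k"
  obtains c where "enters n P k (r, c) South"
proof -
  have "\<exists>c s. enters n P k (r, c) s \<and> (r < k \<longrightarrow> s = South)" if "1 \<le> r" "r \<le> k" for r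
    using that(2,1)
  proof (induction rule: inc_induct)
    case base
    then show ?case using enters.start[of k n P] k by auto
  next
    case (step m)
    then obtain c s where "enters n P k (Suc m, c) s" by auto
    then show ?case using enters_row_above[OF P] step.prems by blast
  qed
  then show thesis using assms that by fastforce
qed

text \<open>A cell entered from the south does not raise the level, so the pipe would arrive at a
  second south entrance of the same row one level short.\<close>

lemma south_entry_unique:
  assumes P: "P \<subseteq> inner_cells n" and x: "enters n P k (r, c) South" and y: "enters n P k (r, c') South"
  shows "c = c'"
proof -
  have "\<not> c < c'" if x: "enters n P k (r, c) South" and y: "enters n P k (r, c') South" for c c'
  proof
    assume "c < c'"
    have l: "level n P (cell_time n (r, c)) k = Suc (r + c)" "level n P (cell_time n (r, c')) k = Suc (r + c')"
      and le: "r + c \<le> n" "r + c' \<le> n"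
      using x y by (auto simp: enters_iff[OF P])
    have t: "c + n = r + cell_time n (r, c)" using le by (simp add: cell_time_def)
    have "level n P (Suc (cell_time n (r, c))) k \<le> Suc (r + c)"
      by (simp add: l cross_step_south[OF t])
    moreover have "Suc (cell_time n (r, c)) \<le> cell_time n (r, c')"
      using \<open>c < c'\<close> le by (simp add: cell_time_def)
    then have "level n P (cell_time n (r, c')) k + Suc (cell_time n (r, c))
        \<le> level n P (Suc (cell_time n (r, c))) k + cell_time n (r, c')" by (rule level_mono(2))
    moreover have "c' + n = r + cell_time n (r, c')" using le by (simp add: cell_time_def)
    ultimately show False using l(2) t by linarith
  qed
  from this[OF x y] this[OF y x] show ?thesis by simp
qed

text \<open>
  Pipe \<open>k\<close> enters each of the rows between \<open>r\<close> and \<open>k\<close> exactly once from the south, meeting there a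
  pipe from the west, either crossing it or touching it. The pipes numbered between \<open>r\<close> and \<open>k\<close> that
  \<open>k\<close> does not cross in these rows are therefore as many as the touchings. By the monotonicity of
  the west entries along a row, all rows where the pipe from the west precedes \<open>k\<close> start with a pipe
  preceding \<open>k\<close>; counting forces every uncrossed pipe to precede \<open>k\<close>.
\<close>
lemma precedes_if_not_crossing_below:
  assumes \<omega>: "\<omega> permutes {1..n}" and PD: "P \<in> PD n \<omega>" and \<pi>: "\<pi> \<in> linear_extensions n P"
    and m: "r < m" "m < k" and k: "k \<le> n" and cr: "\<And>x. crosses n P m k x \<Longrightarrow> fst x \<le> r"
  shows "inv \<pi> m < inv \<pi> k"
proof -
  note P = PD_D[OF PD \<omega>]
  define R where "R = {r<..<k}"
  have "\<forall>\<rho>\<in>R. \<exists>p. fst (fst p) = \<rho> \<and> enters n P k (fst p) South \<and> enters n P (snd p) (fst p) West"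
  proof
    fix \<rho> assume \<rho>: "\<rho> \<in> R"
    obtain c where c: "enters n P k (\<rho>, c) South"
      using south_entry_exists[OF P(1) k, of \<rho>] \<rho> by (auto simp: R_def)
    then have "(\<rho>, c) \<in> inner_cells n" by (auto simp: enters_iff[OF P(1)] inner_cells_def)
    then obtain i where "enters n P i (\<rho>, c) West" by (rule exists_entering[OF P(1)])
    then show "\<exists>p. fst (fst p) = \<rho> \<and> enters n P k (fst p) South \<and> enters n P (snd p) (fst p) West"
      using c by (intro exI[of _ "((\<rho>, c), i)"]) simp
  qed
  from bchoice[OF this] obtain h where h: "\<forall>\<rho>\<in>R. fst (fst (h \<rho>)) = \<rho> \<and> enters n P k (fst (h \<rho>)) South \<and>
      enters n P (snd (h \<rho>)) (fst (h \<rho>)) West"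
    by blast
  define g w where "g \<rho> = fst (h \<rho>)" and "w \<rho> = snd (h \<rho>)" for \<rho>
  have g: "fst (g \<rho>) = \<rho>" "enters n P k (g \<rho>) South" and w: "enters n P (w \<rho>) (g \<rho>) West"
    if "\<rho> \<in> R" for \<rho>
    using h that by (auto simp: g_def w_def)
  \<comment> \<open>\<open>g \<rho>\<close> is the cell where \<open>k\<close> comes into row
    \<open>\<rho>\<close> from the south and \<open>w \<rho>\<close> the pipe met there.
    \<open>T\<close> and \<open>X\<close> are the rows with a touching and with a crossing,
    \<open>N\<close> the pipes not crossed below row \<open>r\<close>, \<open>Z\<close> the pipes
    preceding \<open>k\<close>. Rows and pipes share the index set \<open>R\<close> because pipe
    \<open>\<rho>\<close> starts in row \<open>\<rho>\<close>.\<close>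
  define T X where "T = {\<rho> \<in> R. g \<rho> \<notin> P}" and "X = {\<rho> \<in> R. g \<rho> \<in> P}"
  define N where "N = {p \<in> R. \<not> (\<exists>x. crosses n P p k x \<and> r < fst x)}"
  define Z where "Z = {z. inv \<pi> z < inv \<pi> k}"
  have fin: "finite R" "finite T" "finite X" "finite N" by (auto simp: R_def T_def X_def N_def)
  have crX: "crosses n P (w \<rho>) k (g \<rho>)" if "\<rho> \<in> X" for \<rho>
    using that g w by (auto simp: crosses_def X_def)
  have injX: "inj_on w X"
  proof (rule inj_onI)
    fix \<rho> \<rho>' assume "\<rho> \<in> X" "\<rho>' \<in> X" "w \<rho> = w \<rho>'"
    then have "g \<rho> = g \<rho>'" using crX crosses_unique[OF \<omega> PD] by metis
    then show "\<rho> = \<rho>'" using g(1) \<open>\<rho> \<in> X\<close> \<open>\<rho>' \<in> X\<close> by (metis (no_types, lifting) X_def mem_Collect_eq)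
  qed
  have imX: "w ` X = R - N"
  proof (intro equalityI subsetI)
    fix p assume "p \<in> w ` X"
    then obtain \<rho> where \<rho>: "\<rho> \<in> X" "p = w \<rho>" by auto
    then have c: "crosses n P p k (g \<rho>)" "fst (g \<rho>) = \<rho>" "\<rho> \<in> R" using crX g by (auto simp: X_def)
    then have "p < k" using crosses_inversion[OF \<omega> PD] by (auto simp: inversions_def)
    moreover have "\<rho> \<le> p" using enters_row_le[OF P(1), of p "g \<rho>" West] c by (simp add: crosses_def)
    ultimately have "p \<in> R" "r < fst (g \<rho>)" using c by (auto simp: R_def)
    then show "p \<in> R - N" using c(1) unfolding N_def by blast
  next
    fix p assume "p \<in> R - N"
    then obtain x where x: "crosses n P p k x" "r < fst x" unfolding N_def by blast
    have "fst x < k" using enters_row_le[OF P(1), of k x South] x by (auto simp: crosses_def)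
    then have R: "fst x \<in> R" using x by (auto simp: R_def)
    obtain c where c: "g (fst x) = (fst x, c)" using g(1)[OF R] by (cases "g (fst x)") auto
    have "enters n P k (fst x, snd x) South" using x(1) by (simp add: crosses_def)
    moreover have "enters n P k (fst x, c) South" using g(2)[OF R] c by simp
    ultimately have "snd x = c" by (rule south_entry_unique[OF P(1)])
    then have "g (fst x) = x" using c by (cases x) simp
    then have "w (fst x) = p" using w[OF R] x(1) enters_unique[OF P(1)] by (auto simp: crosses_def)
    then show "p \<in> w ` X" using R x(1) \<open>g (fst x) = x\<close> by (auto simp: X_def crosses_def intro!: rev_image_eqI)
  qed
  have "card T + card X = card R"
    using fin by (subst card_Un_disjoint[symmetric]) (auto simp: T_def X_def intro!: arg_cong[where f = card])
  moreover have "N \<subseteq> R" by (auto simp: N_def)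
  then have "card (R - N) + card N = card R" using fin by (simp add: card_Diff_subset card_mono)
  then have "card X + card N = card R" using card_image[OF injX] imX by simp
  ultimately have TN: "card T = card N" by simp
  define XZ where "XZ = {\<rho> \<in> X. w \<rho> \<in> Z}"
  have "w ` XZ = (R - N) \<inter> Z" unfolding imX[symmetric] by (auto simp: XZ_def)
  moreover have "inj_on w XZ" using injX by (rule inj_on_subset) (auto simp: XZ_def)
  ultimately have cXZ: "card XZ = card ((R - N) \<inter> Z)" by (metis card_image)
  have "T \<union> XZ \<subseteq> R \<inter> Z"
  proof
    fix \<rho> assume \<rho>: "\<rho> \<in> T \<union> XZ"
    then have R: "\<rho> \<in> R" by (auto simp: T_def XZ_def X_def)
    have "w \<rho> \<in> Z"
    proof (cases "\<rho> \<in> T")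
      case True
      have "g \<rho> \<in> inner_cells n" using g(2)[OF R] by (auto simp: enters_iff[OF P(1)] inner_cells_def)
      then have "touches n P (w \<rho>) k (g \<rho>)" using g[OF R] w[OF R] True by (auto simp: T_def touches_def contacts_def)
      then show ?thesis using linear_extensions_touches[OF \<pi>] unfolding Z_def by blast
    qed (use \<rho> in \<open>auto simp: XZ_def\<close>)
    moreover have "1 \<le> snd (g \<rho>)" using g(2)[OF R] by (auto simp: enters_iff[OF P(1)])
    then have "g \<rho> = (\<rho>, Suc (snd (g \<rho>) - 1))" using g(1)[OF R] by (cases "g \<rho>") simp
    then have "inv \<pi> \<rho> \<le> inv \<pi> (w \<rho>)" using row_entries_increase[OF P(1) \<pi>] w[OF R] by metis
    ultimately show "\<rho> \<in> R \<inter> Z" using R by (auto simp: Z_def)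
  qed
  then have "card (T \<union> XZ) \<le> card (R \<inter> Z)" using fin by (intro card_mono) auto
  moreover have "card (T \<union> XZ) = card T + card XZ"
    using fin by (intro card_Un_disjoint) (auto simp: T_def XZ_def X_def)
  moreover have "card (R \<inter> Z) = card ((R - N) \<inter> Z) + card (N \<inter> Z)"
    using fin by (subst card_Un_disjoint[symmetric]) (auto simp: N_def intro!: arg_cong[where f = card])
  \<comment> \<open>The crossed pipes in \<open>Z\<close> are counted by \<open>XZ\<close> on one
    side and by \<open>(R - N) \<inter> Z\<close> on the other, and cancel.\<close>
  ultimately have "card N \<le> card (N \<inter> Z)" using TN cXZ by simp
  then have "N \<inter> Z = N" using fin by (intro card_seteq) auto
  moreover have "\<not> (\<exists>x. crosses n P m k x \<and> r < fst x)" using cr leD by blast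
  then have "m \<in> N" using m by (simp add: N_def R_def)
  ultimately show ?thesis by (auto simp: Z_def)
qed

text \<open>The choice \<open>r = i - 1\<close> makes row \<open>i\<close> itself part of the rows
  counted.\<close>

lemma precedes_if_crossing_above:
  assumes \<omega>: "\<omega> permutes {1..n}" and PD: "P \<in> PD n \<omega>" and \<pi>: "\<pi> \<in> linear_extensions n P"
    and ij: "(i, j) \<in> value_pairs n" and cr: "\<And>x. crosses n P i j x \<Longrightarrow> fst x < i"
  shows "inv \<pi> i < inv \<pi> j"
proof (rule precedes_if_not_crossing_below[OF \<omega> PD \<pi>])
  show "i - 1 < i" "i < j" "j \<le> n" using ij by (auto simp: value_pairs_def)
  show "fst x \<le> i - 1" if "crosses n P i j x" for x using cr[OF that] by simp
qed

text \<open>A pair that is no inversion of \<open>\<omega>\<close> never crosses, so its order is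
  forced.\<close>

lemma linear_extension_inversions:
  assumes \<omega>: "\<omega> permutes {1..n}" and PD: "P \<in> PD n \<omega>" and \<pi>: "\<pi> \<in> linear_extensions n P"
  shows "inversions n \<pi> \<subseteq> inversions n \<omega>"
proof (rule subrelI, rule ccontr)
  fix i j assume ij: "(i, j) \<in> inversions n \<pi>" "(i, j) \<notin> inversions n \<omega>"
  then have "\<not> crosses n P i j x" for x using crosses_inversion[OF \<omega> PD] by blast
  then have "inv \<pi> i < inv \<pi> j"
    using precedes_if_crossing_above[OF \<omega> PD \<pi>, of i j] ij(1) inversions_subset by blast
  then show False using ij(1) by (simp add: inversions_def)
qed

text \<open>
  Reflection in the main diagonal reverses time and turns pipe dreams for \<open>\<omega>\<close> into pipe dreams for
  \<open>inv \<omega>\<close>, with pipes renumbered by their exit columns.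
\<close>
lemma level_transpose:
  assumes \<omega>: "\<omega> permutes {1..n}" and PD: "P \<in> PD n \<omega>" and e: "e \<in> {1..n}"
  shows "t \<le> Suc (2 * n) \<Longrightarrow> level n (prod.swap ` P) t e = level n P (Suc (2 * n) - t) (\<omega> e)"
proof (induction t)
  case 0
  have "\<omega> e \<in> {1..n}" using e permutes_in_image[OF \<omega>] by blast
  then have "level n P (2 * n) (\<omega> e) = Suc e" using PD_D(3)[OF PD \<omega>] permutes_inverses(2)[OF \<omega>] by simp
  then have "level n P (Suc (2 * n)) (\<omega> e) = Suc e"
    by (rule level_after_exit[OF PD_D(1)[OF PD \<omega>]]) (use e in auto)
  then show ?case by simp
next
  case (Suc t)
  \<comment> \<open>Reflection sends a cell of time \<open>t\<close> to one of time
    \<open>2 * n - t\<close>. The state before the one is the state after the other, whence the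
    extra \<open>Suc\<close>.\<close>
  define u where "u = 2 * n - t"
  have u: "Suc (2 * n) - t = Suc u" "Suc (2 * n) - Suc t = u" "t + u = 2 * n" using Suc.prems by (auto simp: u_def)
  have "cross_step n (prod.swap ` P) t l = cross_step n P u l" for l
  proof -
    have time: "c + n = r + t \<longleftrightarrow> r + n = c + u" for r c using u(3) by linarith
    have mem: "(r, c) \<in> prod.swap ` P \<longleftrightarrow> (c, r) \<in> P" for r c by (rule pair_in_swap_image)
    show ?thesis unfolding cross_step_def mem time
      by (smt (verit, ccfv_threshold) add.commute)
  qed
  then show ?case using Suc u by (simp add: cross_step_involution)
qed

text \<open>Reflecting and reversing a path turns the west-east passage of a crossing into the
  south-north one, but keeps each bend of a contact. So crossings exchange their pipes while arcs
  keep their direction.\<close>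

lemma transpose_cell:
  assumes \<omega>: "\<omega> permutes {1..n}" and PD: "P \<in> PD n \<omega>" and ef: "e \<in> {1..n}" "f \<in> {1..n}"
  shows "crosses n (prod.swap ` P) e f (prod.swap x) \<longleftrightarrow> crosses n P (\<omega> f) (\<omega> e) x"
    "touches n (prod.swap ` P) e f (prod.swap x) \<longleftrightarrow> touches n P (\<omega> e) (\<omega> f) x"
proof -
  note P = PD_D[OF PD \<omega>]
  have P': "prod.swap ` P \<subseteq> inner_cells n" using P(1) by (auto simp: inner_cells_def)
  have mem: "prod.swap x \<in> prod.swap ` P \<longleftrightarrow> x \<in> P" by (cases x) simp
  have inner: "prod.swap x \<in> inner_cells n \<longleftrightarrow> x \<in> inner_cells n" by (cases x) (auto simp: inner_cells_def)
  have im: "\<omega> k \<in> {1..n}" if "k \<in> {1..n}" for k using that permutes_in_image[OF \<omega>] by blast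
  have ent: "enters n (prod.swap ` P) k (prod.swap x) s \<longleftrightarrow>
      enters n P (\<omega> k) x (if x \<in> P then case s of West \<Rightarrow> South | South \<Rightarrow> West else s)"
    if x: "x \<in> inner_cells n" and k: "k \<in> {1..n}" for k s
  proof -
    have t: "snd x + n = fst x + cell_time n x" using cell_time_add[OF x] by simp
    have "Suc (2 * n) - cell_time n (prod.swap x) = Suc (cell_time n x)"
      using x by (auto simp: cell_time_def inner_cells_def)
    moreover have "cell_time n (prod.swap x) \<le> Suc (2 * n)" using cell_time_less inner x by (metis less_imp_le le_SucI)
    ultimately have "level n (prod.swap ` P) (cell_time n (prod.swap x)) k
        = cross_step n P (cell_time n x) (level n P (cell_time n x) (\<omega> k))"
      using level_transpose[OF \<omega> PD k] by simp
    then have "level n (prod.swap ` P) (cell_time n (prod.swap x)) k = l \<longleftrightarrow>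
        level n P (cell_time n x) (\<omega> k) = cross_step n P (cell_time n x) l" for l
      by (metis cross_step_involution)
    then show ?thesis
      using x k im[OF k] cross_step_west[OF t, of P] cross_step_south[OF t, of P]
      by (cases s) (auto simp: enters_iff[OF P'] enters_iff[OF P(1)] inner_cells_def add.commute)
  qed
  show "crosses n (prod.swap ` P) e f (prod.swap x) \<longleftrightarrow> crosses n P (\<omega> f) (\<omega> e) x"
    using ent ef mem P(1) unfolding crosses_def by (auto 0 3)
  show "touches n (prod.swap ` P) e f (prod.swap x) \<longleftrightarrow> touches n P (\<omega> e) (\<omega> f) x"
    using ent ef mem inner unfolding touches_def contacts_def by (auto 0 3)
qed

lemma transpose_PD:
  assumes \<omega>: "\<omega> permutes {1..n}" and PD: "P \<in> PD n \<omega>"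
  shows "prod.swap ` P \<in> PD n (inv \<omega>)"
proof (rule PD_I)
  note P = PD_D[OF PD \<omega>]
  show P': "prod.swap ` P \<subseteq> inner_cells n" using P(1) by (auto simp: inner_cells_def)
  show "inv \<omega> permutes {1..n}" by (rule permutes_inv[OF \<omega>])
  have *: "pipes_cross_at n P (\<omega> e) (\<omega> f) (prod.swap x)" if "pipes_cross_at n (prod.swap ` P) e f x" for e f x
  proof -
    have "e \<in> {1..n}" "f \<in> {1..n}" using that crosses_pipes[OF P'] unfolding pipes_cross_at_iff by blast+
    then show ?thesis using that transpose_cell(1)[OF \<omega> PD, of _ _ "prod.swap x"]
      unfolding pipes_cross_at_iff by auto
  qed
  show "crosses_once n (prod.swap ` P)"
    unfolding crosses_once_def using * P(2)[unfolded crosses_once_def] by (metis swap_swap)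
  fix j assume j: "j \<in> {1..n}"
  then have "\<omega> j \<in> {1..n}" using permutes_in_image[OF \<omega>] by blast
  then have "level n P 1 (\<omega> j) = Suc (\<omega> j)" using level_before_start[OF P(1), of 1] by simp
  then show "level n (prod.swap ` P) (2 * n) j = Suc (inv (inv \<omega>) j)"
    using level_transpose[OF \<omega> PD j, of "2 * n"] permutes_inv_inv[OF \<omega>] by simp
qed

lemma transpose_linear_extension:
  assumes \<omega>: "\<omega> permutes {1..n}" and PD: "P \<in> PD n \<omega>" and \<pi>: "\<pi> \<in> linear_extensions n P"
  shows "inv \<omega> \<circ> \<pi> \<in> linear_extensions n (prod.swap ` P)" "inv (inv \<omega> \<circ> \<pi>) e = inv \<pi> (\<omega> e)"
proof -
  have \<pi>p: "\<pi> permutes {1..n}" using \<pi> by (rule linear_extensions_permutes)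
  have inv: "inv (inv \<omega> \<circ> \<pi>) e = inv \<pi> (\<omega> e)" for e
    using permutes_inv_inv[OF \<omega>] permutes_bij[OF \<pi>p] permutes_bij[OF permutes_inv[OF \<omega>]]
    by (simp add: o_inv_distrib)
  then show "inv (inv \<omega> \<circ> \<pi>) e = inv \<pi> (\<omega> e)" .
  have P': "prod.swap ` P \<subseteq> inner_cells n" using PD_D(1)[OF PD \<omega>] by (auto simp: inner_cells_def)
  have "inv \<pi> (\<omega> e) < inv \<pi> (\<omega> f)" if t: "touches n (prod.swap ` P) e f x" for e f x
  proof -
    have "e \<in> {1..n}" "f \<in> {1..n}" using touches_pipes[OF P' t] by blast+
    then have "touches n P (\<omega> e) (\<omega> f) (prod.swap x)"
      using t transpose_cell(2)[OF \<omega> PD, of e f "prod.swap x"] by simp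
    then show ?thesis by (rule linear_extensions_touches[OF \<pi>])
  qed
  then show "inv \<omega> \<circ> \<pi> \<in> linear_extensions n (prod.swap ` P)"
    using permutes_compose[OF \<pi>p permutes_inv[OF \<omega>]] by (simp add: linear_extensions_iff inv)
qed

text \<open>Mirror image of \<open>enters_row_le\<close>; the strict bounds belong to the pipe that
  enters from the south after reflection.\<close>

lemma exit_column:
  assumes \<omega>: "\<omega> permutes {1..n}" and PD: "P \<in> PD n \<omega>"
  shows "crosses n P i j x \<Longrightarrow> snd x \<le> inv \<omega> j \<and> snd x < inv \<omega> i"
    "touches n P i j x \<Longrightarrow> snd x \<le> inv \<omega> i \<and> snd x < inv \<omega> j"
proof -
  note P = PD_D[OF PD \<omega>]
  note P' = PD_D(1)[OF transpose_PD[OF \<omega> PD] permutes_inv[OF \<omega>]]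
  note io = permutes_inverses(1)[OF \<omega>]
  show "snd x \<le> inv \<omega> j \<and> snd x < inv \<omega> i" if c: "crosses n P i j x"
  proof -
    have "i \<in> {1..n}" "j \<in> {1..n}" using crosses_pipes[OF P(1) c] by blast+
    then have "crosses n (prod.swap ` P) (inv \<omega> j) (inv \<omega> i) (prod.swap x)"
      using c transpose_cell(1)[OF \<omega> PD] inv_permutes_in[OF \<omega>] io by metis
    then show ?thesis
      using enters_row_le[OF P', of "inv \<omega> j" "prod.swap x" West]
        enters_row_le[OF P', of "inv \<omega> i" "prod.swap x" South] by (simp add: crosses_def)
  qed
  show "snd x \<le> inv \<omega> i \<and> snd x < inv \<omega> j" if c: "touches n P i j x"
  proof -
    have "i \<in> {1..n}" "j \<in> {1..n}" using touches_pipes[OF P(1) c] by blast+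
    then have "touches n (prod.swap ` P) (inv \<omega> i) (inv \<omega> j) (prod.swap x)"
      using c transpose_cell(2)[OF \<omega> PD] inv_permutes_in[OF \<omega>] io by metis
    then show ?thesis
      using enters_row_le[OF P', of "inv \<omega> i" "prod.swap x" West]
        enters_row_le[OF P', of "inv \<omega> j" "prod.swap x" South] by (simp add: touches_def)
  qed
qed

text \<open>In the reflected pipe dream the pair crosses in row \<open>snd x\<close>, before the
  starting row of its upper pipe, so the counting lemma applies with
  \<open>r = snd x\<close>.\<close>

lemma follows_if_crossing_left:
  assumes \<omega>: "\<omega> permutes {1..n}" and PD: "P \<in> PD n \<omega>" and \<pi>: "\<pi> \<in> linear_extensions n P"
    and x: "crosses n P i j x" and col: "snd x < inv \<omega> j"
  shows "inv \<pi> j < inv \<pi> i"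
proof -
  have ij: "i \<in> {1..n}" "j \<in> {1..n}" "inv \<omega> j < inv \<omega> i"
    using crosses_inversion[OF \<omega> PD x] by (auto simp: inversions_def)
  note io = permutes_inverses(1)[OF \<omega>]
  have "inv (inv \<omega> \<circ> \<pi>) (inv \<omega> j) < inv (inv \<omega> \<circ> \<pi>) (inv \<omega> i)"
  proof (rule precedes_if_not_crossing_below[OF permutes_inv[OF \<omega>] transpose_PD[OF \<omega> PD]
        transpose_linear_extension(1)[OF \<omega> PD \<pi>] col ij(3)])
    show "inv \<omega> i \<le> n" using inv_permutes_in[OF \<omega> ij(1)] by simp
    fix y assume "crosses n (prod.swap ` P) (inv \<omega> j) (inv \<omega> i) y"
    then have "crosses n P i j (prod.swap y)"
      using transpose_cell(1)[OF \<omega> PD, of "inv \<omega> j" "inv \<omega> i" "prod.swap y"] inv_permutes_in[OF \<omega>] ij io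
      by simp
    then have "prod.swap y = x" using crosses_unique[OF \<omega> PD] x by blast
    then show "fst y \<le> snd x" by auto
  qed
  then show ?thesis by (simp add: transpose_linear_extension(2)[OF \<omega> PD \<pi>] io)
qed

lemma crossing_row_or_column:
  assumes \<omega>: "\<omega> permutes {1..n}" and PD: "P \<in> PD n \<omega>" and \<pi>: "\<pi> \<in> linear_extensions n P"
    and x: "crosses n P i j x"
  shows "fst x = i \<or> snd x = inv \<omega> j"
proof (rule ccontr)
  assume not: "\<not> ?thesis"
  have "fst x \<le> i" using enters_row_le[OF PD_D(1)[OF PD \<omega>], of i x West] x by (simp add: crosses_def)
  then have "fst x < i" using not by auto
  moreover have "(i, j) \<in> value_pairs n" using crosses_inversion[OF \<omega> PD x] inversions_subset by blast
  ultimately have "inv \<pi> i < inv \<pi> j"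
    using precedes_if_crossing_above[OF \<omega> PD \<pi>] crosses_unique[OF \<omega> PD x] by blast
  moreover have "snd x < inv \<omega> j" using exit_column(1)[OF \<omega> PD x] not by auto
  then have "inv \<pi> j < inv \<pi> i" by (rule follows_if_crossing_left[OF \<omega> PD \<pi> x])
  ultimately show False by simp
qed

section \<open>The pipe dream of a permutation\<close>

lemma finite_inner_cells [simp]: "finite (inner_cells n)"
  by (rule finite_subset[of _ "{1..n} \<times> {1..n}"]) (auto simp: inner_cells_def)

lemma exists_linear_extension:
  assumes "finite A" and "acyclic r" and "finite r"
  obtains f where "bij_betw f A {1..card A}" "\<And>a b. (a, b) \<in> r \<Longrightarrow> a \<in> A \<Longrightarrow> b \<in> A \<Longrightarrow> f a < f b"
proof -
  have "\<exists>f. bij_betw f A {1..card A} \<and> (\<forall>a b. (a, b) \<in> r \<longrightarrow> a \<in> A \<longrightarrow> b \<in> A \<longrightarrow> f a < f b)"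
    using assms(1)
  proof (induction "card A" arbitrary: A)
    case 0
    then show ?case by (auto simp: bij_betw_def)
  next
    case (Suc m)
    have "wf (r\<inverse>)" using assms(2,3) by (simp add: finite_acyclic_wf_converse)
    moreover have "\<exists>a. a \<in> A" using Suc.hyps(2) by (cases "A = {}") auto
    ultimately obtain z where z: "z \<in> A" "\<And>y. (z, y) \<in> r \<Longrightarrow> y \<notin> A"
      by (metis converseI wfE_min)
    have cA: "card A = Suc m" "card (A - {z}) = m" using Suc.hyps(2) Suc.prems z(1) by simp_all
    then obtain f where f: "bij_betw f (A - {z}) {1..m}"
      "\<And>a b. (a, b) \<in> r \<Longrightarrow> a \<in> A - {z} \<Longrightarrow> b \<in> A - {z} \<Longrightarrow> f a < f b"
      using Suc.hyps(1)[of "A - {z}"] Suc.prems by auto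
    define f' where "f' = f(z := Suc m)"
    have "bij_betw f' (A - {z}) {1..m}" using f(1) by (rule bij_betw_cong[THEN iffD1, rotated]) (simp add: f'_def)
    then have "bij_betw f' ((A - {z}) \<union> {z}) ({1..m} \<union> {f' z})"
      by (rule notIn_Un_bij_betw[rotated 2]) (auto simp: f'_def)
    moreover have "(A - {z}) \<union> {z} = A" "{1..m} \<union> {f' z} = {1..card A}"
      using z cA by (auto simp: f'_def)
    moreover have "f' a < f' b" if ab: "(a, b) \<in> r" "a \<in> A" "b \<in> A" for a b
    proof -
      have "a \<noteq> z" using z(2) ab by blast
      moreover have "f a \<in> {1..m}" if "a \<noteq> z" using f(1) ab that by (auto dest: bij_betwE)
      ultimately show ?thesis using f(2) ab by (cases "b = z") (auto simp: f'_def)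
    qed
    ultimately show ?case by metis
  qed
  then show thesis using that by blast
qed

lemma wf_contact_graph: "P \<subseteq> inner_cells n \<Longrightarrow> wf_digraph (contact_graph n P)"
  by unfold_locales (auto simp: contact_graph_def dest: enters_pipe)

lemma contact_graph_ends: "arcs_ends (contact_graph n P) = {(i, j). \<exists>x. touches n P i j x}"
  by (force simp: arcs_ends_conv contact_graph_def touches_def)

text \<open>Topological sorting in one direction; in the other, places would increase strictly
  around a directed cycle. From here on acyclicity is used only as the existence of a linear
  extension.\<close>

lemma APD_iff:
  assumes \<omega>: "\<omega> permutes {1..n}"
  shows "P \<in> APD n \<omega> \<longleftrightarrow> P \<in> PD n \<omega> \<and> linear_extensions n P \<noteq> {}"
proof (cases "P \<in> PD n \<omega>")
  case PD: True
  let ?G = "contact_graph n P"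
  note P = PD_D(1)[OF PD \<omega>]
  interpret wf_digraph ?G by (rule wf_contact_graph[OF P])
  have "(\<nexists>p. cycle p) \<longleftrightarrow> linear_extensions n P \<noteq> {}"
  proof
    assume nc: "\<nexists>p. cycle p"
    have "(u, u) \<notin> (arcs_ends ?G)\<^sup>+" for u
    proof
      assume "(u, u) \<in> (arcs_ends ?G)\<^sup>+"
      then obtain p where "awalk u p u" "p \<noteq> []" using reachable1_awalk by blast
      then have "closed_w p" by (auto simp: closed_w_def)
      then show False using closed_w_imp_cycle nc by blast
    qed
    then have "acyclic (arcs_ends ?G)" by (simp add: acyclic_def)
    moreover have "arcs_ends ?G \<subseteq> {1..n} \<times> {1..n}"
      using touches_pipes[OF P] by (auto simp: contact_graph_ends)
    then have "finite (arcs_ends ?G)" by (rule finite_subset) simp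
    ultimately obtain f where f: "bij_betw f {1..n} {1..card {1..n}}"
      "\<And>a b. (a, b) \<in> arcs_ends ?G \<Longrightarrow> a \<in> {1..n} \<Longrightarrow> b \<in> {1..n} \<Longrightarrow> f a < f b"
      using exists_linear_extension[of "{1..n}" "arcs_ends ?G"] by auto
    define p where "p v = (if v \<in> {1..n} then f v else v)" for v
    have "bij_betw p {1..n} {1..n}" using f(1) bij_betw_cong[of "{1..n}" p f "{1..n}"] by (simp add: p_def)
    then have p: "p permutes {1..n}" by (rule bij_imp_permutes) (auto simp: p_def)
    have "p i < p j" if "touches n P i j x" for i j x
    proof -
      have "(i, j) \<in> arcs_ends ?G" using that unfolding contact_graph_ends by blast
      then show ?thesis using f(2) touches_pipes[OF P that] by (simp add: p_def)
    qed
    then have "inv p \<in> linear_extensions n P"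
      using permutes_inv[OF p] permutes_inv_inv[OF p] by (simp add: linear_extensions_iff)
    then show "linear_extensions n P \<noteq> {}" by blast
  next
    assume "linear_extensions n P \<noteq> {}"
    then obtain \<pi> where \<pi>: "\<pi> \<in> linear_extensions n P" by blast
    have inc: "inv \<pi> i < inv \<pi> j" if "(i, j) \<in> (arcs_ends ?G)\<^sup>+" for i j
      using that
    proof induction
      case (base y)
      then show ?case using linear_extensions_touches[OF \<pi>] unfolding contact_graph_ends by blast
    next
      case (step y z)
      then have "inv \<pi> y < inv \<pi> z" using linear_extensions_touches[OF \<pi>] unfolding contact_graph_ends by blast
      then show ?case using step.IH by simp
    qed
    show "\<nexists>p. cycle p"
    proof
      assume "\<exists>p. cycle p"
      then obtain p u where "awalk u p u" "p \<noteq> []" unfolding cycle_def by blast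
      then have "(u, u) \<in> (arcs_ends ?G)\<^sup>+" using reachable1_awalk[of u u] by blast
      then show False using inc by blast
    qed
  qed
  then show ?thesis using PD by (simp add: APD_def)
qed (simp add: APD_def)

text \<open>With crossings only, pipe \<open>j\<close> runs straight east to the elbow of its row
  and straight north from there.\<close>

lemma inner_cells_PD:
  assumes \<omega>: "\<omega> permutes {1..n}" and all: "inversions n \<omega> = value_pairs n"
  shows "inner_cells n \<in> PD n \<omega>"
proof (rule PD_I[OF subset_refl _ \<omega>])
  let ?P = "inner_cells n"
  have inv: "inv \<omega> j = Suc n - j" if j: "j \<in> {1..n}" for j
  proof -
    have "inv \<omega> u < inv \<omega> j \<longleftrightarrow> j < u" if u: "u \<in> {1..n}" for u
    proof (cases u j rule: linorder_cases)
      case less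
      then have "(u, j) \<in> inversions n \<omega>" using all u j by (auto simp: value_pairs_def)
      then show ?thesis using less by (auto simp: inversions_def)
    next
      case greater
      then have "(j, u) \<in> inversions n \<omega>" using all u j by (auto simp: value_pairs_def)
      then show ?thesis using greater by (auto simp: inversions_def)
    qed simp
    then have "{u \<in> {1..n}. inv \<omega> u < inv \<omega> j} = {j<..n}" using j by auto
    then show ?thesis using inv_eq_card[OF \<omega> j] j by (auto simp: Suc_diff_le)
  qed
  show exit: "level n ?P (2 * n) j = Suc (inv \<omega> j)" if j: "j \<in> {1..n}" for j
  proof -
    define e where "e = Suc n - j"
    have e: "j + e = Suc n" "1 \<le> e" "e \<le> n" using j by (auto simp: e_def)
    have west: "enters n ?P j (j, Suc c) West" if "Suc c \<le> e" for c
      using that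
    proof (induction c)
      case 0
      then show ?case using enters.start[of j n ?P] j by simp
    next
      case (Suc c)
      then have "(j, Suc c) \<in> ?P" using e j by (auto simp: inner_cells_def)
      then show ?case using Suc by (auto intro: enters.cross_east)
    qed
    have last: "enters n ?P j (j, e) West" using west[of "e - 1"] e by simp
    have elbow: "(j, e) \<in> elbows n" using e j by (auto simp: elbows_def)
    have "exits_at n ?P j e"
    proof (cases "j = 1")
      case True
      then show ?thesis using last elbow by (simp add: exits_at_def)
    next
      case False
      have south: "enters n ?P j (r, e) South" if "1 \<le> r" "r \<le> j - 1" for r
        using that(2,1)
      proof (induction rule: inc_induct)
        case base
        have "Suc (j - 1) = j" using False j by simp
        then show ?case using enters.turn_north[of n ?P j "j - 1" e] last elbow base by simp
      next
        case (step m)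
        have "(Suc m, e) \<in> ?P" using step e by (auto simp: inner_cells_def)
        then show ?case using step enters.cross_north[of n ?P j m e] by simp
      qed
      have "(1, e) \<in> ?P" using False e j by (auto simp: inner_cells_def)
      moreover have "enters n ?P j (1, e) South" by (rule south) (use False j in auto)
      ultimately show ?thesis by (simp add: exits_at_def)
    qed
    then have "level n ?P (2 * n) j = Suc e" using exits_at_iff[OF subset_refl] e by blast
    then show ?thesis using inv[OF j] by (simp add: e_def)
  qed
  \<comment> \<open>This bijection only counts cells; the pipes crossing at \<open>(r, c)\<close>
    are \<open>r\<close> and \<open>Suc n - c\<close>.\<close>
  have "bij_betw (\<lambda>(r, c). (r, r + c)) ?P (value_pairs n)"
    by (rule bij_betw_byWitness[where f' = "\<lambda>(i, j). (i, j - i)"])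
      (auto simp: inner_cells_def value_pairs_def)
  then have "card ?P = card (inversions n \<omega>)" using all by (simp add: bij_betw_same_card)
  then show "crosses_once n ?P" using crosses_once_iff_card[OF subset_refl \<omega> exit] by blast
qed

text \<open>
  Descending from the longest permutation: if \<open>\<omega>\<close> is covered by \<open>\<omega>'\<close>, resolving the crossing of the
  two exchanged pipes into a contact turns a pipe dream for \<open>\<omega>'\<close> into one for \<open>\<omega>\<close>.
\<close>
lemma PD_nonempty: "\<omega> permutes {1..n} \<Longrightarrow> PD n \<omega> \<noteq> {}"
proof (induction "card (value_pairs n - inversions n \<omega>)" arbitrary: \<omega> rule: less_induct)
  case less
  note \<omega> = less.prems
  show ?case
  proof (cases "inversions n \<omega> = value_pairs n")
    case True
    then show ?thesis using inner_cells_PD[OF \<omega>] by blast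
  next
    case False
    obtain \<rho> where \<rho>: "\<rho> permutes {1..n}" "inversions n \<rho> = value_pairs n"
      using exists_permutation_of_inversions[OF subset_refl trans_value_pairs, of n] by (auto simp: trans_def)
    have "inversions n \<omega> \<subset> inversions n \<rho>" using False inversions_subset \<rho>(2) by blast
    then obtain k where k: "1 \<le> k" "k < n" "\<omega> k < \<omega> (Suc k)"
      using exists_ascent[OF \<omega> \<rho>(1)] by blast
    define i j where "i = \<omega> k" and "j = \<omega> (Suc k)"
    define \<omega>' where "\<omega>' = \<omega> \<circ> transpose k (Suc k)"
    note sw = swap_positions[OF \<omega> k, folded \<omega>'_def i_def j_def]
    have ij: "(i, j) \<in> value_pairs n" using sw(2) inversions_subset by blast
    have "value_pairs n - inversions n \<omega>' \<subset> value_pairs n - inversions n \<omega>" using sw(2,3) ij by blast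
    then have "card (value_pairs n - inversions n \<omega>') < card (value_pairs n - inversions n \<omega>)"
      by (intro psubset_card_mono) auto
    then obtain P' where PD': "P' \<in> PD n \<omega>'" using less.hyps sw(1) by blast
    note P' = PD_D[OF PD' sw(1)]
    obtain x where x: "crosses n P' i j x" using inversion_crosses[OF sw(1) PD'] sw(2) by blast
    have xP: "x \<in> P'" "x \<in> inner_cells n" using x P'(1) by (auto simp: crosses_def)
    let ?P = "toggle P' x"
    have sub: "?P \<subseteq> inner_cells n" using P'(1) xP by (auto simp: toggle_def)
    have exit: "level n ?P (2 * n) v = Suc (inv \<omega> v)" if v: "v \<in> {1..n}" for v
    proof -
      have "transpose i j v \<in> {1..n}" using v ij by (auto simp: transpose_def value_pairs_def)
      then have "level n ?P (2 * n) v = Suc (inv \<omega>' (transpose i j v))"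
        using level_toggle[OF P'(1) xP(2), of i j "2 * n" v] x cell_time_less[OF xP(2)] P'(3)
        by (simp add: crosses_def)
      then show ?thesis using sw(4) by simp
    qed
    \<comment> \<open>One crossing and one inversion disappear together, so the counting criterion
      passes down from \<open>\<omega>'\<close>.\<close>
    have "card ?P = card P' - 1" using xP(1) by (simp add: toggle_def)
    also have "card P' = card (inversions n \<omega>')" using crosses_once_iff_card[OF P'(1) sw(1) P'(3)] P'(2) by blast
    also have "\<dots> - 1 = card (inversions n \<omega>)" using sw(2,3) by simp
    finally have "crosses_once n ?P" using crosses_once_iff_card[OF sub \<omega> exit] by blast
    then show ?thesis using PD_I[OF sub _ \<omega> exit] by blast
  qed
qed

text \<open>
  A pipe dream with the crossings as late as possible admits no flip moving a crossing to a later
  contact, hence all its arcs are increasing.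
\<close>
lemma exists_PD_identity:
  assumes \<omega>: "\<omega> permutes {1..n}"
  obtains P where "P \<in> PD n \<omega>" "id \<in> linear_extensions n P"
proof -
  have "PD n \<omega> \<subseteq> Pow (inner_cells n)" by (auto simp: PD_def)
  then have fin: "finite (PD n \<omega>)" by (rule finite_subset) simp
  define s where "s P = (\<Sum>x\<in>P. cell_time n x)" for P
  have "Max (s ` PD n \<omega>) \<in> s ` PD n \<omega>" using fin PD_nonempty[OF \<omega>] by (intro Max_in) auto
  then obtain P where PD: "P \<in> PD n \<omega>" and "s P = Max (s ` PD n \<omega>)" by auto
  then have max: "s Q \<le> s P" if "Q \<in> PD n \<omega>" for Q using that fin by simp
  note P = PD_D[OF PD \<omega>]
  have "i < j" if t: "touches n P i j x" for i j x
  proof (rule ccontr)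
    assume "\<not> i < j"
    moreover have "i \<noteq> j" using touches_levels(1,2)[OF P(1) t] by auto
    ultimately have "j < i" by simp
    then obtain z where z: "crosses n P j i z" "cell_time n z < cell_time n x"
      using touches_after_crossing[OF \<omega> PD t] by blast
    have m: "pipes_meet n P i j z" "pipes_meet n P i j x"
      using z t by (auto simp: crosses_def touches_def pipes_meet_def)
    have zx: "z \<in> P" "z \<in> inner_cells n" "x \<notin> P" "x \<in> inner_cells n"
      using z t P(1) by (auto simp: crosses_def touches_def contacts_def)
    let ?Q = "toggle (toggle P z) x"
    have "?Q = insert x (P - {z})" using zx by (auto simp: toggle_def)
    then have "s ?Q = cell_time n x + s (P - {z})" using zx finite_subset[OF P(1)] by (simp add: s_def)
    moreover have "s P = cell_time n z + s (P - {z})"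
      using zx finite_subset[OF P(1)] by (simp add: s_def sum.remove)
    moreover have "?Q \<in> PD n \<omega>" using toggle2_PD[OF \<omega> PD zx(2,4) _ m z(2)] zx by blast
    ultimately show False using max[of ?Q] z(2) by simp
  qed
  then have "id \<in> linear_extensions n P" by (auto simp: linear_extensions_iff)
  then show thesis using that PD by blast
qed

section \<open>Uniqueness, and flips induced by adjacent exchanges\<close>

text \<open>Every arc must follow the exit order, so a cell is a crossing exactly when the pipes
  entering it form an inversion of \<open>\<omega>\<close>. The cells are thereby determined one
  time after the other.\<close>

lemma PD_unique_top:
  assumes \<omega>: "\<omega> permutes {1..n}" and P: "P \<in> PD n \<omega>" "\<omega> \<in> linear_extensions n P"
    and Q: "Q \<in> PD n \<omega>" "\<omega> \<in> linear_extensions n Q"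
  shows "P = Q"
proof -
  note sub = PD_D(1)[OF P(1) \<omega>] PD_D(1)[OF Q(1) \<omega>]
  have mem: "x \<in> R \<longleftrightarrow> (i, j) \<in> inversions n \<omega>"
    if R: "R \<in> PD n \<omega>" "\<omega> \<in> linear_extensions n R" and x: "x \<in> inner_cells n"
      and e: "enters n R i x West" "enters n R j x South" for R x i j
  proof
    assume "x \<in> R"
    then show "(i, j) \<in> inversions n \<omega>" using crosses_inversion[OF \<omega> R(1)] e by (simp add: crosses_def)
  next
    assume ij: "(i, j) \<in> inversions n \<omega>"
    show "x \<in> R"
    proof (rule ccontr)
      assume "x \<notin> R"
      then have "touches n R i j x" using e x by (simp add: touches_def contacts_def)
      then have "inv \<omega> i < inv \<omega> j" by (rule linear_extensions_touches[OF R(2)])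
      then show False using ij by (simp add: inversions_def)
    qed
  qed
  have same: "x \<in> P \<longleftrightarrow> x \<in> Q"
    if x: "x \<in> inner_cells n" and l: "level n P (cell_time n x) = level n Q (cell_time n x)" for x
  proof -
    obtain i j where "enters n P i x West" "enters n P j x South" by (rule exists_entering[OF sub(1) x])
    moreover from this have "enters n Q i x West" "enters n Q j x South"
      using l by (simp_all add: enters_iff[OF sub(1)] enters_iff[OF sub(2)])
    ultimately show ?thesis using mem[OF P x] mem[OF Q x] by blast
  qed
  have level: "level n P t = level n Q t" for t
  proof (induction t)
    case (Suc t)
    have "cross_step n P t l = cross_step n Q t l" for l
    proof (rule cross_step_cong)
      fix r c assume rc: "c + n = r + t"
      show "(r, c) \<in> P \<longleftrightarrow> (r, c) \<in> Q"
      proof (cases "(r, c) \<in> inner_cells n")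
        case True
        then have "cell_time n (r, c) = t" using rc by (simp add: cell_time_def)
        then show ?thesis using same[OF True] Suc by simp
      qed (use sub in blast)
    qed
    then show ?case using Suc by (simp add: fun_eq_iff)
  qed (simp add: fun_eq_iff)
  then show ?thesis using same sub by blast
qed

lemma swap_positions_less:
  assumes \<pi>: "\<pi> permutes {1..n}" and k: "1 \<le> k" "k < n" "\<pi> k < \<pi> (Suc k)"
    and less: "inv \<pi> a < inv \<pi> b" and ne: "\<not> (a = \<pi> k \<and> b = \<pi> (Suc k))"
  shows "inv (\<pi> \<circ> transpose k (Suc k)) a < inv (\<pi> \<circ> transpose k (Suc k)) b"
proof -
  have "inv (\<pi> \<circ> transpose k (Suc k)) v = transpose k (Suc k) (inv \<pi> v)" for v
  proof -
    have "(\<pi> \<circ> transpose k (Suc k)) (transpose k (Suc k) (inv \<pi> v)) = v"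
      by (simp add: permutes_inverses[OF \<pi>])
    then show ?thesis using permutes_inverses(2)[OF swap_positions(1)[OF \<pi> k]] by metis
  qed
  moreover have "\<not> (inv \<pi> a = k \<and> inv \<pi> b = Suc k)" using ne permutes_inverses(1)[OF \<pi>] by metis
  ultimately show ?thesis using less by (auto simp: transpose_def)
qed

text \<open>
  The flipped contact is the first one of the two pipes: flipping a later one would leave contacts
  in both orders.
\<close>
lemma adjacent_swap:
  assumes \<omega>: "\<omega> permutes {1..n}" and PD: "P \<in> PD n \<omega>" and \<pi>: "\<pi> \<in> linear_extensions n P"
    and k: "1 \<le> k" "k < n" "\<pi> k < \<pi> (Suc k)" and inv\<omega>: "(\<pi> k, \<pi> (Suc k)) \<in> inversions n \<omega>"
  defines "i \<equiv> \<pi> k" and "j \<equiv> \<pi> (Suc k)" and "\<pi>' \<equiv> \<pi> \<circ> transpose k (Suc k)"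
  obtains (stay) "\<pi>' \<in> linear_extensions n P" "\<And>x. \<not> touches n P i j x"
  | (flip) P' x y where "P' \<in> PD n \<omega>" "\<pi>' \<in> linear_extensions n P'" "increasing_flip n P P'"
      "P' = insert y (P - {x})" "x \<in> P" "y \<notin> P" "crosses n P' i j y" "touches n P' j i x"
      "\<And>u. touches n P' j i u \<Longrightarrow> cell_time n u \<le> cell_time n x"
proof (cases "\<exists>x. touches n P i j x")
  case False
  have perm: "\<pi> permutes {1..n}" by (rule linear_extensions_permutes[OF \<pi>])
  have "inv \<pi>' a < inv \<pi>' b" if t: "touches n P a b x" for a b x
    unfolding \<pi>'_def
  proof (rule swap_positions_less[OF perm k linear_extensions_touches[OF \<pi> t]])
    show "\<not> (a = \<pi> k \<and> b = \<pi> (Suc k))" using False t unfolding i_def j_def by blast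
  qed
  then have "\<pi>' \<in> linear_extensions n P"
    using swap_positions(1)[OF perm k] by (simp add: linear_extensions_iff \<pi>'_def)
  then show thesis using stay False by blast
next
  case True
  note P = PD_D[OF PD \<omega>]
  have perm: "\<pi> permutes {1..n}" by (rule linear_extensions_permutes[OF \<pi>])
  note sw = swap_positions[OF perm k, folded \<pi>'_def i_def j_def]
  have ij: "inv \<pi> i = k" "inv \<pi> j = Suc k" "i \<noteq> j"
    using permutes_inverses(2)[OF perm] k by (simp_all add: i_def j_def)
  obtain y where y: "touches n P i j y"
    and first: "\<And>u. touches n P i j u \<Longrightarrow> cell_time n y \<le> cell_time n u"
    using True arg_min_natI[of "touches n P i j" _ "cell_time n"] arg_min_nat_le[of "touches n P i j" _ "cell_time n"]
    by metis
  obtain x where x: "crosses n P i j x"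
    using inversion_crosses[OF \<omega> PD inv\<omega>] unfolding i_def j_def by blast
  have yx: "cell_time n y < cell_time n x" by (rule touches_before_crossing[OF \<omega> PD y x])
  have cells: "y \<in> inner_cells n" "y \<notin> P" "x \<in> inner_cells n" "x \<in> P"
    using x y P(1) by (auto simp: crosses_def touches_def contacts_def)
  have meet: "pipes_meet n P i j y" "pipes_meet n P i j x"
    using x y by (auto simp: crosses_def touches_def pipes_meet_def)
  define P' where "P' = toggle (toggle P y) x"
  have P'_eq: "P' = insert y (P - {x})" using cells by (auto simp: P'_def toggle_def)
  have mem: "z \<in> P' \<longleftrightarrow> z = y \<or> z \<in> P \<and> z \<noteq> x" for z using cells P'_eq by auto
  have PD': "P' \<in> PD n \<omega>"
    unfolding P'_def using toggle2_PD[OF \<omega> PD cells(1,3) _ meet yx] cells by blast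
  note ent = level_toggle2(3)[OF P(1) cells(1,3) meet yx, folded P'_def]
  have cr': "crosses n P' i j y"
    using y by (simp add: crosses_def touches_def ent mem)
  have to': "touches n P' j i x"
    using x cells yx by (auto simp: crosses_def touches_def ent contacts_def mem)
  have flip_inc: "increasing_flip n P P'"
  proof -
    have "fst x \<le> fst y" "snd y \<le> snd x"
      using enters_monotone[OF P(1), of i y West x West] x y yx by (simp_all add: crosses_def touches_def)
    then show ?thesis using x y P'_eq unfolding increasing_flip_def pipes_cross_at_iff pipes_touch_at_iff by blast
  qed
  \<comment> \<open>In \<open>P'\<close> the cell \<open>x\<close> is the last contact of the two
    pipes, which allows the flip to be undone knowing only \<open>P'\<close> and the pair.\<close>
  have last: "cell_time n u \<le> cell_time n x" if u: "touches n P' j i u" for u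
  proof (rule ccontr)
    assume late: "\<not> ?thesis"
    then have "u \<noteq> x" "u \<noteq> y" using yx by auto
    then have "touches n P j i u"
      using u late by (auto simp: touches_def ent contacts_def mem)
    then have "inv \<pi> j < inv \<pi> i" by (rule linear_extensions_touches[OF \<pi>])
    then show False using ij by simp
  qed
  have "inv \<pi>' a < inv \<pi>' b" if t: "touches n P' a b u" for a b u
  proof (cases "u = x")
    case True
    then have "a = j" "b = i"
      using t to' enters_unique[OF PD_D(1)[OF PD' \<omega>]] unfolding touches_def by blast+
    then show ?thesis using sw(4) ij by simp
  next
    case False
    then have u: "u \<in> contacts n P" using t by (auto simp: touches_def contacts_def mem)
    show ?thesis
    proof (cases "cell_time n y < cell_time n u \<and> cell_time n u \<le> cell_time n x")
      case True
      \<comment> \<open>Inside the window the pipes on the arc and the places of \<open>i\<close>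
        and \<open>j\<close> are exchanged simultaneously, and the two changes cancel.\<close>
      then have "touches n P (transpose i j a) (transpose i j b) u" using t u by (simp add: touches_def ent)
      then show ?thesis unfolding sw(4) by (rule linear_extensions_touches[OF \<pi>])
    next
      case False
      then have tu: "touches n P a b u" using t u by (auto simp: touches_def ent)
      \<comment> \<open>Only an arc from \<open>i\<close> to \<open>j\<close> could be violated by
        the exchange. It lies before \<open>x\<close>, so outside the window it is not later than
        the first contact \<open>y\<close>, which has become a crossing.\<close>
      have "\<not> (a = i \<and> b = j)"
      proof
        assume "a = i \<and> b = j"
        then have tij: "touches n P i j u" using tu by simp
        then have "cell_time n u = cell_time n y"
          using first touches_before_crossing[OF \<omega> PD _ x] False by (metis less_imp_le not_less le_antisym)
        then have "u = y" using enters_same_time(1)[OF P(1)] tij y unfolding touches_def by blast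
        then show False using t by (auto simp: touches_def contacts_def mem)
      qed
      then show ?thesis unfolding \<pi>'_def i_def j_def
        by (rule swap_positions_less[OF perm k linear_extensions_touches[OF \<pi> tu]])
    qed
  qed
  then have "\<pi>' \<in> linear_extensions n P'" using sw(1) by (simp add: linear_extensions_iff)
  then show thesis using flip PD' flip_inc P'_eq cells(4,2) cr' to' last by blast
qed

text \<open>Induction upwards to \<open>\<omega>\<close>. An arc from \<open>j\<close> to
  \<open>i\<close> is impossible before the exchange, so its presence afterwards tells whether a
  flip took place; the flipped cells are then the unique crossing and the last contact of the
  pair.\<close>

lemma PD_unique:
  assumes \<omega>: "\<omega> permutes {1..n}"
  shows "P \<in> PD n \<omega> \<Longrightarrow> Q \<in> PD n \<omega> \<Longrightarrow> \<pi> \<in> linear_extensions n P \<Longrightarrow> \<pi> \<in> linear_extensions n Q \<Longrightarrow> P = Q"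
proof (induction "card (inversions n \<omega> - inversions n \<pi>)" arbitrary: \<pi> P Q rule: less_induct)
  case less
  have perm: "\<pi> permutes {1..n}" by (rule linear_extensions_permutes[OF less.prems(3)])
  have sub: "inversions n \<pi> \<subseteq> inversions n \<omega>"
    by (rule linear_extension_inversions[OF \<omega> less.prems(1,3)])
  show ?case
  proof (cases "inversions n \<pi> = inversions n \<omega>")
    case True
    then have "\<pi> = \<omega>" by (rule inversions_inject[OF perm \<omega>])
    then show ?thesis using PD_unique_top[OF \<omega>] less.prems by blast
  next
    case False
    then obtain k where k: "1 \<le> k" "k < n" "\<pi> k < \<pi> (Suc k)" and ik: "(\<pi> k, \<pi> (Suc k)) \<in> inversions n \<omega>"
      using exists_ascent[OF perm \<omega>] sub by blast
    define i j where "i = \<pi> k" and "j = \<pi> (Suc k)"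
    define \<pi>' where "\<pi>' = \<pi> \<circ> transpose k (Suc k)"
    note sw = swap_positions[OF perm k, folded \<pi>'_def i_def j_def]
    have "inversions n \<omega> - inversions n \<pi>' \<subset> inversions n \<omega> - inversions n \<pi>"
      using sw(2,3) ik unfolding i_def j_def by blast
    then have "card (inversions n \<omega> - inversions n \<pi>') < card (inversions n \<omega> - inversions n \<pi>)"
      by (intro psubset_card_mono) auto
    note IH = less.hyps[OF this]
    have no: "\<not> touches n R j i x" if "\<pi> \<in> linear_extensions n R" for R x
    proof
      assume "touches n R j i x"
      then have "inv \<pi> j < inv \<pi> i" by (rule linear_extensions_touches[OF that])
      then show False using permutes_inverses(2)[OF perm] by (simp add: i_def j_def)
    qed
    note adjP = adjacent_swap[OF \<omega> less.prems(1,3) k ik, folded i_def j_def \<pi>'_def]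
    note adjQ = adjacent_swap[OF \<omega> less.prems(2,4) k ik, folded i_def j_def \<pi>'_def]
    show ?thesis
    proof (rule adjP)
      assume P: "\<pi>' \<in> linear_extensions n P"
      show ?thesis
      proof (rule adjQ)
        assume "\<pi>' \<in> linear_extensions n Q"
        then show ?thesis using IH less.prems P by blast
      next
        fix Q' x y assume "Q' \<in> PD n \<omega>" "\<pi>' \<in> linear_extensions n Q'" "touches n Q' j i x"
        then show ?thesis using IH[OF less.prems(1) _ P] no[OF less.prems(3)] by blast
      qed
    next
      fix P' x y assume P: "P' \<in> PD n \<omega>" "\<pi>' \<in> linear_extensions n P'" "P' = insert y (P - {x})"
        "x \<in> P" "y \<notin> P" "crosses n P' i j y" "touches n P' j i x"
        "\<And>u. touches n P' j i u \<Longrightarrow> cell_time n u \<le> cell_time n x"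
      show ?thesis
      proof (rule adjQ)
        assume "\<pi>' \<in> linear_extensions n Q"
        then show ?thesis using IH[OF less.prems(2) P(1) _ P(2)] P(7) no[OF less.prems(4)] by blast
      next
        fix Q' x' y' assume Q: "Q' \<in> PD n \<omega>" "\<pi>' \<in> linear_extensions n Q'" "Q' = insert y' (Q - {x'})"
          "x' \<in> Q" "y' \<notin> Q" "crosses n Q' i j y'" "touches n Q' j i x'"
          "\<And>u. touches n Q' j i u \<Longrightarrow> cell_time n u \<le> cell_time n x'"
        have eq: "P' = Q'" using IH P Q by blast
        then have "y = y'" using crosses_unique[OF \<omega> P(1)] P(6) Q(6) by blast
        moreover have "cell_time n x = cell_time n x'"
          using P(7,8) Q(7,8) eq by (metis le_antisym)
        then have "x = x'"
          using enters_same_time(1)[OF PD_D(1)[OF P(1) \<omega>]] P(7) Q(7) eq unfolding touches_def by blast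
        moreover have "P = insert x (P' - {y})" using P(3-5) by blast
        moreover have "Q = insert x' (Q' - {y'})" using Q(3-5) by blast
        ultimately show ?thesis using eq by simp
      qed
    qed
  qed
qed

definition flip_rel :: "nat \<Rightarrow> (nat \<Rightarrow> nat) \<Rightarrow> (position set \<times> position set) set" where
  "flip_rel n \<omega> = {(P, P'). P \<in> APD n \<omega> \<and> P' \<in> APD n \<omega> \<and> increasing_flip n P P'}"

text \<open>Serves twice: started at the identity it produces the pipe dream of
  \<open>\<sigma>\<close>, and started in an arbitrary class it converts a comparison in the weak
  order into a flip path.\<close>

lemma flip_chain:
  assumes \<omega>: "\<omega> permutes {1..n}" and \<sigma>: "\<sigma> permutes {1..n}" "inversions n \<sigma> \<subseteq> inversions n \<omega>"
  shows "P \<in> PD n \<omega> \<Longrightarrow> \<pi> \<in> linear_extensions n P \<Longrightarrow> inversions n \<pi> \<subseteq> inversions n \<sigma> \<Longrightarrow>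
    \<exists>Q \<in> PD n \<omega>. \<sigma> \<in> linear_extensions n Q \<and> (P, Q) \<in> (flip_rel n \<omega>)\<^sup>*"
proof (induction "card (inversions n \<sigma> - inversions n \<pi>)" arbitrary: \<pi> P rule: less_induct)
  case less
  have perm: "\<pi> permutes {1..n}" by (rule linear_extensions_permutes[OF less.prems(2)])
  show ?case
  proof (cases "inversions n \<pi> = inversions n \<sigma>")
    case True
    then have "\<pi> = \<sigma>" by (rule inversions_inject[OF perm \<sigma>(1)])
    then show ?thesis using less.prems by blast
  next
    case False
    then obtain k where k: "1 \<le> k" "k < n" "\<pi> k < \<pi> (Suc k)" and ik: "(\<pi> k, \<pi> (Suc k)) \<in> inversions n \<sigma>"
      using exists_ascent[OF perm \<sigma>(1)] less.prems(3) by blast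
    define \<pi>' where "\<pi>' = \<pi> \<circ> transpose k (Suc k)"
    note sw = swap_positions[OF perm k, folded \<pi>'_def]
    have "inversions n \<sigma> - inversions n \<pi>' \<subset> inversions n \<sigma> - inversions n \<pi>"
      using sw(2,3) ik by blast
    then have "card (inversions n \<sigma> - inversions n \<pi>') < card (inversions n \<sigma> - inversions n \<pi>)"
      by (intro psubset_card_mono) auto
    note IH = less.hyps[OF this]
    have le: "inversions n \<pi>' \<subseteq> inversions n \<sigma>" using ik less.prems(3) by (simp add: sw(2))
    have ik': "(\<pi> k, \<pi> (Suc k)) \<in> inversions n \<omega>" using ik \<sigma>(2) by blast
    show ?thesis
    proof (rule adjacent_swap[OF \<omega> less.prems(1,2) k ik', folded \<pi>'_def])
      assume "\<pi>' \<in> linear_extensions n P"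
      then show ?thesis using IH less.prems(1) le by blast
    next
      fix P' x y assume P': "P' \<in> PD n \<omega>" "\<pi>' \<in> linear_extensions n P'" "increasing_flip n P P'"
      then have "(P, P') \<in> flip_rel n \<omega>"
        using less.prems(1,2) unfolding flip_rel_def APD_iff[OF \<omega>] by blast
      moreover obtain Q where "Q \<in> PD n \<omega>" "\<sigma> \<in> linear_extensions n Q" "(P', Q) \<in> (flip_rel n \<omega>)\<^sup>*"
        using IH P' le by blast
      ultimately show ?thesis by (meson converse_rtrancl_into_rtrancl)
    qed
  qed
qed

lemma exists_PD:
  assumes \<omega>: "\<omega> permutes {1..n}" and \<sigma>: "\<sigma> permutes {1..n}" "inversions n \<sigma> \<subseteq> inversions n \<omega>"
  obtains P where "P \<in> APD n \<omega>" "\<sigma> \<in> linear_extensions n P"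
proof -
  obtain P where P: "P \<in> PD n \<omega>" "id \<in> linear_extensions n P" by (rule exists_PD_identity[OF \<omega>])
  have "inversions n id \<subseteq> inversions n \<sigma>" by (auto simp: inversions_def)
  then obtain Q where "Q \<in> PD n \<omega>" "\<sigma> \<in> linear_extensions n Q" using flip_chain[OF \<omega> \<sigma> P] by blast
  then show thesis using that unfolding APD_iff[OF \<omega>] by blast
qed

section \<open>Increasing flips between acyclic pipe dreams\<close>

text \<open>The northwest pipe of a contact turns north there and so leaves the row for
  good.\<close>

lemma touches_then_above:
  assumes P: "P \<subseteq> inner_cells n" and y: "touches n P i j y" and u: "enters n P i u s"
    and t: "cell_time n y < cell_time n u"
  shows "fst u < fst y"
proof -
  have "cell_time n y + fst y = snd y + n" "cell_time n u + fst u = snd u + n"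
    "level n P (cell_time n u) i = fst u + snd u + side_offset s"
    using y u by (auto simp: touches_def enters_iff[OF P] cell_time_def)
  moreover have "level n P (cell_time n u) i + Suc (cell_time n y)
      \<le> level n P (Suc (cell_time n y)) i + cell_time n u"
    using t by (intro level_mono(2)) simp
  ultimately show ?thesis using touches_levels(3)[OF P y] by linarith
qed

text \<open>
  In every linear extension of an acyclic \<open>P\<close>, left inversions are inverted and pairs that are not
  row inversions are not.
\<close>
definition row_inversions :: "nat \<Rightarrow> position set \<Rightarrow> (nat \<times> nat) set" where
  "row_inversions n P = {(i, j). \<exists>x. crosses n P i j x \<and> fst x = i}"

definition left_inversions :: "nat \<Rightarrow> (nat \<Rightarrow> nat) \<Rightarrow> position set \<Rightarrow> (nat \<times> nat) set" where
  "left_inversions n \<omega> P = {(i, j). \<exists>x. crosses n P i j x \<and> snd x < inv \<omega> j}"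

lemma APD_crossing_row_or_column:
  assumes \<omega>: "\<omega> permutes {1..n}" and P: "P \<in> APD n \<omega>" and x: "crosses n P i j x"
  shows "fst x = i \<or> snd x = inv \<omega> j"
  using crossing_row_or_column[OF \<omega> _ _ x] P unfolding APD_iff[OF \<omega>] by blast

lemma left_inversions_subset:
  assumes \<omega>: "\<omega> permutes {1..n}" and P: "P \<in> APD n \<omega>"
  shows "left_inversions n \<omega> P \<subseteq> row_inversions n P"
  using APD_crossing_row_or_column[OF \<omega> P]
  unfolding left_inversions_def row_inversions_def by fastforce

section \<open>A single flip between acyclic pipe dreams\<close>

text \<open>Normal form of an increasing flip: contact and crossing carry the same orientation,
  which encodes that the contact comes first. \<open>flip_rel_acyclic_flip\<close> brings every flip
  into this form.\<close>

locale acyclic_flip =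
  fixes n :: nat and \<omega> :: "nat \<Rightarrow> nat" and P P' :: "position set" and i j :: nat and x y :: position
  assumes \<omega>: "\<omega> permutes {1..n}" and P: "P \<in> APD n \<omega>" and P': "P' \<in> APD n \<omega>"
    and touch: "touches n P i j y" and cross: "crosses n P i j x" and P'_eq: "P' = insert y (P - {x})"
begin

lemma PD: "P \<in> PD n \<omega>" and PD': "P' \<in> PD n \<omega>"
  using P P' by (simp_all add: APD_iff[OF \<omega>])

lemmas sub = PD_D(1)[OF PD \<omega>] and sub' = PD_D(1)[OF PD' \<omega>]

lemma yx: "cell_time n y < cell_time n x"
  by (rule touches_before_crossing[OF \<omega> PD touch cross])

lemma cells: "y \<in> inner_cells n" "y \<notin> P" "x \<in> inner_cells n" "x \<in> P"
  using touch cross sub by (auto simp: touches_def crosses_def contacts_def)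

lemma mem: "z \<in> P' \<longleftrightarrow> z = y \<or> z \<in> P \<and> z \<noteq> x"
  using cells P'_eq by auto

text \<open>\<open>enters\<close> describes the state before a cell acts: at \<open>y\<close> the
  pipes still agree in \<open>P\<close> and \<open>P'\<close>, at \<open>x\<close> they are already
  exchanged.\<close>

definition window :: "position \<Rightarrow> bool" where
  "window u \<longleftrightarrow> cell_time n y < cell_time n u \<and> cell_time n u \<le> cell_time n x"

lemma enters': "enters n P' k u s \<longleftrightarrow> enters n P (if window u then transpose i j k else k) u s"
proof -
  have "pipes_meet n P i j y" "pipes_meet n P i j x"
    using touch cross by (auto simp: crosses_def touches_def pipes_meet_def)
  moreover have "P' = toggle (toggle P y) x" using cells P'_eq by (auto simp: toggle_def)
  ultimately show ?thesis
    using level_toggle2(3)[OF sub cells(1,3) _ _ yx, of i j k u s] unfolding window_def by simp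
qed

lemma cross': "crosses n P' i j y"
  using touch by (simp add: crosses_def touches_def enters' mem window_def)

lemma touch': "touches n P' j i x"
  using cross cells yx by (auto simp: crosses_def touches_def enters' contacts_def mem window_def)

lemma ij: "i \<noteq> j" "inv \<omega> i \<noteq> inv \<omega> j"
  using crosses_inversion[OF \<omega> PD cross] by (auto simp: inversions_def)

text \<open>Pipe \<open>i\<close> turns north at \<open>y\<close>, and pipe \<open>j\<close> came
  into \<open>y\<close> from the south, hence from a lower row.\<close>

lemma window_row:
  assumes "window u"
  shows "enters n P i u s \<Longrightarrow> fst u < i" "enters n P j u s \<Longrightarrow> fst u < j"
proof -
  have t: "cell_time n y < cell_time n u" using assms by (simp add: window_def)
  have y: "fst y \<le> i" "fst y < j"
    using touch enters_row_le[OF sub, of i y West] enters_row_le[OF sub, of j y South]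
    by (simp_all add: touches_def)
  show "fst u < i" if "enters n P i u s" using touches_then_above[OF sub touch that t] y by simp
  show "fst u < j" if "enters n P j u s"
    using enters_monotone(1)[OF sub, of j y South u s] touch that t y by (simp add: touches_def)
qed

text \<open>In \<open>P'\<close>, pipe \<open>i\<close> comes into the contact \<open>x\<close> from
  the south and still has to turn east. Pipe \<open>j\<close> comes into \<open>x\<close> from the
  west, so any earlier entrance from the south lies strictly left of \<open>x\<close>.\<close>

lemma window_column:
  assumes "window u"
  shows "enters n P' i u s \<Longrightarrow> snd u < inv \<omega> i" "enters n P' j u South \<Longrightarrow> snd u < inv \<omega> j"
proof -
  have t: "cell_time n u \<le> cell_time n x" using assms by (simp add: window_def)
  have x: "enters n P' j x West" "enters n P' i x South" "snd x \<le> inv \<omega> j" "snd x < inv \<omega> i"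
    using touch' exit_column(2)[OF \<omega> PD' touch'] by (simp_all add: touches_def)
  show "snd u < inv \<omega> i" if "enters n P' i u s"
    using enters_monotone(2)[OF sub' that x(2) t] x(4) by simp
  show "snd u < inv \<omega> j" if u: "enters n P' j u South"
  proof -
    have "cell_time n u + fst u = snd u + n" "cell_time n x + fst x = snd x + n"
      "level n P' (cell_time n u) j = Suc (fst u + snd u)" "level n P' (cell_time n x) j = fst x + snd x"
      using u x(1) by (auto simp: enters_iff[OF sub'] cell_time_def)
    then have "snd u < snd x" using level_mono(1)[OF t, of n P' j] by linarith
    then show ?thesis using x(3) by simp
  qed
qed

text \<open>
  If a third pipe \<open>k\<close> crosses \<open>i\<close> and \<open>j\<close> between \<open>y\<close> and \<open>x\<close>, the flip interchanges these two
  crossings. Each must lie in the starting row of its upper pipe or the exit column of its lower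
  pipe, both before and after the flip; as \<open>i\<close> and \<open>j\<close> have different exits and have already left
  their starting rows, both crossings lie in row \<open>k\<close> or both in the exit column of \<open>k\<close>.
\<close>
lemma crossing_moves:
  assumes z: "crosses n P p q z" and z': "crosses n P' p q z'" and ne: "(p, q) \<noteq> (i, j)"
  shows "z = z' \<or> fst z = p \<and> fst z' = p \<and> snd z' < inv \<omega> q \<or>
    snd z = inv \<omega> q \<and> snd z' = inv \<omega> q \<and> fst z < p"
proof -
  have zx: "z \<noteq> x" "z \<in> P"
    using z cross ne enters_unique[OF sub] unfolding crosses_def by blast+
  have z'y: "z' \<noteq> y" "z' \<in> P'"
    using z' cross' ne enters_unique[OF sub'] unfolding crosses_def by blast+
  have zP': "z \<in> P'" "z' \<in> P" using zx z'y mem by auto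
  consider (out) "\<not> window z" | (out') "\<not> window z'"
    | (other) "window z" "p \<notin> {i, j}" "q \<notin> {i, j}"
    | (both) "p \<in> {i, j}" "q \<in> {i, j}"
    | (upper) "window z" "window z'" "p \<notin> {i, j}" "q \<in> {i, j}"
    | (lower) "window z" "window z'" "p \<in> {i, j}" "q \<notin> {i, j}" by blast
  then show ?thesis
  proof cases
    case out
    then have "crosses n P' p q z" using z zP' by (simp add: crosses_def enters')
    then show ?thesis using crosses_unique[OF \<omega> PD' _ z'] by blast
  next
    case out'
    then have "crosses n P p q z'" using z' zP' by (simp add: crosses_def enters')
    then show ?thesis using crosses_unique[OF \<omega> PD z] by blast
  next
    case other
    then have "crosses n P' p q z" using z zP' by (simp add: crosses_def enters')
    then show ?thesis using crosses_unique[OF \<omega> PD' _ z'] by blast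
  next
    case both
    then have "p = j" "q = i" using ne crosses_levels(1)[OF sub z] by auto
    then show ?thesis using crosses_asym[OF \<omega> PD cross] z by blast
  next
    case upper
    have z2: "crosses n P' p (transpose i j q) z" using z zP' upper by (simp add: crosses_def enters')
    have z2': "crosses n P p (transpose i j q) z'" using z' zP' upper by (simp add: crosses_def enters')
    note D = APD_crossing_row_or_column[OF \<omega> P z] APD_crossing_row_or_column[OF \<omega> P' z']
      APD_crossing_row_or_column[OF \<omega> P' z2] APD_crossing_row_or_column[OF \<omega> P z2']
    have "fst z = p" "fst z' = p" using D upper(4) ij by auto
    moreover have "snd z' < inv \<omega> q" using window_column[OF upper(2)] upper(4) z' by (auto simp: crosses_def)
    ultimately show ?thesis by simp
  next
    case lower
    have z2: "crosses n P' (transpose i j p) q z" using z zP' lower by (simp add: crosses_def enters')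
    have z2': "crosses n P (transpose i j p) q z'" using z' zP' lower by (simp add: crosses_def enters')
    have row: "fst z < p" using window_row[OF lower(1)] z lower(3) by (auto simp: crosses_def)
    have row': "fst z' < transpose i j p"
      using window_row[OF lower(2)] z2' lower(3) ij by (auto simp: crosses_def)
    show ?thesis
      using APD_crossing_row_or_column[OF \<omega> P z] APD_crossing_row_or_column[OF \<omega> P z2'] row row' by simp
  qed
qed

lemma row_x: "fst x < i"
  using touches_then_above[OF sub touch, of x West] yx cross touch enters_row_le[OF sub, of i y West]
  by (simp add: crosses_def touches_def)

lemma flipped_not_row: "(i, j) \<notin> row_inversions n P"
  using row_x crosses_unique[OF \<omega> PD cross] unfolding row_inversions_def by fastforce

text \<open>In \<open>P\<close> pipe \<open>j\<close> leaves the contact \<open>y\<close> eastwards,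
  so the column of \<open>y\<close> is left of its exit.\<close>

lemma flipped_left: "(i, j) \<in> left_inversions n \<omega> P'"
  using cross' exit_column(2)[OF \<omega> PD touch] unfolding left_inversions_def by blast

lemma other_crossing:
  assumes "crosses n P p q z"
  obtains z' where "crosses n P' p q z'"
  using inversion_crosses[OF \<omega> PD' crosses_inversion[OF \<omega> PD assms]] by blast

lemma other_crossing':
  assumes "crosses n P' p q z'"
  obtains z where "crosses n P p q z"
  using inversion_crosses[OF \<omega> PD crosses_inversion[OF \<omega> PD' assms]] by blast

lemma row_inversions_mono: "row_inversions n P \<subseteq> row_inversions n P'"
proof (rule subrelI)
  fix p q assume pq: "(p, q) \<in> row_inversions n P"
  then obtain z where z: "crosses n P p q z" "fst z = p" unfolding row_inversions_def by blast
  obtain z' where z': "crosses n P' p q z'" by (rule other_crossing[OF z(1)])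
  have "(p, q) \<noteq> (i, j)" using pq flipped_not_row by auto
  then have "fst z' = p" using crossing_moves[OF z(1) z'] z(2) by auto
  then show "(p, q) \<in> row_inversions n P'" using z' unfolding row_inversions_def by blast
qed

lemma left_inversions_mono: "left_inversions n \<omega> P \<subseteq> left_inversions n \<omega> P'"
proof (rule subrelI)
  fix p q assume pq: "(p, q) \<in> left_inversions n \<omega> P"
  then obtain z where z: "crosses n P p q z" "snd z < inv \<omega> q" unfolding left_inversions_def by blast
  obtain z' where z': "crosses n P' p q z'" by (rule other_crossing[OF z(1)])
  show "(p, q) \<in> left_inversions n \<omega> P'"
  proof (cases "(p, q) = (i, j)")
    case False
    then have "snd z' < inv \<omega> q" using crossing_moves[OF z(1) z'] z(2) by auto
    then show ?thesis using z' unfolding left_inversions_def by blast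
  qed (use flipped_left in simp)
qed

text \<open>A crossing of any other pair that is left of the exit column in \<open>P'\<close> has
  either stayed or moved along its starting row. In both cases it was in that row before.\<close>

lemma only_flipped:
  assumes "(p, q) \<in> left_inversions n \<omega> P'" "(p, q) \<notin> row_inversions n P"
  shows "(p, q) = (i, j)"
proof (rule ccontr)
  assume ne: "(p, q) \<noteq> (i, j)"
  obtain z' where z': "crosses n P' p q z'" "snd z' < inv \<omega> q"
    using assms(1) unfolding left_inversions_def by blast
  obtain z where z: "crosses n P p q z" by (rule other_crossing'[OF z'(1)])
  have "fst z = p"
    using crossing_moves[OF z z'(1) ne] APD_crossing_row_or_column[OF \<omega> P z] z'(2) by auto
  then show False using assms(2) z unfolding row_inversions_def by blast
qed

end

text \<open>Weakly southwest implies not later in time, whereas a contact with the reversed arc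
  would come after the crossing.\<close>

lemma flip_rel_acyclic_flip:
  assumes \<omega>: "\<omega> permutes {1..n}" and flip: "(P, P') \<in> flip_rel n \<omega>"
  obtains i j x y where "acyclic_flip n \<omega> P P' i j x y"
proof -
  have APD: "P \<in> APD n \<omega>" "P' \<in> APD n \<omega>" and "increasing_flip n P P'"
    using flip by (auto simp: flip_rel_def)
  then have PD: "P \<in> PD n \<omega>" by (simp add: APD_iff[OF \<omega>])
  note P = PD_D[OF PD \<omega>]
  obtain i' j' y x where h: "pipes_touch_at n P i' j' y" "pipes_cross_at n P i' j' x"
    "fst y \<ge> fst x" "snd y \<le> snd x" "P' = insert y (P - {x})"
    using \<open>increasing_flip n P P'\<close> unfolding increasing_flip_def by blast
  obtain i j where x: "crosses n P i j x" and y: "touches n P i j y \<or> touches n P j i y"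
    using h(1,2) unfolding pipes_cross_at_iff pipes_touch_at_iff by blast
  have "cell_time n y \<le> cell_time n x" using h(3,4) by (simp add: cell_time_def)
  moreover have "i < j" using crosses_inversion[OF \<omega> PD x] by (simp add: inversions_def)
  ultimately have "\<not> touches n P j i y"
    using touches_after_crossing[OF \<omega> PD] crosses_unique[OF \<omega> PD x] by (metis not_less)
  then have "acyclic_flip n \<omega> P P' i j x y"
    using \<omega> APD x y h(5) by unfold_locales blast+
  then show thesis by (rule that)
qed

lemma flips_mono:
  assumes \<omega>: "\<omega> permutes {1..n}" and "(P, Q) \<in> (flip_rel n \<omega>)\<^sup>*"
  shows "row_inversions n P \<subseteq> row_inversions n Q" "left_inversions n \<omega> P \<subseteq> left_inversions n \<omega> Q"
proof -
  have "row_inversions n P \<subseteq> row_inversions n Q \<and> left_inversions n \<omega> P \<subseteq> left_inversions n \<omega> Q"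
    using assms(2)
  proof induction
    case (step Q R)
    obtain i j x y where "acyclic_flip n \<omega> Q R i j x y" by (rule flip_rel_acyclic_flip[OF \<omega> step.hyps(2)])
    then interpret acyclic_flip n \<omega> Q R i j x y .
    show ?case using step.IH row_inversions_mono left_inversions_mono by blast
  qed simp
  then show "row_inversions n P \<subseteq> row_inversions n Q" "left_inversions n \<omega> P \<subseteq> left_inversions n \<omega> Q" by auto
qed

text \<open>
  The flipped pair is the only pair that is not a row inversion of \<open>P\<close> and is a left inversion of
  \<open>P'\<close>; every flip on a path from \<open>P\<close> to \<open>P'\<close> would have to flip it.
\<close>
lemma flip_indecomposable:
  assumes \<omega>: "\<omega> permutes {1..n}" and flip: "(P, P') \<in> flip_rel n \<omega>"
    and 1: "(P, Q) \<in> flip_rel n \<omega>" and 2: "(Q, R) \<in> flip_rel n \<omega>" and 3: "(R, P') \<in> (flip_rel n \<omega>)\<^sup>*"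
  shows False
proof -
  obtain i j x y where "acyclic_flip n \<omega> P P' i j x y" by (rule flip_rel_acyclic_flip[OF \<omega> flip])
  then interpret a: acyclic_flip n \<omega> P P' i j x y .
  obtain i1 j1 x1 y1 where "acyclic_flip n \<omega> P Q i1 j1 x1 y1" by (rule flip_rel_acyclic_flip[OF \<omega> 1])
  then interpret b: acyclic_flip n \<omega> P Q i1 j1 x1 y1 .
  obtain i2 j2 x2 y2 where "acyclic_flip n \<omega> Q R i2 j2 x2 y2" by (rule flip_rel_acyclic_flip[OF \<omega> 2])
  then interpret c: acyclic_flip n \<omega> Q R i2 j2 x2 y2 .
  have QP: "left_inversions n \<omega> R \<subseteq> left_inversions n \<omega> P'" by (rule flips_mono(2)[OF \<omega> 3])
  have "(i1, j1) = (i, j)"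
    using a.only_flipped b.flipped_left c.left_inversions_mono QP b.flipped_not_row by blast
  moreover have "(i2, j2) = (i, j)"
    using a.only_flipped c.flipped_left QP c.flipped_not_row b.row_inversions_mono by blast
  ultimately have "(i2, j2) \<in> row_inversions n Q"
    using b.flipped_left left_inversions_subset[OF \<omega> b.P'] by auto
  then show False using c.flipped_not_row by blast
qed

section \<open>The largest linear extension\<close>

lemma row_inversions_subset:
  assumes "\<omega> permutes {1..n}" "P \<in> PD n \<omega>"
  shows "row_inversions n P \<subseteq> value_pairs n"
  using crosses_inversion[OF assms] inversions_subset unfolding row_inversions_def by blast

text \<open>Pipe \<open>j\<close> crosses \<open>k\<close> in row \<open>j\<close>, before it climbs
  to row \<open>i\<close> and meets \<open>i\<close>. At that moment \<open>k\<close> already has a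
  smaller level than \<open>j\<close>, hence than \<open>i\<close>, so \<open>i\<close> has crossed
  \<open>k\<close> earlier, which can only be in its starting row.\<close>

lemma trans_row_inversions:
  assumes \<omega>: "\<omega> permutes {1..n}" and PD: "P \<in> PD n \<omega>"
  shows "trans (row_inversions n P)"
proof (rule transI)
  note P = PD_D[OF PD \<omega>]
  fix i j k assume "(i, j) \<in> row_inversions n P" "(j, k) \<in> row_inversions n P"
  then obtain x1 x2 where x1: "crosses n P i j x1" "fst x1 = i" and x2: "crosses n P j k x2" "fst x2 = j"
    unfolding row_inversions_def by blast
  have less: "i < j" "j < k"
    using crosses_inversion[OF \<omega> PD x1(1)] crosses_inversion[OF \<omega> PD x2(1)] by (auto simp: inversions_def)
  have e: "enters n P i x1 West" "enters n P j x1 South" "enters n P j x2 West" "enters n P k x2 South"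
    using x1 x2 by (auto simp: crosses_def)
  have "cell_time n x2 < cell_time n x1"
    using enters_monotone(1)[OF P(1) e(2,3)] x1(2) x2(2) less by (meson not_less)
  then have "level n P (cell_time n x1) k < level n P (cell_time n x1) j"
    by (rule crosses_once_order(2)[OF P(1,2) x2(1)])
  then have "\<not> level n P (cell_time n x1) i < level n P (cell_time n x1) k"
    using e(1,2) by (simp add: enters_iff[OF P(1)])
  moreover have "level n P 0 i < level n P 0 k" using less by simp
  moreover have "i \<in> {1..n}" "k \<in> {1..n}" using enters_pipe[OF P(1)] e by blast+
  ultimately obtain z where z: "crosses n P i k z" "cell_time n z < cell_time n x1"
    using crossing_between[OF P(1), of i k 0 "cell_time n x1"] by blast
  have zi: "enters n P i z West" using z(1) by (simp add: crosses_def)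
  have "fst z = i"
    using enters_row_le[OF P(1) zi] enters_monotone(1)[OF P(1) zi e(1)] z(2) x1(2) by simp
  then show "(i, k) \<in> row_inversions n P" using z(1) unfolding row_inversions_def by blast
qed

text \<open>
  A row inversion may still be excluded by transitivity, so the row inversions need not form the
  inversion set of a permutation.
\<close>
definition top_extension :: "nat \<Rightarrow> position set \<Rightarrow> nat \<Rightarrow> nat" where
  "top_extension n P = (SOME \<pi>. \<pi> permutes {1..n} \<and>
    inversions n \<pi> = value_pairs n - (value_pairs n - row_inversions n P)\<^sup>+)"

text \<open>Pairs that are not row inversions are forced into increasing order, and so is their
  transitive closure; this bounds all linear extensions. The bound is itself an extension: an
  increasing arc is no row inversion, and a decreasing arc is inverted by any existing extension,
  hence lies outside the closure.\<close>

lemma top_extension: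
  assumes \<omega>: "\<omega> permutes {1..n}" and APD: "P \<in> APD n \<omega>"
  shows "top_extension n P permutes {1..n}"
    "inversions n (top_extension n P) = value_pairs n - (value_pairs n - row_inversions n P)\<^sup>+"
    "top_extension n P \<in> linear_extensions n P"
    "\<pi> \<in> linear_extensions n P \<Longrightarrow> inversions n \<pi> \<subseteq> inversions n (top_extension n P)"
proof -
  have PD: "P \<in> PD n \<omega>" and "linear_extensions n P \<noteq> {}" using APD by (auto simp: APD_iff[OF \<omega>])
  then obtain \<rho> where \<rho>: "\<rho> \<in> linear_extensions n P" by blast
  note P = PD_D[OF PD \<omega>]
  let ?C = "value_pairs n - row_inversions n P" and ?M = "top_extension n P"
  have "value_pairs n - ?C = row_inversions n P" using row_inversions_subset[OF \<omega> PD] by blast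
  then have "\<exists>\<pi>. \<pi> permutes {1..n} \<and> inversions n \<pi> = value_pairs n - ?C\<^sup>+"
    using inversions_diff_trancl[of ?C n] trans_row_inversions[OF \<omega> PD] by (metis Diff_subset)
  then have M: "?M permutes {1..n} \<and> inversions n ?M = value_pairs n - ?C\<^sup>+"
    unfolding top_extension_def by (rule someI_ex)
  then show Mp: "?M permutes {1..n}" and inv_M: "inversions n ?M = value_pairs n - ?C\<^sup>+" by auto
  have C: "inv \<pi> p < inv \<pi> q" if pq: "(p, q) \<in> ?C\<^sup>+" and \<pi>: "\<pi> \<in> linear_extensions n P" for \<pi> p q
  proof -
    have base: "inv \<pi> p < inv \<pi> q" if pq: "(p, q) \<in> ?C" for p q
    proof (rule precedes_if_crossing_above[OF \<omega> PD \<pi>])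
      show "(p, q) \<in> value_pairs n" using pq by simp
      fix z assume z: "crosses n P p q z"
      then have "fst z \<noteq> p" using pq unfolding row_inversions_def by blast
      moreover have "fst z \<le> p" using enters_row_le[OF P(1), of p z West] z by (simp add: crosses_def)
      ultimately show "fst z < p" by simp
    qed
    show ?thesis using pq by induction (use base less_trans in blast)+
  qed
  show "?M \<in> linear_extensions n P"
  proof -
    have "inv ?M a < inv ?M b" if t: "touches n P a b u" for a b u
    proof -
      have ab: "a \<in> {1..n}" "b \<in> {1..n}" using touches_pipes[OF P(1) t] by auto
      consider "a < b" | "a = b" | "b < a" by linarith
      then show ?thesis
      proof cases
        case 1
        \<comment> \<open>The crossing of the pair comes after the contact \<open>u\<close>, where
          \<open>a\<close> turns north, so it lies above row \<open>a\<close>.\<close>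
        have "(a, b) \<notin> row_inversions n P"
        proof
          assume "(a, b) \<in> row_inversions n P"
          then obtain z where z: "crosses n P a b z" "fst z = a" unfolding row_inversions_def by blast
          have "fst z < fst u"
            using touches_then_above[OF P(1) t, of z West] z(1) touches_before_crossing[OF \<omega> PD t z(1)]
            by (simp add: crosses_def)
          then show False using enters_row_le[OF P(1), of a u West] t z(2) by (simp add: touches_def)
        qed
        then have "(a, b) \<in> ?C" using 1 ab by (simp add: value_pairs_def)
        then have "(a, b) \<notin> inversions n ?M" using inv_M by (simp add: r_into_trancl')
        then show ?thesis using inv_less_iff[OF Mp, of a b] 1 ab by simp
      next
        case 2
        then show ?thesis using touches_levels(1,2)[OF P(1) t] by simp
      next
        case 3
        have "inv \<rho> a < inv \<rho> b" by (rule linear_extensions_touches[OF \<rho> t])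
        then have "(b, a) \<notin> ?C\<^sup>+" using C[OF _ \<rho>, of b a] by auto
        then have "(b, a) \<in> inversions n ?M" using inv_M 3 ab by (simp add: value_pairs_def)
        then show ?thesis by (simp add: inversions_def)
      qed
    qed
    then show ?thesis using Mp by (simp add: linear_extensions_iff)
  qed
  show "inversions n \<pi> \<subseteq> inversions n ?M" if \<pi>: "\<pi> \<in> linear_extensions n P"
  proof (rule subrelI)
    fix p q assume pq: "(p, q) \<in> inversions n \<pi>"
    then have "(p, q) \<notin> ?C\<^sup>+" using C[OF _ \<pi>, of p q] by (auto simp: inversions_def)
    then show "(p, q) \<in> inversions n ?M" using pq inv_M inversions_subset by blast
  qed
qed

lemma top_extension_le:
  assumes \<omega>: "\<omega> permutes {1..n}" and P: "P \<in> APD n \<omega>"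
  shows "inversions n (top_extension n P) \<subseteq> inversions n \<omega>"
  using linear_extension_inversions[OF \<omega> _ top_extension(3)[OF \<omega> P]] P by (simp add: APD_iff[OF \<omega>])

section \<open>Reachability by flips as an order, and its covers\<close>

text \<open>Flips enlarge the row inversions and so shrink the closure of their complement.
  Conversely, a chain ending at the largest extension of \<open>Q\<close> ends in \<open>Q\<close>
  itself by uniqueness.\<close>

lemma flips_iff:
  assumes \<omega>: "\<omega> permutes {1..n}" and P: "P \<in> APD n \<omega>" and Q: "Q \<in> APD n \<omega>"
  shows "(P, Q) \<in> (flip_rel n \<omega>)\<^sup>* \<longleftrightarrow>
    inversions n (top_extension n P) \<subseteq> inversions n (top_extension n Q)"
proof
  assume "(P, Q) \<in> (flip_rel n \<omega>)\<^sup>*"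
  then have "value_pairs n - row_inversions n Q \<subseteq> value_pairs n - row_inversions n P"
    using flips_mono(1)[OF \<omega>] by blast
  then show "inversions n (top_extension n P) \<subseteq> inversions n (top_extension n Q)"
    using top_extension(2)[OF \<omega> P] top_extension(2)[OF \<omega> Q] trancl_mono_subset by blast
next
  assume le: "inversions n (top_extension n P) \<subseteq> inversions n (top_extension n Q)"
  have PD: "P \<in> PD n \<omega>" "Q \<in> PD n \<omega>" using P Q by (auto simp: APD_iff[OF \<omega>])
  obtain R where "R \<in> PD n \<omega>" "top_extension n Q \<in> linear_extensions n R" "(P, R) \<in> (flip_rel n \<omega>)\<^sup>*"
    using flip_chain[OF \<omega> top_extension(1)[OF \<omega> Q] top_extension_le[OF \<omega> Q] PD(1) top_extension(3)[OF \<omega> P] le]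
    by blast
  moreover from this have "R = Q" using PD_unique[OF \<omega> _ PD(2)] top_extension(3)[OF \<omega> Q] by blast
  ultimately show "(P, Q) \<in> (flip_rel n \<omega>)\<^sup>*" by simp
qed

lemma flips_if_le:
  assumes \<omega>: "\<omega> permutes {1..n}" and P: "P \<in> APD n \<omega>" and Q: "Q \<in> APD n \<omega>"
    and \<pi>: "\<pi> \<in> linear_extensions n P" and \<sigma>: "\<sigma> \<in> linear_extensions n Q"
    and le: "inversions n \<pi> \<subseteq> inversions n \<sigma>"
  shows "(P, Q) \<in> (flip_rel n \<omega>)\<^sup>*"
proof -
  have PD: "P \<in> PD n \<omega>" "Q \<in> PD n \<omega>" using P Q by (auto simp: APD_iff[OF \<omega>])
  obtain R where "R \<in> PD n \<omega>" "\<sigma> \<in> linear_extensions n R" "(P, R) \<in> (flip_rel n \<omega>)\<^sup>*"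
    using flip_chain[OF \<omega> linear_extensions_permutes[OF \<sigma>] linear_extension_inversions[OF \<omega> PD(2) \<sigma>] PD(1) \<pi> le]
    by blast
  moreover from this have "R = Q" using PD_unique[OF \<omega> _ PD(2)] \<sigma> by blast
  ultimately show ?thesis by simp
qed

lemma flips_antisym:
  assumes \<omega>: "\<omega> permutes {1..n}" and P: "P \<in> APD n \<omega>" and Q: "Q \<in> APD n \<omega>"
    and "(P, Q) \<in> (flip_rel n \<omega>)\<^sup>*" "(Q, P) \<in> (flip_rel n \<omega>)\<^sup>*"
  shows "P = Q"
proof -
  have "top_extension n P = top_extension n Q"
    using assms(4,5) inversions_inject[OF top_extension(1)[OF \<omega> P] top_extension(1)[OF \<omega> Q]]
    unfolding flips_iff[OF \<omega> P Q] flips_iff[OF \<omega> Q P] by blast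
  then show ?thesis
    using PD_unique[OF \<omega>, of P Q "top_extension n P"] P Q
      top_extension(3)[OF \<omega> P] top_extension(3)[OF \<omega> Q] by (simp add: APD_iff[OF \<omega>])
qed

lemma flip_rel_neq:
  assumes \<omega>: "\<omega> permutes {1..n}" and "(P, Q) \<in> flip_rel n \<omega>"
  shows "P \<noteq> Q"
proof -
  obtain i j x y where "acyclic_flip n \<omega> P Q i j x y" by (rule flip_rel_acyclic_flip[OF assms])
  then interpret acyclic_flip n \<omega> P Q i j x y .
  show ?thesis using mem[of y] cells(2) by blast
qed

lemma flip_rel_iff_cover:
  assumes \<omega>: "\<omega> permutes {1..n}" and P: "P \<in> APD n \<omega>" and Q: "Q \<in> APD n \<omega>"
  shows "(P, Q) \<in> flip_rel n \<omega> \<longleftrightarrow> (P, Q) \<in> (flip_rel n \<omega>)\<^sup>* \<and> P \<noteq> Q \<and>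
    (\<forall>R \<in> APD n \<omega>. (P, R) \<in> (flip_rel n \<omega>)\<^sup>* \<longrightarrow> (R, Q) \<in> (flip_rel n \<omega>)\<^sup>* \<longrightarrow> R = P \<or> R = Q)"
    (is "_ \<longleftrightarrow> ?cover")
proof
  assume flip: "(P, Q) \<in> flip_rel n \<omega>"
  have "R = P \<or> R = Q"
    if R: "R \<in> APD n \<omega>" and PR: "(P, R) \<in> (flip_rel n \<omega>)\<^sup>*" and RQ: "(R, Q) \<in> (flip_rel n \<omega>)\<^sup>*" for R
  proof (rule ccontr)
    assume ne: "\<not> ?thesis"
    then obtain S where S: "(P, S) \<in> flip_rel n \<omega>" "(S, R) \<in> (flip_rel n \<omega>)\<^sup>*"
      using PR by (metis converse_rtranclE)
    have SQ: "(S, Q) \<in> (flip_rel n \<omega>)\<^sup>*" using S(2) RQ by simp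
    \<comment> \<open>If the first flip already reached \<open>Q\<close>, antisymmetry would
      identify \<open>R\<close> and \<open>Q\<close>. So the path has a second flip, against
      indecomposability.\<close>
    have "S \<noteq> Q" using flips_antisym[OF \<omega> R Q RQ] S(2) ne by blast
    then obtain T where "(S, T) \<in> flip_rel n \<omega>" "(T, Q) \<in> (flip_rel n \<omega>)\<^sup>*"
      using SQ by (metis converse_rtranclE)
    then show False using flip_indecomposable[OF \<omega> flip S(1)] by blast
  qed
  then show ?cover using flip flip_rel_neq[OF \<omega> flip] by blast
next
  assume c: ?cover
  then obtain S where S: "(P, S) \<in> flip_rel n \<omega>" "(S, Q) \<in> (flip_rel n \<omega>)\<^sup>*" by (metis converse_rtranclE)
  then have "S \<in> APD n \<omega>" by (simp add: flip_rel_def)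
  then have "S = P \<or> S = Q" using c S by blast
  then show "(P, Q) \<in> flip_rel n \<omega>" using S(1) flip_rel_neq[OF \<omega> S(1)] by blast
qed

section \<open>The lattice quotient\<close>

lemma mem_weak_interval:
  "\<pi> \<in> carrier (weak_interval n \<omega>) \<longleftrightarrow> \<pi> permutes {1..n} \<and> inversions n \<pi> \<subseteq> inversions n \<omega>"
  by (auto simp: weak_interval_def weak_le_def inversions_def)

lemma linear_extensions_inject:
  assumes \<omega>: "\<omega> permutes {1..n}" and P: "P \<in> APD n \<omega>" and Q: "Q \<in> APD n \<omega>"
    and \<pi>: "\<pi> \<in> linear_extensions n P" "\<pi> \<in> linear_extensions n Q"
  shows "P = Q"
  using PD_unique[OF \<omega> _ _ \<pi>] P Q by (simp add: APD_iff[OF \<omega>])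

lemma inj_on_linear_extensions:
  assumes \<omega>: "\<omega> permutes {1..n}"
  shows "inj_on (linear_extensions n) (APD n \<omega>)"
proof (rule inj_onI)
  fix P Q assume PQ: "P \<in> APD n \<omega>" "Q \<in> APD n \<omega>" "linear_extensions n P = linear_extensions n Q"
  then obtain \<pi> where "\<pi> \<in> linear_extensions n P" by (auto simp: APD_iff[OF \<omega>])
  then show "P = Q" using linear_extensions_inject[OF \<omega> PQ(1,2)] PQ(3) by simp
qed

lemma linear_extensions_subset:
  assumes \<omega>: "\<omega> permutes {1..n}" and P: "P \<in> APD n \<omega>"
  shows "linear_extensions n P \<subseteq> carrier (weak_interval n \<omega>)"
  using linear_extension_inversions[OF \<omega>] linear_extensions_permutes P
  by (auto simp: mem_weak_interval APD_iff[OF \<omega>])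

lemma congruence_class:
  assumes \<omega>: "\<omega> permutes {1..n}" and P: "P \<in> APD n \<omega>" and \<pi>: "\<pi> \<in> linear_extensions n P"
  shows "pd_congruence n \<omega> `` {\<pi>} = linear_extensions n P"
  using linear_extensions_inject[OF \<omega> P _ \<pi>] linear_extensions_subset[OF \<omega> P] P \<pi>
  unfolding pd_congruence_def by blast

lemma carrier_quotient:
  assumes \<omega>: "\<omega> permutes {1..n}"
  shows "carrier (pd_quotient n \<omega>) = linear_extensions n ` APD n \<omega>"
proof -
  let ?I = "carrier (weak_interval n \<omega>)"
  have "?I // pd_congruence n \<omega> = linear_extensions n ` APD n \<omega>"
  proof (intro equalityI subsetI)
    fix X assume "X \<in> ?I // pd_congruence n \<omega>"
    then obtain \<pi> where \<pi>: "\<pi> \<in> ?I" "X = pd_congruence n \<omega> `` {\<pi>}" by (rule quotientE)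
    obtain P where P: "P \<in> APD n \<omega>" "\<pi> \<in> linear_extensions n P"
      using exists_PD[OF \<omega>] \<pi>(1) unfolding mem_weak_interval by blast
    then show "X \<in> linear_extensions n ` APD n \<omega>" using congruence_class[OF \<omega> P] \<pi>(2) by blast
  next
    fix X assume "X \<in> linear_extensions n ` APD n \<omega>"
    then obtain P where P: "P \<in> APD n \<omega>" "X = linear_extensions n P" by blast
    then obtain \<pi> where \<pi>: "\<pi> \<in> linear_extensions n P" by (auto simp: APD_iff[OF \<omega>])
    then have "\<pi> \<in> ?I" using linear_extensions_subset[OF \<omega> P(1)] by blast
    then show "X \<in> ?I // pd_congruence n \<omega>"
      using quotientI[of \<pi> ?I "pd_congruence n \<omega>"] congruence_class[OF \<omega> P(1) \<pi>] P(2) by simp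
  qed
  then show ?thesis by (simp add: pd_quotient_def quotient_order_def)
qed

text \<open>Comparable representatives yield a flip path; for the converse the largest extensions
  serve as representatives.\<close>

lemma le_quotient:
  assumes \<omega>: "\<omega> permutes {1..n}" and P: "P \<in> APD n \<omega>" and Q: "Q \<in> APD n \<omega>"
  shows "linear_extensions n P \<sqsubseteq>\<^bsub>pd_quotient n \<omega>\<^esub> linear_extensions n Q \<longleftrightarrow> (P, Q) \<in> (flip_rel n \<omega>)\<^sup>*"
proof -
  have "linear_extensions n P \<sqsubseteq>\<^bsub>pd_quotient n \<omega>\<^esub> linear_extensions n Q \<longleftrightarrow>
      (\<exists>\<pi>\<in>linear_extensions n P. \<exists>\<sigma>\<in>linear_extensions n Q. inversions n \<pi> \<subseteq> inversions n \<sigma>)"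
    by (simp add: pd_quotient_def quotient_order_def weak_interval_def weak_le_def)
  also have "\<dots> \<longleftrightarrow> (P, Q) \<in> (flip_rel n \<omega>)\<^sup>*"
    using flips_if_le[OF \<omega> P Q] flips_iff[OF \<omega> P Q] top_extension(3)[OF \<omega> P] top_extension(3)[OF \<omega> Q]
    by blast
  finally show ?thesis .
qed

lemma arcs_hasse_quotient:
  assumes \<omega>: "\<omega> permutes {1..n}"
  shows "arcs (hasse_diagram (pd_quotient n \<omega>)) =
    map_prod (linear_extensions n) (linear_extensions n) ` flip_rel n \<omega>"
proof -
  let ?L = "linear_extensions n" and ?Q = "pd_quotient n \<omega>"
  have less: "?L P \<sqsubset>\<^bsub>?Q\<^esub> ?L R \<longleftrightarrow> (P, R) \<in> (flip_rel n \<omega>)\<^sup>* \<and> P \<noteq> R"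
    if "P \<in> APD n \<omega>" "R \<in> APD n \<omega>" for P R
    using le_quotient[OF \<omega> that] inj_on_eq_iff[OF inj_on_linear_extensions[OF \<omega>] that]
    by (simp add: lless_def) (simp add: pd_quotient_def quotient_order_def)
  have arc: "(?L P, ?L R) \<in> arcs (hasse_diagram ?Q) \<longleftrightarrow> (P, R) \<in> flip_rel n \<omega>"
    if P: "P \<in> APD n \<omega>" and R: "R \<in> APD n \<omega>" for P R
  proof -
    have "(?L P, ?L R) \<in> arcs (hasse_diagram ?Q) \<longleftrightarrow> ?L P \<sqsubset>\<^bsub>?Q\<^esub> ?L R \<and>
        \<not> (\<exists>S\<in>APD n \<omega>. ?L P \<sqsubset>\<^bsub>?Q\<^esub> ?L S \<and> ?L S \<sqsubset>\<^bsub>?Q\<^esub> ?L R)"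
      using P R by (auto simp: hasse_diagram_def carrier_quotient[OF \<omega>])
    also have "\<dots> \<longleftrightarrow> (P, R) \<in> flip_rel n \<omega>"
      unfolding flip_rel_iff_cover[OF \<omega> P R] using less P R by (metis (no_types, lifting))
    finally show ?thesis .
  qed
  have sub: "arcs (hasse_diagram ?Q) \<subseteq> ?L ` APD n \<omega> \<times> ?L ` APD n \<omega>"
    by (auto simp: hasse_diagram_def carrier_quotient[OF \<omega>])
  show ?thesis
  proof (intro equalityI subsetI)
    fix a assume a: "a \<in> arcs (hasse_diagram ?Q)"
    then obtain P R where PR: "P \<in> APD n \<omega>" "R \<in> APD n \<omega>" "a = (?L P, ?L R)" using sub by blast
    then have "(P, R) \<in> flip_rel n \<omega>" using arc a by simp
    then show "a \<in> map_prod ?L ?L ` flip_rel n \<omega>" using PR(3) by (simp add: rev_image_eqI)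
  next
    fix a assume "a \<in> map_prod ?L ?L ` flip_rel n \<omega>"
    then obtain P R where PR: "(P, R) \<in> flip_rel n \<omega>" "a = (?L P, ?L R)" by auto
    then show "a \<in> arcs (hasse_diagram ?Q)" using arc[of P R] by (simp add: flip_rel_def)
  qed
qed

lemma reachable_flip_graph:
  "reachable (increasing_flip_graph n \<omega>) P Q \<longleftrightarrow>
    P \<in> APD n \<omega> \<and> Q \<in> APD n \<omega> \<and> (P, Q) \<in> (flip_rel n \<omega>)\<^sup>*"
proof -
  have ends: "arcs_ends (increasing_flip_graph n \<omega>) = flip_rel n \<omega>"
    by (auto simp: arcs_ends_conv increasing_flip_graph_def flip_rel_def)
  have verts: "verts (increasing_flip_graph n \<omega>) = APD n \<omega>" by (simp add: increasing_flip_graph_def)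
  have "P \<in> APD n \<omega> \<and> Q \<in> APD n \<omega> \<and> (P, Q) \<in> (flip_rel n \<omega>)\<^sup>*" if "(P, Q) \<in> rtrancl_on (APD n \<omega>) (flip_rel n \<omega>)"
    using that by induction (auto intro: rtrancl_into_rtrancl)
  moreover have "(P, Q) \<in> rtrancl_on (APD n \<omega>) (flip_rel n \<omega>)" if "(P, Q) \<in> (flip_rel n \<omega>)\<^sup>*" "P \<in> APD n \<omega>"
    using that by induction (auto intro: rtrancl_on_into_rtrancl_on simp: flip_rel_def)
  ultimately show ?thesis unfolding reachable_def ends verts by blast
qed

text \<open>The join or meet \<open>\<rho>\<close> of two largest extensions is not claimed to be
  largest in its class. It is only used as a representative of the class of \<open>R\<close>, which
  \<open>below\<close> and \<open>above\<close> show to be enough.\<close>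

lemma lattice_flips:
  assumes \<omega>: "\<omega> permutes {1..n}"
  shows "lattice (closure_order (increasing_flip_graph n \<omega>))" (is "lattice ?L")
proof -
  have car: "carrier ?L = APD n \<omega>" by (simp add: closure_order_def increasing_flip_graph_def)
  have le: "P \<sqsubseteq>\<^bsub>?L\<^esub> Q \<longleftrightarrow> inversions n (top_extension n P) \<subseteq> inversions n (top_extension n Q)"
    if "P \<in> APD n \<omega>" "Q \<in> APD n \<omega>" for P Q
    using that flips_iff[OF \<omega> that] by (simp add: closure_order_def reachable_flip_graph)
  have eq: "eq ?L = (=)" by (simp add: closure_order_def)
  have ext: "(P, Q) \<in> (flip_rel n \<omega>)\<^sup>* \<longleftrightarrow> P \<sqsubseteq>\<^bsub>?L\<^esub> Q" if "P \<in> APD n \<omega>" "Q \<in> APD n \<omega>" for P Q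
    using that by (simp add: closure_order_def reachable_flip_graph)
  have below: "P \<sqsubseteq>\<^bsub>?L\<^esub> R" if P: "P \<in> APD n \<omega>" and R: "R \<in> APD n \<omega>" and \<rho>: "\<rho> \<in> linear_extensions n R"
    and "inversions n (top_extension n P) \<subseteq> inversions n \<rho>" for P R \<rho>
    using flips_if_le[OF \<omega> P R top_extension(3)[OF \<omega> P] \<rho>] that(4) ext[OF P R] by blast
  have above: "R \<sqsubseteq>\<^bsub>?L\<^esub> P" if P: "P \<in> APD n \<omega>" and R: "R \<in> APD n \<omega>" and \<rho>: "\<rho> \<in> linear_extensions n R"
    and "inversions n \<rho> \<subseteq> inversions n (top_extension n P)" for P R \<rho>
    using flips_if_le[OF \<omega> R P \<rho> top_extension(3)[OF \<omega> P]] that(4) ext[OF R P] by blast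
  interpret partial_order ?L
  proof
    show "x \<sqsubseteq>\<^bsub>?L\<^esub> x" if "x \<in> carrier ?L" for x using that le by (simp add: car)
    show "x .=\<^bsub>?L\<^esub> y" if "x \<sqsubseteq>\<^bsub>?L\<^esub> y" "y \<sqsubseteq>\<^bsub>?L\<^esub> x" "x \<in> carrier ?L" "y \<in> carrier ?L" for x y
      using that flips_antisym[OF \<omega>] ext by (simp add: car eq)
    show "x \<sqsubseteq>\<^bsub>?L\<^esub> z" if "x \<sqsubseteq>\<^bsub>?L\<^esub> y" "y \<sqsubseteq>\<^bsub>?L\<^esub> z" "x \<in> carrier ?L" "y \<in> carrier ?L" "z \<in> carrier ?L" for x y z
      using that le by (auto simp: car)
  qed (auto simp: eq)
  show ?thesis
  proof
    fix P Q assume "P \<in> carrier ?L" "Q \<in> carrier ?L"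
    then have PQ: "P \<in> APD n \<omega>" "Q \<in> APD n \<omega>" by (simp_all add: car)
    note top = top_extension(1)[OF \<omega> PQ(1)] top_extension(1)[OF \<omega> PQ(2)]
    show "\<exists>s. least ?L s (Upper ?L {P, Q})"
    proof -
      obtain \<rho> where \<rho>: "\<rho> permutes {1..n}" and join: "\<forall>\<tau>. inversions n \<rho> \<subseteq> inversions n \<tau> \<longleftrightarrow>
          inversions n (top_extension n P) \<subseteq> inversions n \<tau> \<and> inversions n (top_extension n Q) \<subseteq> inversions n \<tau>"
        by (rule weak_join[OF top]) simp
      obtain R where R: "R \<in> APD n \<omega>" "\<rho> \<in> linear_extensions n R"
        using exists_PD[OF \<omega> \<rho>] join[THEN spec, of \<omega>] top_extension_le[OF \<omega>] PQ by blast
      have "P \<sqsubseteq>\<^bsub>?L\<^esub> R" "Q \<sqsubseteq>\<^bsub>?L\<^esub> R" using below[OF _ R] PQ join[THEN spec, of \<rho>] by blast+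
      moreover have "R \<sqsubseteq>\<^bsub>?L\<^esub> S" if "S \<in> APD n \<omega>" "P \<sqsubseteq>\<^bsub>?L\<^esub> S" "Q \<sqsubseteq>\<^bsub>?L\<^esub> S" for S
        using above[OF that(1) R] join[THEN spec, of "top_extension n S"] that le PQ by blast
      ultimately have "least ?L R (Upper ?L {P, Q})" using R(1) PQ by (auto simp: least_def Upper_def car)
      then show ?thesis by blast
    qed
    show "\<exists>s. greatest ?L s (Lower ?L {P, Q})"
    proof -
      obtain \<rho> where \<rho>: "\<rho> permutes {1..n}" and meet: "\<forall>\<tau>. \<tau> permutes {1..n} \<longrightarrow>
          (inversions n \<tau> \<subseteq> inversions n \<rho> \<longleftrightarrow>
          inversions n \<tau> \<subseteq> inversions n (top_extension n P) \<and> inversions n \<tau> \<subseteq> inversions n (top_extension n Q))"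
        by (rule weak_meet[OF top]) simp
      obtain R where R: "R \<in> APD n \<omega>" "\<rho> \<in> linear_extensions n R"
        using exists_PD[OF \<omega> \<rho>] meet[rule_format, OF \<rho>] top_extension_le[OF \<omega> PQ(1)] by blast
      have "R \<sqsubseteq>\<^bsub>?L\<^esub> P" "R \<sqsubseteq>\<^bsub>?L\<^esub> Q" using above[OF _ R] PQ meet[rule_format, OF \<rho>] by blast+
      moreover have "S \<sqsubseteq>\<^bsub>?L\<^esub> R" if "S \<in> APD n \<omega>" "S \<sqsubseteq>\<^bsub>?L\<^esub> P" "S \<sqsubseteq>\<^bsub>?L\<^esub> Q" for S
        using below[OF that(1) R] meet[rule_format, OF top_extension(1)[OF \<omega> that(1)]] that le PQ by blast
      ultimately have "greatest ?L R (Lower ?L {P, Q})" using R(1) PQ by (auto simp: greatest_def Lower_def car)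
      then show ?thesis by blast
    qed
  qed
qed

theorem theorem3p15:
  fixes n :: nat and \<omega> :: "nat \<Rightarrow> nat"
  assumes "n \<ge> 1" and "\<omega> permutes {1..n}"
  shows "bij_betw (linear_extensions n) (APD n \<omega>) (carrier (pd_quotient n \<omega>)) \<and>
    pre_digraph.digraph_isomorphism (hasse_diagram (pd_quotient n \<omega>)) (class_to_pd_iso n \<omega>) \<and>
    app_iso (class_to_pd_iso n \<omega>) (hasse_diagram (pd_quotient n \<omega>)) = increasing_flip_graph n \<omega> \<and>
    lattice (closure_order (increasing_flip_graph n \<omega>))"
proof -
  note \<omega> = assms(2)
  let ?L = "linear_extensions n" and ?c = "class_to_pd n \<omega>" and ?H = "hasse_diagram (pd_quotient n \<omega>)"
  have bij: "bij_betw ?L (APD n \<omega>) (carrier (pd_quotient n \<omega>))"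
    using inj_on_linear_extensions[OF \<omega>] carrier_quotient[OF \<omega>] by (simp add: bij_betw_def)
  have c: "?c (?L P) = P" if "P \<in> APD n \<omega>" for P
    using the_inv_into_f_f[OF inj_on_linear_extensions[OF \<omega>] that] by (simp add: class_to_pd_def)
  have verts: "verts ?H = ?L ` APD n \<omega>" by (simp add: hasse_diagram_def carrier_quotient[OF \<omega>])
  have ends: "tail ?H = fst" "head ?H = snd" by (simp_all add: hasse_diagram_def)
  have sub: "arcs ?H \<subseteq> verts ?H \<times> verts ?H" by (auto simp: hasse_diagram_def)
  have wf: "wf_digraph ?H" using sub by unfold_locales (auto simp: ends)
  have inj: "inj_on ?c (verts ?H)" using c by (auto simp: verts inj_on_def)
  have arcs: "map_prod ?c ?c ` arcs ?H = flip_rel n \<omega>"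
  proof -
    have "map_prod ?c ?c (map_prod ?L ?L a) = a" if "a \<in> flip_rel n \<omega>" for a
      using that c by (cases a) (simp add: flip_rel_def)
    then have "(\<lambda>a. map_prod ?c ?c (map_prod ?L ?L a)) ` flip_rel n \<omega> = (\<lambda>a. a) ` flip_rel n \<omega>"
      by (rule image_cong[OF refl])
    then show ?thesis by (simp only: arcs_hasse_quotient[OF \<omega>] image_image image_ident)
  qed
  have "inj_on (map_prod ?c ?c) (arcs ?H)"
    by (rule inj_on_subset[OF map_prod_inj_on[OF inj inj] sub])
  then have iso: "pre_digraph.digraph_isomorphism ?H (class_to_pd_iso n \<omega>)"
    using wf inj by (auto simp: pre_digraph.digraph_isomorphism_def class_to_pd_iso_def ends)
  have "?c ` verts ?H = APD n \<omega>" using c by (auto simp: verts image_image)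
  then have "app_iso (class_to_pd_iso n \<omega>) ?H = increasing_flip_graph n \<omega>"
    using arcs by (simp add: app_iso_def class_to_pd_iso_def increasing_flip_graph_def flip_rel_def)
  then show ?thesis using bij iso lattice_flips[OF \<omega>] by blast
qed

end
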